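(* Let $\alpha>0$ be a real number, let $(\lambda_n)_{n\ge 1}$ be a sequence of positive real numbers, and let $T_{n,\lambda_n}$ be the connected component of the distinguished vertex $\mathbf{o}$ in the $\lambda_n$-massive spanning forest $\boldsymbol{\lambda_n}\mathbf{SF}(\mathbf{K}_n)$ of the complete graph $\mathbf{K}_n$. Then, in the sense of local convergence in distribution as $n\to\infty$: \begin{itemize} \item if $\lambda_n=o(n)$, then $\mathrm{Shape}(T_{n,\lambda_n},\mathbf{o})$ converges to $\mathcal{T}_0$; \item if $\lambda_n\sim\alpha n$, then $\mathrm{Shape}(T_{n,\lambda_n},\mathbf{o})$ converges to $\mathcal{T}_\alpha$; \item if $\lambda_n\gg n$ (i.e. $\lambda_n/n\to\infty$), then $\mathrm{Shape}(T_{n,\lambda_n},\mathbf{o})$ converges to the tree $\{\mathbf{o}\}$ reduced to a single vertex. \end{itemize}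
   Context: Massive spanning forest: a spanning forest of a finite graph $G$ without self-loops is a subgraph of $G$ without cycles containing all the vertices of $G$; $\mathcal{F}(G)$ is the set of spanning forests of $G$. For $f\in\mathcal{F}(G)$, $C(f)$ is the set of connected components (trees) of $f$, and for a tree $t$, $|t|$ is its number of vertices. For $\lambda>0$, the $\lambda$-massive spanning forest $\boldsymbol{\lambda}\mathbf{SF}(G)$ is the random element of $\mathcal{F}(G)$ with law $$\mathbf{P}(\boldsymbol{\lambda}\mathbf{SF}(G)=f)\ \propto\ \lambda^{|C(f)|}\prod_{t\in C(f)}|t| ,\qquad f\in\mathcal{F}(G).$$ $\mathbf{K}_n$ is the complete graph with $n$ vertices, with a distinguished vertex $\mathbf{o}$. For a labeled tree $T$ containing $\mathbf{o}$, $\mathrm{Shape}(T,\mathbf{o})$ is the non-planar unlabeled tree obtained from $T$, rooted at $\mathbf{o}$ (i.e. the isomorphism class of the rooted tree $(T,\mathbf{o})$). $\mathrm{BGWP}(\beta)$ is the Bienaymé–Galton–Watson tree with reproduction law $\mathrm{Poisson}(\beta)$, started from a single root individual. The random tree $\mathcal{T}_0$ is obtained by growing independent unconditioned $\mathrm{BGWP}(1)$ trees, one on each vertex of a semi-infinite line started at $\mathbf{o}$ (the root of each $\mathrm{BGWP}(1)$ tree being identified with the corresponding vertex of the line), and is rooted at $\mathbf{o}$. For $\alpha>0$, the random tree $\mathcal{T}_\alpha$ is obtained by growing independent unconditioned $\mathrm{BGWP}\left(\frac{1}{1+\alpha}\right)$ trees, one on each vertex of a spine (a finite path started at $\mathbf{o}$),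 where the number $L$ of vertices of the spine is independent of these trees with law $\mathrm{Geom}\left(\frac{\alpha}{1+\alpha}\right)$, that is $\mathbf{P}(L=k)=\frac{\alpha}{(1+\alpha)^{k}}$ for $k\ge 1$; it is rooted at $\mathbf{o}$. Both are regarded as non-planar unlabeled rooted trees. Local convergence: for a rooted tree $T$ and an integer $h\ge 0$, $T_{\le h}$ is the subtree of $T$ induced by the vertices at distance at most $h$ from the root. A sequence of random locally finite rooted unlabeled trees $T^{(n)}$ converges locally in distribution to a random locally finite rooted unlabeled tree $T$ if for every $h\ge 0$ and every finite rooted unlabeled tree $t$ of height at most $h$, $\mathbf{P}(T^{(n)}_{\le h}=t)\to\mathbf{P}(T_{\le h}=t)$. *)

theory Defs
  imports "HOL-Probability.Probability" "HOL-Library.Landau_Symbols"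
begin

section \<open>Graphs, forests and rooted trees\<close>

record 'a ugraph =
  verts :: "'a set"
  edges :: "'a set set"

record 'a rgraph = "'a ugraph" +
  rt :: 'a

definition adj :: "('a, 'z) ugraph_scheme \<Rightarrow> 'a \<Rightarrow> 'a \<Rightarrow> bool" where
  "adj G x y \<longleftrightarrow> {x, y} \<in> edges G"

definition simple_graph :: "('a, 'z) ugraph_scheme \<Rightarrow> bool" where
  "simple_graph G \<longleftrightarrow> (\<forall>e \<in> edges G. e \<subseteq> verts G \<and> card e = 2)"

definition connected_graph :: "('a, 'z) ugraph_scheme \<Rightarrow> bool" where
  "connected_graph G \<longleftrightarrow> (\<forall>x \<in> verts G. \<forall>y \<in> verts G. (adj G)\<^sup>*\<^sup>* x y)"

definition is_cycle :: "('a, 'z) ugraph_scheme \<Rightarrow> 'a list \<Rightarrow> bool" where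
  "is_cycle G c \<longleftrightarrow> 3 \<le> length c \<and> distinct c \<and> successively (adj G) c \<and> adj G (last c) (hd c)"

definition spanning_forests :: "'a ugraph \<Rightarrow> 'a ugraph set" where
  "spanning_forests G = {f. verts f = verts G \<and> edges f \<subseteq> edges G \<and> (\<nexists>c. is_cycle f c)}"

definition graph_component :: "'a ugraph \<Rightarrow> 'a \<Rightarrow> 'a ugraph" where
  "graph_component G v =
     (let C = {w \<in> verts G. (adj G)\<^sup>*\<^sup>* v w} in \<lparr>verts = C, edges = {e \<in> edges G. e \<subseteq> C}\<rparr>)"

definition graph_components :: "'a ugraph \<Rightarrow> 'a ugraph set" where
  "graph_components G = graph_component G ` verts G"

definition rooted_component :: "'a ugraph \<Rightarrow> 'a \<Rightarrow> 'a rgraph" where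
  "rooted_component G v =
     \<lparr>verts = verts (graph_component G v), edges = edges (graph_component G v), rt = v\<rparr>"

definition rooted_tree :: "'a rgraph \<Rightarrow> bool" where
  "rooted_tree T \<longleftrightarrow>
     simple_graph T \<and> connected_graph T \<and> (\<nexists>c. is_cycle T c) \<and> rt T \<in> verts T"

definition graph_dist :: "('a, 'z) ugraph_scheme \<Rightarrow> 'a \<Rightarrow> 'a \<Rightarrow> enat" where
  "graph_dist G x y = (INF k \<in> {k. (adj G ^^ k) x y}. enat k)"

definition trunc :: "nat \<Rightarrow> 'a rgraph \<Rightarrow> 'a rgraph" where
  "trunc h T =
     (let B = {v \<in> verts T. graph_dist T (rt T) v \<le> enat h}
      in \<lparr>verts = B, edges = {e \<in> edges T. e \<subseteq> B}, rt = rt T\<rparr>)"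

definition height_le :: "'a rgraph \<Rightarrow> nat \<Rightarrow> bool" where
  "height_le T h \<longleftrightarrow> (\<forall>v \<in> verts T. graph_dist T (rt T) v \<le> enat h)"


section \<open>Unlabeled rooted trees\<close>

definition rooted_iso :: "'a rgraph \<Rightarrow> 'b rgraph \<Rightarrow> bool" where
  "rooted_iso T T' \<longleftrightarrow>
     (\<exists>\<phi>. bij_betw \<phi> (verts T) (verts T') \<and> \<phi> (rt T) = rt T' \<and>
          edges T' = (\<lambda>e. \<phi> ` e) ` edges T)"

text \<open>
  An unlabeled rooted tree is the class of all its copies with vertices in \<^typ>\<open>nat\<close>.
  Locally finite trees are countable, so this class is nonempty and determines the tree up to
  root-preserving isomorphism.
\<close>

type_synonym utree = "nat rgraph set"

definition shape :: "'a rgraph \<Rightarrow> utree" where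
  "shape T = {t. rooted_iso T t}"

text \<open>All members of the union below coincide when \<open>\<tau>\<close> is an isomorphism class.\<close>

definition utrunc :: "nat \<Rightarrow> utree \<Rightarrow> utree" where
  "utrunc h \<tau> = (\<Union>t \<in> \<tau>. shape (trunc h t))"

definition finite_utrees :: "nat \<Rightarrow> utree set" where
  "finite_utrees h =
     {shape t | t :: nat rgraph. rooted_tree t \<and> finite (verts t) \<and> height_le t h}"

definition converges_locally ::
    "(nat \<Rightarrow> 'a measure) \<Rightarrow> (nat \<Rightarrow> 'a \<Rightarrow> utree) \<Rightarrow> 'b measure \<Rightarrow> ('b \<Rightarrow> utree) \<Rightarrow> bool" where
  "converges_locally M X M' X' \<longleftrightarrow>
     (\<forall>h. \<forall>\<tau> \<in> finite_utrees h.
        (\<lambda>n. \<P>(\<omega> in M n. utrunc h (X n \<omega>) = \<tau>)) \<longlonglongrightarrow> \<P>(\<omega> in M'. utrunc h (X' \<omega>) = \<tau>))"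


section \<open>Massive spanning forests\<close>

definition forest_weight :: "real \<Rightarrow> 'a ugraph \<Rightarrow> real" where
  "forest_weight lam f = lam ^ card (graph_components f) *
     (\<Prod>t \<in> graph_components f. real (card (verts t)))"

definition massive_SF :: "real \<Rightarrow> 'a ugraph \<Rightarrow> 'a ugraph pmf" where
  "massive_SF lam G = embed_pmf (\<lambda>f.
     if f \<in> spanning_forests G
     then forest_weight lam f / (\<Sum>g \<in> spanning_forests G. forest_weight lam g) else 0)"

definition complete_graph :: "nat \<Rightarrow> nat ugraph" where
  "complete_graph n = \<lparr>verts = {..<n}, edges = {e. e \<subseteq> {..<n} \<and> card e = 2}\<rparr>"


section \<open>The limit trees\<close>

text \<open>
  Bienayme--Galton--Watson trees in Ulam--Harris coding: individuals are words, the children of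
  \<open>u\<close> are \<open>u @ [0], \<dots>, u @ [N u - 1]\<close>, and the offspring numbers \<open>N u\<close> are independent.
\<close>

definition BGW_tree :: "(nat list \<Rightarrow> nat) \<Rightarrow> nat list rgraph" where
  "BGW_tree N =
     (let V = {u. \<forall>k < length u. u ! k < N (take k u)}
      in \<lparr>verts = V, edges = {{u, u @ [j]} | u j. u @ [j] \<in> V}, rt = []\<rparr>)"

definition BGWP :: "real \<Rightarrow> (nat list \<Rightarrow> nat) measure" where
  "BGWP \<beta> = (\<Pi>\<^sub>M u \<in> UNIV. measure_pmf (poisson_pmf \<beta>))"

text \<open>
  The spine has \<open>L \<le> \<infinity>\<close> vertices; its vertex number \<open>i\<close> is the copy \<open>(i, rt (T i))\<close> of the root
  of \<open>T i\<close>.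
\<close>

definition graft_on_spine :: "enat \<Rightarrow> (nat \<Rightarrow> 'a rgraph) \<Rightarrow> (nat \<times> 'a) rgraph" where
  "graft_on_spine L T =
     \<lparr>verts = {(i, u). enat i < L \<and> u \<in> verts (T i)},
      edges = {Pair i ` e | i e. enat i < L \<and> e \<in> edges (T i)} \<union>
              {{(i, rt (T i)), (Suc i, rt (T (Suc i)))} | i. enat (Suc i) < L},
      rt = (0, rt (T 0))\<rparr>"

definition tree0_space :: "(nat \<Rightarrow> nat list \<Rightarrow> nat) measure" where
  "tree0_space = (\<Pi>\<^sub>M i \<in> UNIV. BGWP 1)"

definition tree0 :: "(nat \<Rightarrow> nat list \<Rightarrow> nat) \<Rightarrow> (nat \<times> nat list) rgraph" where
  "tree0 \<omega> = graft_on_spine \<infinity> (\<lambda>i. BGW_tree (\<omega> i))"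

text \<open>\<^const>\<open>geometric_pmf\<close> lives on \<open>{0, 1, \<dots>}\<close>, hence the shift.\<close>

definition spine_length :: "real \<Rightarrow> nat pmf" where
  "spine_length \<alpha> = map_pmf Suc (geometric_pmf (\<alpha> / (1 + \<alpha>)))"

definition tree_alpha_space :: "real \<Rightarrow> (nat \<times> (nat \<Rightarrow> nat list \<Rightarrow> nat)) measure" where
  "tree_alpha_space \<alpha> = measure_pmf (spine_length \<alpha>) \<Otimes>\<^sub>M (\<Pi>\<^sub>M i \<in> UNIV. BGWP (1 / (1 + \<alpha>)))"

definition tree_alpha :: "nat \<times> (nat \<Rightarrow> nat list \<Rightarrow> nat) \<Rightarrow> (nat \<times> nat list) rgraph" where
  "tree_alpha = (\<lambda>(L, \<omega>). graft_on_spine (enat L) (\<lambda>i. BGW_tree (\<omega> i)))"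

definition single_vertex :: "nat rgraph" where
  "single_vertex = \<lparr>verts = {0}, edges = {}, rt = 0\<rparr>"


section \<open>The definitions are well-behaved\<close>

lemma rooted_iso_refl: "rooted_iso T T"
  unfolding rooted_iso_def by (intro exI[of _ id]) auto

lemma rooted_iso_sym:
  assumes "simple_graph T" "rooted_iso T T'" "rt T \<in> verts T"
  shows "rooted_iso T' T"
proof -
  obtain p where p: "bij_betw p (verts T) (verts T')" "p (rt T) = rt T'"
    "edges T' = (\<lambda>e. p ` e) ` edges T"
    using assms(2) by (auto simp: rooted_iso_def)
  let ?q = "inv_into (verts T) p"
  have inj: "inj_on p (verts T)" using p(1) by (rule bij_betw_imp_inj_on)
  have "?q ` p ` e = e" if "e \<in> edges T" for e
    using that assms(1) inj by (intro inv_into_image_cancel) (auto simp: simple_graph_def)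
  then have "edges T = (\<lambda>e. ?q ` e) ` edges T'"
    unfolding p(3) by (simp add: image_image)
  moreover have "?q (rt T') = rt T"
    using inv_into_f_f[OF inj assms(3)] p(2) by simp
  ultimately show ?thesis
    unfolding rooted_iso_def by (intro exI[of _ ?q] conjI bij_betw_inv_into[OF p(1)])
qed

lemma rooted_iso_trans:
  assumes "rooted_iso A B" "rooted_iso B C"
  shows "rooted_iso A C"
proof -
  obtain p q where pq: "bij_betw p (verts A) (verts B)" "p (rt A) = rt B"
    "edges B = (\<lambda>e. p ` e) ` edges A"
    "bij_betw q (verts B) (verts C)" "q (rt B) = rt C"
    "edges C = (\<lambda>e. q ` e) ` edges B"
    using assms unfolding rooted_iso_def by metis
  have "bij_betw (q \<circ> p) (verts A) (verts C)"
    using pq(1,4) by (rule bij_betw_trans)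
  moreover have "(q \<circ> p) (rt A) = rt C"
    by (simp add: pq(2,5))
  moreover have "edges C = (\<lambda>e. (q \<circ> p) ` e) ` edges A"
    by (simp add: pq(3,6) image_image)
  ultimately show ?thesis
    unfolding rooted_iso_def by (intro exI[of _ "q \<circ> p"] conjI)
qed

lemma shape_eq_iff:
  fixes t :: "nat rgraph"
  assumes "simple_graph T" "rt T \<in> verts T"
  shows "shape T = shape t \<longleftrightarrow> rooted_iso T t"
proof
  assume "shape T = shape t"
  then show "rooted_iso T t"
    using rooted_iso_refl[of t] by (auto simp: shape_def)
next
  assume "rooted_iso T t"
  then show "shape T = shape t"
    unfolding shape_def
    using rooted_iso_sym[OF assms(1) _ assms(2)] rooted_iso_trans[of T t] rooted_iso_trans[of t T]
    by blast
qed

lemma relpowp_adj_verts: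
  assumes "simple_graph T" "x \<in> verts T" "(adj T ^^ k) x y"
  shows "y \<in> verts T"
  using assms(3)
proof (cases k)
  case 0
  then show ?thesis using assms by simp
next
  case (Suc m)
  then obtain z where "adj T z y" using assms(3) by auto
  then show ?thesis using assms(1) by (auto simp: adj_def simple_graph_def)
qed

lemma graph_dist_le_iff: "graph_dist G x y \<le> enat h \<longleftrightarrow> (\<exists>k\<le>h. (adj G ^^ k) x y)"
proof -
  have "graph_dist G x y \<le> enat h \<longleftrightarrow> graph_dist G x y < enat (Suc h)"
    by (cases "graph_dist G x y") auto
  also have "\<dots> \<longleftrightarrow> (\<exists>k\<le>h. (adj G ^^ k) x y)"
    unfolding graph_dist_def by (auto simp: INF_less_iff less_Suc_eq_le)
  finally show ?thesis .
qed

lemma rooted_iso_trunc: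
  assumes "simple_graph T" "rt T \<in> verts T" "rooted_iso T T'"
  shows "rooted_iso (trunc h T) (trunc h T')"
proof -
  obtain p where p: "bij_betw p (verts T) (verts T')" "p (rt T) = rt T'"
    "edges T' = (\<lambda>e. p ` e) ` edges T"
    using assms(3) by (auto simp: rooted_iso_def)
  have inj: "inj_on p (verts T)" using p(1) by (rule bij_betw_imp_inj_on)
  have sub: "e \<subseteq> verts T" if "e \<in> edges T" for e
    using that assms(1) by (auto simp: simple_graph_def)
  have edge: "p ` e \<in> edges T' \<longleftrightarrow> e \<in> edges T" if "e \<subseteq> verts T" for e
    using inj_on_image_eq_iff[OF inj that sub] p(3) by auto
  have sub': "e \<subseteq> verts T'" if "e \<in> edges T'" for e
    using that sub p(1,3) by (fastforce dest: bij_betw_apply)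
  have walk: "(adj T' ^^ k) (rt T') (p y) \<longleftrightarrow> (adj T ^^ k) (rt T) y" if "y \<in> verts T" for k y
    using that
  proof (induction k arbitrary: y)
    case 0
    then show ?case using p(2) assms(2) inj by (auto dest: inj_onD)
  next
    case (Suc k)
    have adj: "adj T' (p z) (p y) \<longleftrightarrow> adj T z y" if "z \<in> verts T" for z
      using edge[of "{z, y}"] that Suc.prems by (simp add: adj_def)
    show ?case
    proof
      assume "(adj T' ^^ Suc k) (rt T') (p y)"
      then obtain z' where z': "(adj T' ^^ k) (rt T') z'" "adj T' z' (p y)" by auto
      then have "z' \<in> verts T'" using sub' by (auto simp: adj_def)
      then obtain z where "z \<in> verts T" "z' = p z"
        using p(1) by (auto simp: bij_betw_def)
      then show "(adj T ^^ Suc k) (rt T) y"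
        using z' Suc.IH adj by auto
    next
      assume "(adj T ^^ Suc k) (rt T) y"
      then obtain z where z: "(adj T ^^ k) (rt T) z" "adj T z y" by auto
      then have "z \<in> verts T" using sub by (auto simp: adj_def)
      then show "(adj T' ^^ Suc k) (rt T') (p y)"
        using z Suc.IH adj by auto
    qed
  qed
  have V: "p ` verts (trunc h T) = verts (trunc h T')"
  proof -
    have VT: "verts T' = p ` verts T" using p(1) by (simp add: bij_betw_def)
    have "verts (trunc h T') = {y \<in> p ` verts T. \<exists>k\<le>h. (adj T' ^^ k) (rt T') y}"
      by (simp add: trunc_def Let_def graph_dist_le_iff VT)
    also have "\<dots> = p ` {v \<in> verts T. \<exists>k\<le>h. (adj T' ^^ k) (rt T') (p v)}"
      by blast
    also have "{v \<in> verts T. \<exists>k\<le>h. (adj T' ^^ k) (rt T') (p v)} =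
        {v \<in> verts T. \<exists>k\<le>h. (adj T ^^ k) (rt T) v}"
      by (simp add: walk cong: conj_cong)
    also have "\<dots> = verts (trunc h T)"
      by (simp add: trunc_def Let_def graph_dist_le_iff)
    finally show ?thesis ..
  qed
  have le: "verts (trunc h T) \<subseteq> verts T" by (auto simp: trunc_def Let_def)
  have "edges (trunc h T') = {e \<in> edges T'. e \<subseteq> p ` verts (trunc h T)}"
    unfolding V by (simp add: trunc_def Let_def)
  also have "\<dots> = (\<lambda>e. p ` e) ` {e \<in> edges T. e \<subseteq> verts (trunc h T)}"
    unfolding p(3) using inj_on_image_subset_iff[OF inj sub le] by auto
  also have "{e \<in> edges T. e \<subseteq> verts (trunc h T)} = edges (trunc h T)"
    by (simp add: trunc_def Let_def)
  finally have "edges (trunc h T') = (\<lambda>e. p ` e) ` edges (trunc h T)" .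
  moreover have "bij_betw p (verts (trunc h T)) (verts (trunc h T'))"
    using V inj_on_subset[OF inj le] by (simp add: bij_betw_def)
  moreover have "p (rt (trunc h T)) = rt (trunc h T')"
    using p(2) by (simp add: trunc_def Let_def)
  ultimately show ?thesis
    unfolding rooted_iso_def by (intro exI[of _ p] conjI)
qed

lemma simple_graph_trunc: "simple_graph T \<Longrightarrow> simple_graph (trunc h T)"
  by (auto simp: simple_graph_def trunc_def Let_def)

lemma root_trunc: "rt T \<in> verts T \<Longrightarrow> rt (trunc h T) \<in> verts (trunc h T)"
  by (auto simp: trunc_def Let_def graph_dist_le_iff intro!: exI[of _ 0])

lemma utrunc_shape:
  fixes T :: "'a::countable rgraph"
  assumes "simple_graph T" "rt T \<in> verts T"
  shows "utrunc h (shape T) = shape (trunc h T)"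
proof -
  define t where
    "t = \<lparr>verts = to_nat ` verts T, edges = (\<lambda>e. to_nat ` e) ` edges T, rt = to_nat (rt T)\<rparr>"
  have "rooted_iso T t"
    unfolding rooted_iso_def t_def by (intro exI[of _ to_nat]) (auto simp: bij_betw_def)
  moreover have "shape (trunc h s) = shape (trunc h T)" if "rooted_iso T s" for s :: "nat rgraph"
    using that assms shape_eq_iff rooted_iso_trunc simple_graph_trunc root_trunc by metis
  ultimately show ?thesis
    unfolding utrunc_def by (auto simp: shape_def)
qed

lemma pred_const: "Measurable.pred M (\<lambda>_. c)"
  by simp

text \<open>The events in \<open>converges_locally\<close> are measurable.\<close>

lemma measurable_shape_trunc:
  fixes R :: "'w \<Rightarrow> 'a::countable rgraph" and t :: "nat rgraph"
  assumes simple: "\<And>\<omega>. simple_graph (R \<omega>)"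
    and root: "\<And>\<omega>. rt (R \<omega>) = r" "\<And>\<omega>. r \<in> verts (R \<omega>)"
    and vM: "\<And>v. Measurable.pred M (\<lambda>\<omega>. v \<in> verts (R \<omega>))"
    and eM: "\<And>e. Measurable.pred M (\<lambda>\<omega>. e \<in> edges (R \<omega>))"
    and fin: "finite (verts t)"
  shows "{\<omega> \<in> space M. utrunc h (shape (R \<omega>)) = shape t} \<in> sets M"
proof -
  let ?T = "\<lambda>\<omega>. trunc h (R \<omega>)"
  have walk: "Measurable.pred M (\<lambda>\<omega>. (adj (R \<omega>) ^^ k) r v)" for k v
  proof (induction k arbitrary: v)
    case 0
    show ?case by simp
  next
    case (Suc k)
    have "(\<lambda>\<omega>. (adj (R \<omega>) ^^ Suc k) r v) =
        (\<lambda>\<omega>. \<exists>b. (adj (R \<omega>) ^^ k) r b \<and> {b, v} \<in> edges (R \<omega>))"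
      by (simp add: relcompp_apply adj_def)
    then show ?case
      by (simp only:) (intro pred_intros_countable(2) pred_intros_logic(3) Suc.IH eM)
  qed
  have vT: "Measurable.pred M (\<lambda>\<omega>. v \<in> verts (?T \<omega>))" for v
  proof -
    have "(\<lambda>\<omega>. v \<in> verts (?T \<omega>)) =
        (\<lambda>\<omega>. v \<in> verts (R \<omega>) \<and> (\<exists>k \<in> {..h}. (adj (R \<omega>) ^^ k) r v))"
      by (auto simp: trunc_def Let_def graph_dist_le_iff root)
    then show ?thesis
      by (simp only:) (intro pred_intros_logic(3) pred_intros_finite(4) finite_atMost vM walk)
  qed
  have eT: "Measurable.pred M (\<lambda>\<omega>. e \<in> edges (?T \<omega>))" for e
  proof -
    have "(\<lambda>\<omega>. e \<in> edges (?T \<omega>)) =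
        (\<lambda>\<omega>. e \<in> edges (R \<omega>) \<and> (\<forall>v. v \<in> e \<longrightarrow> v \<in> verts (?T \<omega>)))"
      by (auto simp: trunc_def Let_def)
    then show ?thesis
      by (simp only:) (intro pred_intros_logic(3) pred_intros_countable(1) pred_intros_imp' eM vT)
  qed
  define K where "K = {(V, E). finite V \<and> E \<in> Pow (Pow V) \<and>
    rooted_iso \<lparr>verts = V, edges = E, rt = r\<rparr> t}"
  define Q where "Q = (\<lambda>\<omega> x. (\<forall>v. v \<in> verts (?T \<omega>) \<longleftrightarrow> v \<in> fst x) \<and>
    (\<forall>e \<in> Pow (fst x). e \<in> edges (?T \<omega>) \<longleftrightarrow> e \<in> snd x))"
  have eq: "utrunc h (shape (R \<omega>)) = shape t \<longleftrightarrow> (\<exists>x \<in> K. Q \<omega> x)" for \<omega>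
  proof -
    have rt: "rt (?T \<omega>) = r" by (simp add: trunc_def Let_def root)
    have T: "\<lparr>verts = verts (?T \<omega>), edges = edges (?T \<omega>), rt = r\<rparr> = ?T \<omega>"
      by (simp add: trunc_def Let_def root)
    have sub: "edges (?T \<omega>) \<subseteq> Pow (verts (?T \<omega>))"
      by (auto simp: trunc_def Let_def)
    have Q: "Q \<omega> x \<longleftrightarrow> x = (verts (?T \<omega>), edges (?T \<omega>))" if "x \<in> K" for x
    proof -
      have "snd x \<subseteq> Pow (fst x)" using that by (cases x) (simp add: K_def)
      moreover have "(\<forall>v. v \<in> verts (?T \<omega>) \<longleftrightarrow> v \<in> fst x) \<longleftrightarrow> fst x = verts (?T \<omega>)" by blast
      moreover have "(\<forall>e \<in> Pow (fst x). e \<in> edges (?T \<omega>) \<longleftrightarrow> e \<in> snd x) \<longleftrightarrow>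
          Pow (fst x) \<inter> edges (?T \<omega>) = Pow (fst x) \<inter> snd x" by blast
      ultimately show ?thesis
        using sub unfolding Q_def by (cases x) (auto simp: Int_absorb1)
    qed
    have root': "rt (R \<omega>) \<in> verts (R \<omega>)" by (simp add: root)
    have "utrunc h (shape (R \<omega>)) = shape t \<longleftrightarrow> rooted_iso (?T \<omega>) t"
      unfolding utrunc_shape[OF simple root']
      by (intro shape_eq_iff simple_graph_trunc root_trunc simple root')
    also have "\<dots> \<longleftrightarrow> (verts (?T \<omega>), edges (?T \<omega>)) \<in> K"
    proof -
      have "finite (verts (?T \<omega>))" if "rooted_iso (?T \<omega>) t"
        using that fin unfolding rooted_iso_def by (auto dest: bij_betw_finite)
      moreover have "rooted_iso \<lparr>verts = verts (?T \<omega>), edges = edges (?T \<omega>), rt = r\<rparr> t =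
          rooted_iso (?T \<omega>) t"
        using rt by (simp add: rooted_iso_def)
      ultimately show ?thesis
        using sub unfolding K_def by blast
    qed
    also have "\<dots> \<longleftrightarrow> (\<exists>x \<in> K. Q \<omega> x)"
      using Q by blast
    finally show ?thesis .
  qed
  have "K \<subseteq> Sigma {V. finite V} (\<lambda>V. Pow (Pow V))" by (auto simp: K_def)
  moreover have "countable (Sigma {V :: 'a set. finite V} (\<lambda>V. Pow (Pow V)))"
    by (intro countable_SIGMA countable_Collect_finite) (auto intro: countable_finite)
  ultimately have K: "countable K" by (rule countable_subset)
  have "{\<omega> \<in> space M. Q \<omega> x} \<in> sets M" if "x \<in> K" for x
  proof -
    have f: "finite (Pow (fst x))" using that by (auto simp: K_def)
    have "Measurable.pred M (\<lambda>\<omega>. \<forall>e \<in> Pow (fst x). e \<in> edges (?T \<omega>) \<longleftrightarrow> e \<in> snd x)"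
      by (intro pred_intros_finite(3)[OF f] pred_intros_logic(6) eT pred_const)
    moreover have "Measurable.pred M (\<lambda>\<omega>. \<forall>v. v \<in> verts (?T \<omega>) \<longleftrightarrow> v \<in> fst x)"
      by (intro pred_intros_countable(1) pred_intros_logic(6) vT pred_const)
    ultimately have "Measurable.pred M (\<lambda>\<omega>. Q \<omega> x)"
      unfolding Q_def by (rule pred_intros_logic(3)[rotated])
    then show ?thesis by (simp add: pred_def)
  qed
  then have "(\<Union>x \<in> K. {\<omega> \<in> space M. Q \<omega> x}) \<in> sets M"
    by (intro sets.countable_UN'' K)
  also have "(\<Union>x \<in> K. {\<omega> \<in> space M. Q \<omega> x}) = {\<omega> \<in> space M. \<exists>x \<in> K. Q \<omega> x}"
    by auto
  finally show ?thesis
    by (simp add: eq)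
qed

lemma finite_spanning_forests:
  assumes "finite (verts G)" "simple_graph G"
  shows "finite (spanning_forests G)"
proof -
  have "edges G \<subseteq> Pow (verts G)"
    using assms(2) by (auto simp: simple_graph_def)
  then have "finite (edges G)"
    using assms(1) finite_subset by blast
  moreover have "spanning_forests G \<subseteq> (\<lambda>E. \<lparr>verts = verts G, edges = E\<rparr>) ` Pow (edges G)"
    by (auto simp: spanning_forests_def image_iff intro!: ugraph.equality)
  ultimately show ?thesis
    by (meson finite_Pow_iff finite_imageI finite_subset)
qed

lemma forest_weight_pos:
  assumes "finite (verts f)" "lam > 0"
  shows "forest_weight lam f > 0"
proof -
  have "0 < card (verts t)" if t: "t \<in> graph_components f" for t
  proof -
    from t obtain v where "v \<in> verts f" "t = graph_component f v"
      by (auto simp: graph_components_def)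
    then have "v \<in> verts t" "finite (verts t)"
      using assms(1) by (auto simp: graph_component_def Let_def)
    then show ?thesis
      by (auto simp: card_gt_0_iff)
  qed
  then show ?thesis
    using assms(2) unfolding forest_weight_def by (intro mult_pos_pos prod_pos) auto
qed

lemma pmf_massive_SF:
  assumes "finite (verts G)" "simple_graph G" "lam > 0"
  shows "pmf (massive_SF lam G) f =
    (if f \<in> spanning_forests G
     then forest_weight lam f / (\<Sum>g \<in> spanning_forests G. forest_weight lam g) else 0)"
proof -
  let ?S = "spanning_forests G" and ?w = "forest_weight lam"
  let ?p = "\<lambda>f. if f \<in> ?S then ?w f / sum ?w ?S else 0"
  have fin: "finite ?S"
    using assms finite_spanning_forests by blast
  have pos: "?w f > 0" if "f \<in> ?S" for f
    using that assms by (intro forest_weight_pos) (auto simp: spanning_forests_def)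
  have "\<not> is_cycle \<lparr>verts = verts G, edges = {}\<rparr> c" for c
    by (auto simp: is_cycle_def adj_def)
  then have "\<lparr>verts = verts G, edges = {}\<rparr> \<in> ?S"
    by (auto simp: spanning_forests_def)
  then have Z: "sum ?w ?S > 0"
    using fin pos by (intro sum_pos) auto
  have nonneg: "0 \<le> ?p f" for f
    using Z pos[of f] by (simp add: less_imp_le)
  have "(\<integral>\<^sup>+ f. ennreal (?p f) \<partial>count_space UNIV) = (\<Sum>f\<in>?S. ennreal (?p f))"
    by (rule nn_integral_count_space'[OF fin]) auto
  also have "\<dots> = ennreal (\<Sum>f\<in>?S. ?p f)"
    by (intro sum_ennreal nonneg)
  also have "(\<Sum>f\<in>?S. ?p f) = 1"
    using Z by (simp flip: sum_divide_distrib)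
  finally have "(\<integral>\<^sup>+ f. ennreal (?p f) \<partial>count_space UNIV) = 1"
    by simp
  then show ?thesis
    unfolding massive_SF_def by (intro pmf_embed_pmf[OF nonneg])
qed

lemma pmf_spine_length:
  assumes "\<alpha> > 0" "k \<ge> 1"
  shows "pmf (spine_length \<alpha>) k = \<alpha> / (1 + \<alpha>) ^ k"
proof -
  obtain m where k: "k = Suc m"
    using assms(2) by (cases k) auto
  have "1 - \<alpha> / (1 + \<alpha>) = 1 / (1 + \<alpha>)"
    using assms(1) by (simp add: field_simps)
  then show ?thesis
    using assms(1) unfolding spine_length_def k
    by (subst pmf_map_inj') (auto simp: power_one_over)
qed

lemma simple_graph_BGW_tree: "simple_graph (BGW_tree N)"
proof -
  have "u \<in> verts (BGW_tree N)" if "u @ [j] \<in> verts (BGW_tree N)" for u j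
    using that
    by (fastforce simp: BGW_tree_def Let_def nth_append dest: spec[of _ "_ :: nat"] split: if_splits)
  then show ?thesis
    by (auto simp: simple_graph_def BGW_tree_def Let_def card_insert_if)
qed

lemma simple_graph_graft_on_spine:
  assumes "\<And>i. simple_graph (T i)" "\<And>i. rt (T i) \<in> verts (T i)"
  shows "simple_graph (graft_on_spine L T)"
  unfolding simple_graph_def
proof
  fix e assume "e \<in> edges (graft_on_spine L T)"
  then consider i e' where "e = Pair i ` e'" "enat i < L" "e' \<in> edges (T i)"
    | i where "e = {(i, rt (T i)), (Suc i, rt (T (Suc i)))}" "enat (Suc i) < L"
    by (auto simp: graft_on_spine_def)
  then show "e \<subseteq> verts (graft_on_spine L T) \<and> card e = 2"
  proof cases
    case 1
    have "card e = card e'"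
      unfolding 1(1) by (intro card_image) (auto simp: inj_on_def)
    then show ?thesis
      using 1 assms(1)[of i] by (auto simp: graft_on_spine_def simple_graph_def)
  next
    case 2
    have "enat i < enat (Suc i)" by simp
    then have "enat i < L" using 2(2) by (rule less_trans)
    then show ?thesis
      using 2 assms(2) by (simp add: graft_on_spine_def)
  qed
qed

lemma BGW_tree_verts_iff: "u \<in> verts (BGW_tree N) \<longleftrightarrow> (\<forall>k. k < length u \<longrightarrow> u ! k < N (take k u))"
  by (simp add: BGW_tree_def)

lemma BGW_tree_edges_iff:
  "e \<in> edges (BGW_tree N) \<longleftrightarrow> (\<exists>u j. e = {u, u @ [j]} \<and> u @ [j] \<in> verts (BGW_tree N))"
  by (auto simp: BGW_tree_def Let_def)

lemma root_BGW_tree: "rt (BGW_tree N) = []"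
  by (simp add: BGW_tree_def)

lemma graft_BGW_edges_iff:
  "e \<in> edges (graft_on_spine L (\<lambda>i. BGW_tree (\<omega> i))) \<longleftrightarrow>
     (\<exists>i u j. e = Pair i ` {u, u @ [j]} \<and> enat i < L \<and> u @ [j] \<in> verts (BGW_tree (\<omega> i))) \<or>
     (\<exists>i. e = {(i, []), (Suc i, [])} \<and> enat (Suc i) < L)"
  unfolding graft_on_spine_def by (auto simp: BGW_tree_edges_iff root_BGW_tree) blast+

lemma measurable_BGW [measurable]:
  "Measurable.pred (\<Pi>\<^sub>M i \<in> (UNIV :: nat set). BGWP \<beta>) (\<lambda>\<omega>. u \<in> verts (BGW_tree (\<omega> i)))"
proof -
  have [measurable]: "(\<lambda>\<omega>. \<omega> i w) \<in> (\<Pi>\<^sub>M i \<in> (UNIV :: nat set). BGWP \<beta>) \<rightarrow>\<^sub>M count_space UNIV" for w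
  proof (rule measurable_compose[where f = "\<lambda>\<omega>. \<omega> i"])
    show "(\<lambda>\<omega>. \<omega> i) \<in> (\<Pi>\<^sub>M i \<in> (UNIV :: nat set). BGWP \<beta>) \<rightarrow>\<^sub>M BGWP \<beta>"
      by (rule measurable_component_singleton) simp
    have "(\<lambda>x. x w) \<in> BGWP \<beta> \<rightarrow>\<^sub>M measure_pmf (poisson_pmf \<beta>)"
      unfolding BGWP_def by (rule measurable_component_singleton) simp
    then show "(\<lambda>x. x w) \<in> BGWP \<beta> \<rightarrow>\<^sub>M count_space UNIV"
      by (simp cong: measurable_cong_sets)
  qed
  show ?thesis
    unfolding BGW_tree_verts_iff by measurable
qed

lemma root_graft_BGW:
  "rt (graft_on_spine L (\<lambda>i. BGW_tree (\<omega> i))) = (0, [])"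
  "0 < L \<Longrightarrow> (0, []) \<in> verts (graft_on_spine L (\<lambda>i. BGW_tree (\<omega> i)))"
  by (auto simp: graft_on_spine_def BGW_tree_def zero_enat_def)

lemma measurable_tree0_event:
  assumes "\<tau> \<in> finite_utrees h"
  shows "{\<omega> \<in> space tree0_space. utrunc h (shape (tree0 \<omega>)) = \<tau>} \<in> sets tree0_space"
proof -
  obtain t :: "nat rgraph" where t: "\<tau> = shape t" "finite (verts t)"
    using assms by (auto simp: finite_utrees_def)
  have [measurable]: "Measurable.pred tree0_space (\<lambda>\<omega>. u \<in> verts (BGW_tree (\<omega> i)))" for i u
    unfolding tree0_space_def by measurable
  show ?thesis unfolding t(1)
  proof (rule measurable_shape_trunc[where r = "(0, [])"])
    show "simple_graph (tree0 \<omega>)" for \<omega>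
      unfolding tree0_def
      by (intro simple_graph_graft_on_spine simple_graph_BGW_tree) (simp add: BGW_tree_def)
    show "rt (tree0 \<omega>) = (0, [])" "(0, []) \<in> verts (tree0 \<omega>)" for \<omega>
      by (auto simp: tree0_def root_graft_BGW)
    show "Measurable.pred tree0_space (\<lambda>\<omega>. v \<in> verts (tree0 \<omega>))" for v
      by (cases v) (simp add: tree0_def graft_on_spine_def)
    show "Measurable.pred tree0_space (\<lambda>\<omega>. e \<in> edges (tree0 \<omega>))" for e
      unfolding tree0_def graft_BGW_edges_iff by measurable
  qed (rule t(2))
qed

lemma measurable_tree_alpha_event:
  assumes "\<tau> \<in> finite_utrees h"
  shows "{\<omega> \<in> space (tree_alpha_space \<alpha>). utrunc h (shape (tree_alpha \<omega>)) = \<tau>} \<in> sets (tree_alpha_space \<alpha>)"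
proof -
  obtain t :: "nat rgraph" where t: "\<tau> = shape t" "finite (verts t)"
    using assms by (auto simp: finite_utrees_def)
  let ?P = "\<Pi>\<^sub>M i \<in> (UNIV :: nat set). BGWP (1 / (1 + \<alpha>))"
  have snd: "snd \<in> tree_alpha_space \<alpha> \<rightarrow>\<^sub>M ?P" unfolding tree_alpha_space_def by simp
  have [measurable]: "Measurable.pred (tree_alpha_space \<alpha>) (\<lambda>\<omega>. u \<in> verts (BGW_tree (snd \<omega> i)))" for i u
    by (rule measurable_compose[OF snd measurable_BGW])
  have "fst \<in> tree_alpha_space \<alpha> \<rightarrow>\<^sub>M measure_pmf (spine_length \<alpha>)" unfolding tree_alpha_space_def by simp
  then have [measurable]: "fst \<in> tree_alpha_space \<alpha> \<rightarrow>\<^sub>M count_space UNIV"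
    by (simp cong: measurable_cong_sets)
  have tree: "tree_alpha \<omega> = graft_on_spine (enat (fst \<omega>)) (\<lambda>i. BGW_tree (snd \<omega> i))" for \<omega>
    by (cases \<omega>) (simp add: tree_alpha_def)
  let ?R = "\<lambda>\<omega>. graft_on_spine (enat (max 1 (fst \<omega>))) (\<lambda>i. BGW_tree (snd \<omega> i))"
  have [measurable]: "{\<omega> \<in> space (tree_alpha_space \<alpha>). utrunc h (shape (?R \<omega>)) = \<tau>} \<in> sets (tree_alpha_space \<alpha>)"
    unfolding t(1)
  proof (rule measurable_shape_trunc[where r = "(0, [])"])
    show "simple_graph (?R \<omega>)" for \<omega>
      by (intro simple_graph_graft_on_spine simple_graph_BGW_tree) (simp add: BGW_tree_def)
    show "rt (?R \<omega>) = (0, [])" "(0, []) \<in> verts (?R \<omega>)" for \<omega>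
      by (auto simp: root_graft_BGW zero_enat_def)
    show "Measurable.pred (tree_alpha_space \<alpha>) (\<lambda>\<omega>. v \<in> verts (?R \<omega>))" for v
      by (cases v) (simp add: graft_on_spine_def)
    show "Measurable.pred (tree_alpha_space \<alpha>) (\<lambda>\<omega>. e \<in> edges (?R \<omega>))" for e
      unfolding graft_BGW_edges_iff by measurable
  qed (rule t(2))
  let ?E = "\<lparr>verts = {}, edges = {}, rt = (0, [])\<rparr> :: (nat \<times> nat list) rgraph"
  have "utrunc h (shape (tree_alpha \<omega>)) = \<tau> \<longleftrightarrow>
      (if fst \<omega> = 0 then utrunc h (shape ?E) = \<tau> else utrunc h (shape (?R \<omega>)) = \<tau>)" for \<omega>
  proof (cases "fst \<omega> = 0")
    case True
    then have "tree_alpha \<omega> = ?E"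
      by (simp add: tree graft_on_spine_def root_BGW_tree flip: zero_enat_def)
    then show ?thesis using True by simp
  next
    case False
    then have "max 1 (fst \<omega>) = fst \<omega>" by simp
    then show ?thesis using False by (simp add: tree)
  qed
  then show ?thesis by simp
qed

end

theory Submission
  imports Defs "HOL-Real_Asymp.Real_Asymp"
begin

text \<open>
  Let \<open>t\<close> be a finite rooted tree of height at most \<open>h\<close>, with \<open>a\<close> vertices, \<open>k\<close> of them at depth
  exactly \<open>h\<close>, and with \<open>\<sigma>\<close> automorphisms. The probability that the ball of radius \<open>h\<close> is a copy of
  \<open>t\<close> is computed exactly, both in the massive spanning forest and in the limit trees. Multiplied by
  \<open>\<sigma>\<close>, it is the expected number of isomorphisms from \<open>t\<close> onto the ball (\<open>card_isos\<close>). One therefore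
  sums, over maps \<open>\<phi>\<close> from the vertices of \<open>t\<close>, the probability that \<open>\<phi>\<close> is an isomorphism, and
  unlabeled trees never have to be enumerated.

  \<^bold>\<open>The forest.\<close> The factor \<open>|T|\<close> in the weight of a forest counts the roots that its component \<open>T\<close>
  may have. Rooting the component of \<open>o\<close> at \<open>o\<close> and keeping its size as a factor, the weighted sum over
  forests becomes a weighted sum over parent maps (\<open>sum_forest_weight\<close>). If the ball has to be the image of
  \<open>\<phi>\<close>, the parents of the \<open>a\<close> vertices in this image are forced, and the other \<open>n - a\<close> vertices form a
  forest that hangs from the \<open>k\<close> boundary vertices, of weight \<open>1\<close> each, and from a point of weight
  \<open>\<lambda>\<close> standing for the roots of the other components. Such forests are counted by a weighted Cayley
  formula with one marked vertex (\<open>sum_parent_maps_exit\<close>); the mark accounts for the size of the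
  component of \<open>o\<close>. The outcome (\<open>prob_massive_SF_ball\<close>) is
  \<open>\<sigma> P = (n-1)\<cdots>(n-a+1) (\<lambda>+n-a+k)^(n-a-1) (\<lambda>a+nk) / (\<lambda>+n)^(n-1)\<close>, and if \<open>n/(\<lambda>+n)\<close>
  tends to \<open>\<beta>\<close>, this tends to \<open>exp(-(a-k)\<beta>) (a(1-\<beta>)+k\<beta>) \<beta>^(a-1)\<close>.

  \<^bold>\<open>The limit.\<close> An isomorphism from \<open>t\<close> onto a ball of the spine tree sends some vertex \<open>e\<close> of \<open>t\<close> to the
  last spine vertex in the ball, the path from the root to \<open>e\<close> to the spine, and it orders the remaining
  \<open>c v\<close> children of every vertex \<open>v\<close>. For a given \<open>e\<close> there are \<open>\<Prod>v. c(v)!\<close> such maps; each is an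
  isomorphism with probability \<open>\<rho>(e) \<Prod>v. exp(-\<beta>) \<beta>^c(v) / c(v)!\<close>, the product being over the vertices
  of depth less than \<open>h\<close> and \<open>\<rho>(e)\<close> being the probability that the last spine vertex in the ball has the
  depth of \<open>e\<close>. The factorials cancel, and the sum over \<open>e\<close> is the limit above, with \<open>\<beta> = 1\<close> for the infinite
  spine and \<open>\<beta> = 1/(1+\<alpha>)\<close> for the geometric one. For the single vertex the formula holds with
  \<open>\<beta> = 0\<close>. These are the values of \<open>lim n/(\<lambda>+n)\<close> in the three regimes.
\<close>


section \<open>Rooted trees described by parents, and isomorphisms onto balls\<close>

text \<open>
  The depth is part of the data because it does two things at once: it forces the iterated parents to reach
  the root, and it is the distance from the root, on which truncation depends.
\<close>

locale parent_tree =
  fixes T :: "'a rgraph" and \<pi> :: "'a \<Rightarrow> 'a" and d :: "'a \<Rightarrow> nat"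
  assumes root: "rt T \<in> verts T"
    and depth_root: "d (rt T) = 0"
    and parent: "v \<in> verts T \<Longrightarrow> v \<noteq> rt T \<Longrightarrow> \<pi> v \<in> verts T"
    and depth: "v \<in> verts T \<Longrightarrow> v \<noteq> rt T \<Longrightarrow> d v = Suc (d (\<pi> v))"
    and edges: "edges T = (\<lambda>v. {v, \<pi> v}) ` (verts T - {rt T})"
begin

definition kids :: "'a \<Rightarrow> 'a set" where
  "kids v = {w \<in> verts T. w \<noteq> rt T \<and> \<pi> w = v}"

lemma vertex_induct [consumes 1, case_names root step]:
  assumes "v \<in> verts T" "P (rt T)"
    and "\<And>v. v \<in> verts T \<Longrightarrow> v \<noteq> rt T \<Longrightarrow> P (\<pi> v) \<Longrightarrow> P v"
  shows "P v"
  using assms(1)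
proof (induction "d v" arbitrary: v rule: less_induct)
  case less
  show ?case
    using less assms(2,3) parent depth by (cases "v = rt T") auto
qed

lemma depth_eq_0_iff: "v \<in> verts T \<Longrightarrow> d v = 0 \<longleftrightarrow> v = rt T"
  using depth depth_root by (cases "v = rt T") auto

lemma simple_graph: "simple_graph T"
  unfolding simple_graph_def edges
proof
  fix e assume "e \<in> (\<lambda>v. {v, \<pi> v}) ` (verts T - {rt T})"
  then obtain v where v: "v \<in> verts T" "v \<noteq> rt T" "e = {v, \<pi> v}" by auto
  then have "v \<noteq> \<pi> v" using depth by fastforce
  then show "e \<subseteq> verts T \<and> card e = 2" using v parent by auto
qed

lemma adj_iff:
  "adj T x y \<longleftrightarrow> (x \<in> verts T \<and> x \<noteq> rt T \<and> y = \<pi> x) \<or> (y \<in> verts T \<and> y \<noteq> rt T \<and> x = \<pi> y)"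
  unfolding adj_def edges by (auto simp: doubleton_eq_iff)

lemma graph_dist_root_le_iff:
  assumes "v \<in> verts T"
  shows "graph_dist T (rt T) v \<le> enat h \<longleftrightarrow> d v \<le> h"
proof -
  have "(adj T ^^ d v) (rt T) v"
    using assms
  proof (induction v rule: vertex_induct)
    case root
    then show ?case by (simp add: depth_root)
  next
    case (step v)
    then show ?case using depth[of v] adj_iff[of "\<pi> v" v] by auto
  qed
  moreover have "d w \<le> k" if "(adj T ^^ k) (rt T) w" for k w
    using that
  proof (induction k arbitrary: w)
    case 0
    then show ?case using depth_root by auto
  next
    case (Suc k)
    then obtain x where "(adj T ^^ k) (rt T) x" "adj T x w" by auto
    moreover have "d w \<le> Suc (d x)"
      using \<open>adj T x w\<close> depth[of w] depth[of x] by (auto simp: adj_iff)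
    ultimately show ?case using Suc.IH[of x] by simp
  qed
  ultimately show ?thesis
    unfolding graph_dist_le_iff using order_trans by blast
qed

lemma verts_trunc: "verts (trunc h T) = {v \<in> verts T. d v \<le> h}"
  using graph_dist_root_le_iff by (auto simp: trunc_def Let_def)

lemma rt_trunc: "rt (trunc h T) = rt T"
  by (simp add: trunc_def Let_def)

lemma parent_tree_trunc: "parent_tree (trunc h T) \<pi> d"
proof
  show "rt (trunc h T) \<in> verts (trunc h T)"
    by (simp add: verts_trunc rt_trunc root depth_root)
  show "d (rt (trunc h T)) = 0" by (simp add: rt_trunc depth_root)
  fix v assume "v \<in> verts (trunc h T)" "v \<noteq> rt (trunc h T)"
  then show "\<pi> v \<in> verts (trunc h T)" "d v = Suc (d (\<pi> v))"
    using parent depth[of v] by (auto simp: verts_trunc rt_trunc)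
next
  have "edges (trunc h T) = {e \<in> edges T. e \<subseteq> verts (trunc h T)}"
    by (simp add: trunc_def Let_def)
  also have "\<dots> = (\<lambda>v. {v, \<pi> v}) ` (verts (trunc h T) - {rt (trunc h T)})"
    unfolding edges verts_trunc rt_trunc using parent depth by fastforce
  finally show "edges (trunc h T) = (\<lambda>v. {v, \<pi> v}) ` (verts (trunc h T) - {rt (trunc h T)})" .
qed

lemma height_le_iff: "height_le T h \<longleftrightarrow> (\<forall>v \<in> verts T. d v \<le> h)"
  unfolding height_le_def using graph_dist_root_le_iff by auto

lemma kids_subset: "kids v \<subseteq> verts T"
  by (auto simp: kids_def)

lemma mem_kids_iff: "w \<in> kids v \<longleftrightarrow> w \<in> verts T \<and> w \<noteq> rt T \<and> \<pi> w = v"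
  by (simp add: kids_def)

lemma depth_kids: "w \<in> kids v \<Longrightarrow> d w = Suc (d v)"
  using depth by (auto simp: kids_def)

end

text \<open>
  Extensional maps, so that the isomorphisms between finite trees can be counted.
\<close>

definition isos :: "'a rgraph \<Rightarrow> 'b rgraph \<Rightarrow> ('a \<Rightarrow> 'b) set" where
  "isos T T' = {\<phi> \<in> extensional (verts T). bij_betw \<phi> (verts T) (verts T') \<and> \<phi> (rt T) = rt T' \<and>
     edges T' = (\<lambda>e. \<phi> ` e) ` edges T}"

lemma edges_image_restrict:
  assumes "simple_graph T"
  shows "(\<lambda>e. restrict \<phi> (verts T) ` e) ` edges T = (\<lambda>e. \<phi> ` e) ` edges T"
proof (rule image_cong[OF refl])
  fix e assume "e \<in> edges T"
  then have "e \<subseteq> verts T" using assms by (auto simp: simple_graph_def)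
  then show "restrict \<phi> (verts T) ` e = \<phi> ` e" by (intro image_cong) auto
qed

lemma isos_nonempty_iff:
  assumes "simple_graph T" "rt T \<in> verts T"
  shows "isos T T' \<noteq> {} \<longleftrightarrow> rooted_iso T T'"
proof
  assume "rooted_iso T T'"
  then obtain p where p: "bij_betw p (verts T) (verts T')" "p (rt T) = rt T'"
    "edges T' = (\<lambda>e. p ` e) ` edges T"
    by (auto simp: rooted_iso_def)
  have "restrict p (verts T) \<in> isos T T'"
    unfolding isos_def mem_Collect_eq edges_image_restrict[OF assms(1)]
    using p assms(2) by (simp add: bij_betw_restrict_eq)
  then show "isos T T' \<noteq> {}" by blast
qed (auto simp: isos_def rooted_iso_def)

lemma isos_comp:
  assumes "simple_graph T" "rt T \<in> verts T" "\<phi> \<in> isos T T'"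
    "bij_betw \<psi> (verts T') (verts T'')" "\<psi> (rt T') = rt T''" "edges T'' = (\<lambda>e. \<psi> ` e) ` edges T'"
  shows "restrict (\<psi> \<circ> \<phi>) (verts T) \<in> isos T T''"
proof -
  have "bij_betw (\<psi> \<circ> \<phi>) (verts T) (verts T'')"
    using assms(3,4) by (auto simp: isos_def intro: bij_betw_trans)
  moreover have "edges T'' = (\<lambda>e. (\<psi> \<circ> \<phi>) ` e) ` edges T"
    using assms(3,6) by (simp add: isos_def image_image)
  ultimately show ?thesis
    unfolding isos_def mem_Collect_eq edges_image_restrict[OF assms(1)]
    using assms by (simp add: isos_def bij_betw_restrict_eq)
qed

lemma finite_isos:
  assumes "finite (verts T)" "finite (verts S)"
  shows "finite (isos T S)"
proof (rule finite_subset)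
  show "isos T S \<subseteq> verts T \<rightarrow>\<^sub>E verts S" by (auto simp: isos_def bij_betw_def PiE_def)
qed (use assms in \<open>auto intro: finite_PiE\<close>)

lemma card_isos_mono:
  assumes "simple_graph T" "rt T \<in> verts T" "finite (verts T)"
    and S: "rooted_iso S S'" and f: "finite (verts S')"
  shows "card (isos T S) \<le> card (isos T S')"
proof -
  obtain p where p: "bij_betw p (verts S) (verts S')" "p (rt S) = rt S'"
    "edges S' = (\<lambda>e. p ` e) ` edges S"
    using S by (auto simp: rooted_iso_def)
  have "inj_on (\<lambda>\<phi>. restrict (p \<circ> \<phi>) (verts T)) (isos T S)"
  proof
    fix \<phi> \<psi> assume h: "\<phi> \<in> isos T S" "\<psi> \<in> isos T S"
      "restrict (p \<circ> \<phi>) (verts T) = restrict (p \<circ> \<psi>) (verts T)"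
    have "\<phi> v = \<psi> v" if "v \<in> verts T" for v
    proof -
      have "p (\<phi> v) = p (\<psi> v)" using h(3) that by (metis comp_apply restrict_apply')
      moreover have "\<phi> v \<in> verts S" "\<psi> v \<in> verts S"
        using h that by (auto simp: isos_def bij_betw_def)
      ultimately show ?thesis using p(1) by (auto simp: bij_betw_def inj_on_def)
    qed
    then show "\<phi> = \<psi>" using h by (auto simp: isos_def intro: extensionalityI)
  qed
  moreover have "(\<lambda>\<phi>. restrict (p \<circ> \<phi>) (verts T)) ` isos T S \<subseteq> isos T S'"
    using isos_comp[OF assms(1,2) _ p] by blast
  ultimately show ?thesis using finite_isos[OF assms(3) f] by (intro card_inj_on_le) auto
qed

text \<open>
  Composing with one isomorphism between the trees, and with its inverse, turns automorphisms into
  isomorphisms and back. Counting maps thus decides whether two trees have the same shape.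
\<close>

lemma card_isos:
  assumes "simple_graph T" "rt T \<in> verts T" "finite (verts T)"
  shows "card (isos T T') = (if rooted_iso T T' then card (isos T T) else 0)"
proof (cases "rooted_iso T T'")
  case True
  have "finite (verts T')" using True assms(3) bij_betw_finite by (auto simp: rooted_iso_def)
  then show ?thesis
    using card_isos_mono[OF assms rooted_iso_sym[OF assms(1) True assms(2)] assms(3)]
      card_isos_mono[OF assms True] True by simp
next
  case False
  then have "isos T T' = {}" using isos_nonempty_iff[OF assms(1,2)] by blast
  then show ?thesis using False by simp
qed

lemma card_isos_pos:
  assumes "simple_graph T" "rt T \<in> verts T" "finite (verts T)"
  shows "card (isos T T) > 0"
proof -
  have "isos T T \<noteq> {}" using isos_nonempty_iff[OF assms(1,2)] rooted_iso_refl by blast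
  then show ?thesis using finite_isos[OF assms(3,3)] by (simp add: card_gt_0_iff)
qed

text \<open>
  Edges are preserved, so the only alternative is that \<open>\<phi> v\<close> is the parent of \<open>\<phi> (\<pi> v)\<close>. By
  induction from the root, \<open>\<phi> v\<close> is then \<open>\<phi> (\<pi> (\<pi> v))\<close>, against injectivity.
\<close>

lemma isos_parent:
  assumes "parent_tree T \<pi> d" "parent_tree T' \<pi>' d'" "\<phi> \<in> isos T T'"
    "v \<in> verts T" "v \<noteq> rt T"
  shows "\<phi> (\<pi> v) = \<pi>' (\<phi> v)"
proof -
  interpret T: parent_tree T \<pi> d by fact
  interpret T': parent_tree T' \<pi>' d' by fact
  have phi: "inj_on \<phi> (verts T)" "\<And>x. x \<in> verts T \<Longrightarrow> \<phi> x \<in> verts T'" "\<phi> (rt T) = rt T'"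
    "edges T' = (\<lambda>e. \<phi> ` e) ` edges T"
    using assms(3) by (auto simp: isos_def bij_betw_def)
  have "v \<noteq> rt T \<longrightarrow> \<phi> (\<pi> v) = \<pi>' (\<phi> v)"
    using assms(4)
  proof (induction v rule: T.vertex_induct)
    case (step v)
    note v = step.hyps
    have "{v, \<pi> v} \<in> edges T" using v by (auto simp: T.edges)
    then have "\<phi> ` {v, \<pi> v} \<in> edges T'" unfolding phi(4) by blast
    then have "adj T' (\<phi> v) (\<phi> (\<pi> v))" by (simp add: adj_def)
    then consider "\<phi> (\<pi> v) = \<pi>' (\<phi> v)" | "\<phi> (\<pi> v) \<noteq> rt T'" "\<pi>' (\<phi> (\<pi> v)) = \<phi> v"
      by (auto simp: T'.adj_iff)
    then show ?case
    proof cases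
      case 2
      then have ne: "\<pi> v \<noteq> rt T" using phi(3) by auto
      then have "\<phi> (\<pi> (\<pi> v)) = \<phi> v" using step.IH 2 by simp
      then have "\<pi> (\<pi> v) = v"
        using phi(1) v T.parent ne by (meson inj_onD)
      then show ?thesis using T.depth[OF v] T.depth[of "\<pi> v"] T.parent[OF v] ne by simp
    qed simp
  qed simp
  then show ?thesis using assms(5) by blast
qed

lemma isos_depth:
  assumes "parent_tree T \<pi> d" "parent_tree T' \<pi>' d'" "\<phi> \<in> isos T T'" "v \<in> verts T"
  shows "d' (\<phi> v) = d v"
proof -
  interpret T: parent_tree T \<pi> d by fact
  interpret T': parent_tree T' \<pi>' d' by fact
  have phi: "inj_on \<phi> (verts T)" "\<And>x. x \<in> verts T \<Longrightarrow> \<phi> x \<in> verts T'" "\<phi> (rt T) = rt T'"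
    using assms(3) by (auto simp: isos_def bij_betw_def)
  show ?thesis using assms(4)
  proof (induction v rule: T.vertex_induct)
    case root
    then show ?case by (simp add: phi T.depth_root T'.depth_root)
  next
    case (step v)
    have "\<phi> v \<noteq> rt T'"
      using step phi(1,3) T.root by (metis inj_onD)
    then show ?case
      using T'.depth[of "\<phi> v"] phi(2) step T.depth[of v] isos_parent[OF assms(1-3), of v] by simp
  qed
qed

text \<open>
  Being an isomorphism onto a ball is a local condition: the children of each vertex of depth less than
  \<open>h\<close> have to be matched, starting from the root. In this form the event can be read off from the
  parent map of a forest and from the offspring numbers of a branching tree.
\<close>

lemma isos_trunc_iff:
  assumes "parent_tree T \<pi> d" "parent_tree T' \<pi>' d'"
    and le: "\<And>v. v \<in> verts T \<Longrightarrow> d v \<le> h"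
  shows "\<phi> \<in> isos T (trunc h T') \<longleftrightarrow> \<phi> \<in> extensional (verts T) \<and> \<phi> (rt T) = rt T' \<and>
    (\<forall>v \<in> verts T. d v < h \<longrightarrow>
       bij_betw \<phi> (parent_tree.kids T \<pi> v) (parent_tree.kids T' \<pi>' (\<phi> v)))"
    (is "?L \<longleftrightarrow> ?R")
proof -
  interpret T: parent_tree T \<pi> d by fact
  interpret T': parent_tree T' \<pi>' d' by fact
  have tr: "parent_tree (trunc h T') \<pi>' d'" by (rule T'.parent_tree_trunc)
  show ?thesis
  proof
    assume L: ?L
    then have phi: "bij_betw \<phi> (verts T) (verts (trunc h T'))" "\<phi> (rt T) = rt T'"
      "inj_on \<phi> (verts T)" "\<And>x. x \<in> verts T \<Longrightarrow> \<phi> x \<in> verts (trunc h T')"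
      by (auto simp: isos_def T'.rt_trunc bij_betw_def)
    have "bij_betw \<phi> (T.kids v) (T'.kids (\<phi> v))" if v: "v \<in> verts T" "d v < h" for v
      unfolding bij_betw_def
    proof
      show "inj_on \<phi> (T.kids v)" using phi(3) T.kids_subset by (rule inj_on_subset)
      show "\<phi> ` T.kids v = T'.kids (\<phi> v)"
      proof (intro equalityI subsetI)
        fix x assume "x \<in> \<phi> ` T.kids v"
        then obtain w where w: "x = \<phi> w" "w \<in> verts T" "w \<noteq> rt T" "\<pi> w = v"
          by (auto simp: T.kids_def)
        moreover have "\<phi> w \<noteq> rt T'" using w phi(2,3) T.root by (metis inj_onD)
        ultimately show "x \<in> T'.kids (\<phi> v)"
          using isos_parent[OF assms(1) tr L, of w] phi(4)[of w] by (auto simp: T'.kids_def T'.verts_trunc)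
      next
        fix x assume x: "x \<in> T'.kids (\<phi> v)"
        have "d' x = Suc (d v)"
          using T'.depth_kids[OF x] isos_depth[OF assms(1) tr L v(1)] by simp
        then have "x \<in> verts (trunc h T')"
          using x v by (auto simp: T'.kids_def T'.verts_trunc)
        then obtain w where w: "w \<in> verts T" "x = \<phi> w" using phi(1) by (auto simp: bij_betw_def)
        have ne: "w \<noteq> rt T" using x w phi(2) by (auto simp: T'.kids_def)
        have "\<phi> (\<pi> w) = \<phi> v"
          using isos_parent[OF assms(1) tr L w(1) ne] x w by (simp add: T'.kids_def)
        then have "\<pi> w = v" using phi(3) v w T.parent[OF w(1) ne] by (auto dest: inj_onD)
        then show "x \<in> \<phi> ` T.kids v" using w ne by (auto simp: T.kids_def)
      qed
    qed
    then show ?R using L phi(2) by (auto simp: isos_def)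
  next
    assume R: ?R
    have kid: "\<phi> v \<in> T'.kids (\<phi> (\<pi> v))" if v: "v \<in> verts T" "v \<noteq> rt T" for v
    proof -
      have "d (\<pi> v) < h" using le[OF v(1)] T.depth[OF v] by simp
      then have "bij_betw \<phi> (T.kids (\<pi> v)) (T'.kids (\<phi> (\<pi> v)))"
        using R T.parent[OF v] by blast
      moreover have "v \<in> T.kids (\<pi> v)" using v by (simp add: T.kids_def)
      ultimately show ?thesis by (auto simp: bij_betw_def)
    qed
    have mem: "\<phi> v \<in> verts T' \<and> d' (\<phi> v) = d v" if "v \<in> verts T" for v
      using that
    proof (induction v rule: T.vertex_induct)
      case root
      then show ?case using R T'.root by (simp add: T.depth_root T'.depth_root)
    next
      case (step v)
      then show ?case using kid[of v] T'.depth_kids[of "\<phi> v"] T.depth[of v] by (auto simp: T'.kids_def)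
    qed
    have inj: "v = w" if "v \<in> verts T" "w \<in> verts T" "\<phi> v = \<phi> w" for v w
      using that
    proof (induction v arbitrary: w rule: T.vertex_induct)
      case root
      then have "d w = 0" using mem[of w] mem[OF T.root] by (simp add: T.depth_root)
      then show ?case using root T.depth_eq_0_iff by auto
    next
      case (step v)
      have wn: "w \<noteq> rt T"
        using mem[of w] mem[of v] step T.depth_eq_0_iff T.depth_root by metis
      have "\<phi> (\<pi> v) = \<phi> (\<pi> w)"
        using kid[of v] kid[of w] step wn by (auto simp: T'.kids_def)
      then have eq: "\<pi> v = \<pi> w" using step.IH[of "\<pi> w"] T.parent[of w] step wn by auto
      have "d (\<pi> v) < h" using le[of v] T.depth[of v] step by simp
      then have "inj_on \<phi> (T.kids (\<pi> v))"
        using R T.parent[of v] step by (auto simp: bij_betw_def)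
      moreover have "v \<in> T.kids (\<pi> v)" "w \<in> T.kids (\<pi> v)"
        using step.hyps step.prems wn eq by (auto simp: T.kids_def)
      ultimately show ?case using step.prems(2) by (auto dest: inj_onD)
    qed
    have surj: "d' x \<le> h \<longrightarrow> x \<in> \<phi> ` verts T" if "x \<in> verts T'" for x
      using that
    proof (induction x rule: T'.vertex_induct)
      case root
      then show ?case using R T.root by (metis imageI)
    next
      case (step x)
      show ?case
      proof
        assume "d' x \<le> h"
        then have dx: "d' (\<pi>' x) < h" using T'.depth[of x] step by simp
        then obtain v where v: "v \<in> verts T" "\<pi>' x = \<phi> v" using step by auto
        then have "bij_betw \<phi> (T.kids v) (T'.kids (\<phi> v))" using R mem dx by auto
        moreover have "x \<in> T'.kids (\<phi> v)" using step v by (simp add: T'.kids_def)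
        ultimately show "x \<in> \<phi> ` verts T" using T.kids_subset[of v] unfolding bij_betw_def by blast
      qed
    qed
    have V: "\<phi> ` verts T = verts (trunc h T')"
      using surj mem le by (auto simp: T'.verts_trunc)
    have inj': "inj_on \<phi> (verts T)" using inj by (auto simp: inj_on_def)
    have "edges (trunc h T') = (\<lambda>x. {x, \<pi>' x}) ` (verts (trunc h T') - {rt T'})"
      using parent_tree.edges[OF tr] by (simp add: T'.rt_trunc)
    also have "verts (trunc h T') - {rt T'} = \<phi> ` (verts T - {rt T})"
      using R T.root inj_on_image_set_diff[OF inj', of "verts T" "{rt T}"] V by simp
    also have "(\<lambda>x. {x, \<pi>' x}) ` (\<phi> ` (verts T - {rt T})) = (\<lambda>v. \<phi> ` {v, \<pi> v}) ` (verts T - {rt T})"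
      unfolding image_image using kid by (intro image_cong refl) (auto simp: T'.kids_def)
    also have "\<dots> = (\<lambda>e. \<phi> ` e) ` edges T" by (simp add: T.edges image_image)
    finally have "edges (trunc h T') = (\<lambda>e. \<phi> ` e) ` edges T" .
    then show ?L using R V inj' by (simp add: isos_def bij_betw_def T'.rt_trunc)
  qed
qed

text \<open>
  The parent of \<open>v\<close> is its neighbour closer to the root. A second such neighbour, or a neighbour as far from
  the root as \<open>v\<close>, would close a cycle: climbing from two distinct vertices at the same distance until the
  climbs meet gives a simple path between them that stays at most that far from the root.
\<close>

lemma rooted_tree_imp_parent_tree:
  assumes "rooted_tree T"
  shows "\<exists>\<pi> d. parent_tree T \<pi> d"
proof -
  have simple: "simple_graph T" and conn: "connected_graph T" and acyclic: "\<And>c. \<not> is_cycle T c"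
    and rt: "rt T \<in> verts T"
    using assms by (auto simp: rooted_tree_def)
  have sym: "adj T x y \<Longrightarrow> adj T y x" for x y by (simp add: adj_def insert_commute)
  have adjV: "adj T x y \<Longrightarrow> x \<in> verts T \<and> y \<in> verts T \<and> x \<noteq> y" for x y
    using simple by (fastforce simp: adj_def simple_graph_def)
  define d where "d v = (LEAST k. (adj T ^^ k) (rt T) v)" for v
  have walk: "(adj T ^^ d v) (rt T) v" if "v \<in> verts T" for v
  proof -
    have "(adj T)\<^sup>*\<^sup>* (rt T) v" using conn rt that by (simp add: connected_graph_def)
    then obtain k where "(adj T ^^ k) (rt T) v" by (auto simp: rtranclp_power)
    then show ?thesis unfolding d_def by (rule LeastI)
  qed
  have d_le: "d v \<le> k" if "(adj T ^^ k) (rt T) v" for v k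
    unfolding d_def using that by (rule Least_le)
  have d0: "d (rt T) = 0" using d_le[of 0 "rt T"] by simp
  have d0D: "v = rt T" if "v \<in> verts T" "d v = 0" for v using walk[OF that(1)] that(2) by simp
  have d_adj: "d y \<le> Suc (d x)" if "adj T x y" for x y
    using d_le[of "Suc (d x)" y] walk[of x] adjV[OF that] that by auto
  have ex_par: "\<exists>w. adj T w v \<and> d v = Suc (d w)" if v: "v \<in> verts T" "v \<noteq> rt T" for v
  proof -
    obtain m where m: "d v = Suc m" using d0D v by (cases "d v") auto
    then obtain w where w: "(adj T ^^ m) (rt T) w" "adj T w v" using walk[OF v(1)] by auto
    then show ?thesis using d_le[OF w(1)] d_adj[OF w(2)] m by (intro exI[of _ w]) auto
  qed
  have path: "\<exists>c. distinct c \<and> successively (adj T) c \<and> hd c = x \<and> last c = y \<and> 3 \<le> length c \<and>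
      (\<forall>z \<in> set c. d z \<le> d x)"
    if "x \<in> verts T" "y \<in> verts T" "x \<noteq> y" "d x = d y" for x y
    using that
  proof (induction "d x" arbitrary: x y)
    case 0
    then show ?case using d0D by metis
  next
    case (Suc m)
    have "x \<noteq> rt T" "y \<noteq> rt T" using Suc.hyps(2) Suc.prems(4) d0 by auto
    then obtain x' y' where p: "adj T x' x" "d x = Suc (d x')" "adj T y' y" "d y = Suc (d y')"
      using ex_par Suc.prems by metis
    show ?case
    proof (cases "x' = y'")
      case True
      then show ?thesis
        using p sym adjV[OF p(1)] adjV[OF p(3)] Suc.prems by (intro exI[of _ "[x, x', y]"]) auto
    next
      case False
      then obtain c where c: "distinct c" "successively (adj T) c" "hd c = x'" "last c = y'"
        "3 \<le> length c" "\<forall>z \<in> set c. d z \<le> d x'"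
        using Suc.hyps(1)[of x' y'] p adjV[OF p(1)] adjV[OF p(3)] Suc.hyps(2) Suc.prems(4) by auto
      have "c \<noteq> []" using c(5) by auto
      moreover have "x \<notin> set c" "y \<notin> set c" using c(6) p Suc.prems(4) by fastforce+
      moreover have "\<forall>z \<in> set (x # c @ [y]). d z \<le> d x" using c(6) p Suc.prems(4) by fastforce
      ultimately show ?thesis
        using c sym[OF p(1)] p(3) Suc.prems(3)
        by (intro exI[of _ "x # c @ [y]"]) (auto simp: successively_append_iff successively_Cons)
    qed
  qed
  have level: "d x \<noteq> d y" if xy: "adj T x y" for x y
  proof
    assume "d x = d y"
    then obtain c where "distinct c" "successively (adj T) c" "hd c = x" "last c = y" "3 \<le> length c"
      using path[of x y] adjV[OF xy] by blast
    then have "is_cycle T c" using sym[OF xy] by (simp add: is_cycle_def)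
    then show False using acyclic by blast
  qed
  have unique: "w = w'" if w: "adj T w v" "d v = Suc (d w)" and w': "adj T w' v" "d v = Suc (d w')" for v w w'
  proof (rule ccontr)
    assume "w \<noteq> w'"
    then obtain c where c: "distinct c" "successively (adj T) c" "hd c = w" "last c = w'" "3 \<le> length c"
      "\<forall>z \<in> set c. d z \<le> d w"
      using path[of w w'] adjV[OF w(1)] adjV[OF w'(1)] w(2) w'(2) by auto
    have "c \<noteq> []" "v \<notin> set c" using c(5,6) w(2) by auto
    then have "is_cycle T (v # c)"
      using c sym[OF w(1)] w'(1) by (auto simp: is_cycle_def successively_Cons)
    then show False using acyclic by blast
  qed
  define \<pi> where "\<pi> v = (SOME w. adj T w v \<and> d v = Suc (d w))" for v
  have pi: "adj T (\<pi> v) v \<and> d v = Suc (d (\<pi> v))" if "v \<in> verts T" "v \<noteq> rt T" for v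
    unfolding \<pi>_def by (rule someI_ex[OF ex_par[OF that]])
  have up: "{x, y} \<in> (\<lambda>v. {v, \<pi> v}) ` (verts T - {rt T})" if a: "adj T x y" and le: "d x < d y" for x y
  proof -
    have y: "y \<in> verts T" "y \<noteq> rt T" using adjV[OF a] le d0 by auto
    have "d y = Suc (d x)" using d_adj[OF a] le by simp
    then have "x = \<pi> y" using unique[OF a] pi[OF y] by blast
    then show ?thesis using y by (intro image_eqI[of _ _ y]) auto
  qed
  have "parent_tree T \<pi> d"
  proof
    show "edges T = (\<lambda>v. {v, \<pi> v}) ` (verts T - {rt T})"
    proof (intro equalityI subsetI)
      fix e assume e: "e \<in> edges T"
      then have "card e = 2" using simple by (simp add: simple_graph_def)
      then obtain x y where xy: "e = {x, y}" by (meson card_2_iff)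
      then have "adj T x y" using e by (simp add: adj_def)
      then show "e \<in> (\<lambda>v. {v, \<pi> v}) ` (verts T - {rt T})"
        using up[of x y] up[of y x] level[of x y] sym[of x y] xy by (auto simp: neq_iff insert_commute)
    next
      fix e assume "e \<in> (\<lambda>v. {v, \<pi> v}) ` (verts T - {rt T})"
      then show "e \<in> edges T" using pi sym by (auto simp: adj_def insert_commute)
    qed
  qed (use rt d0 pi adjV in auto)
  then show ?thesis by blast
qed


section \<open>Counting forests that hang from weighted points\<close>

definition descending :: "'a set \<Rightarrow> ('a \<Rightarrow> 'a) \<Rightarrow> bool" where
  "descending U q \<longleftrightarrow> (\<exists>r :: 'a \<Rightarrow> nat. \<forall>u \<in> U. q u \<in> U \<longrightarrow> r (q u) < r u)"

text \<open>
  The first point outside \<open>U\<close> on the orbit of \<open>v\<close>, for a map that is descending on \<open>U\<close>.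
\<close>

definition exit_point :: "'a set \<Rightarrow> ('a \<Rightarrow> 'a) \<Rightarrow> 'a \<Rightarrow> 'a" where
  "exit_point U q v = (q ^^ (LEAST k. (q ^^ k) v \<notin> U)) v"

lemma descending_induct [consumes 2, case_names step]:
  assumes "descending U q" "v \<in> U" "\<And>v. v \<in> U \<Longrightarrow> (q v \<in> U \<Longrightarrow> P (q v)) \<Longrightarrow> P v"
  shows "P v"
proof -
  obtain r :: "'a \<Rightarrow> nat" where r: "\<forall>u \<in> U. q u \<in> U \<longrightarrow> r (q u) < r u"
    using assms(1) by (auto simp: descending_def)
  show ?thesis using assms(2)
  proof (induction "r v" arbitrary: v rule: less_induct)
    case less
    then show ?case using r assms(3)[of v] by blast
  qed
qed

lemma descending_subset:
  assumes "descending U q" "U' \<subseteq> U" "\<And>u. u \<in> U' \<Longrightarrow> q' u = q u"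
  shows "descending U' q'"
  using assms unfolding descending_def by (metis in_mono)

lemma exit_point_outside: "v \<notin> U \<Longrightarrow> exit_point U q v = v"
  by (simp add: exit_point_def Least_eq_0)

lemma descending_leaves:
  assumes "descending U q" "v \<in> U"
  shows "(LEAST k. (q ^^ k) v \<notin> U) = Suc (LEAST k. (q ^^ k) (q v) \<notin> U)"
proof -
  have "\<exists>k. (q ^^ k) v \<notin> U"
    using assms
  proof (induction v rule: descending_induct)
    case (step v)
    have "(q ^^ 0) (q v) \<notin> U" if "q v \<notin> U" using that by simp
    then obtain k where "(q ^^ k) (q v) \<notin> U" using step.IH by blast
    then show ?case by (intro exI[of _ "Suc k"]) (simp add: funpow_swap1)
  qed
  then obtain k where "(q ^^ k) v \<notin> U" by blast
  then have "(LEAST k. (q ^^ k) v \<notin> U) = Suc (LEAST k. (q ^^ Suc k) v \<notin> U)"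
    by (rule Least_Suc) (use assms(2) in simp)
  then show ?thesis by (simp add: funpow_swap1)
qed

lemma exit_point_step: "descending U q \<Longrightarrow> v \<in> U \<Longrightarrow> exit_point U q v = exit_point U q (q v)"
  by (simp add: exit_point_def descending_leaves funpow_swap1)

lemma exit_point_notin: "descending U q \<Longrightarrow> exit_point U q v \<notin> U"
proof (cases "v \<in> U")
  case True
  assume "descending U q"
  then show ?thesis using True
  proof (induction v rule: descending_induct)
    case (step v)
    then show ?case
      using exit_point_step[of U q v] exit_point_outside[of "q v" U q] \<open>descending U q\<close> by metis
  qed
qed (simp add: exit_point_outside)

lemma exit_point_mem:
  assumes "descending U q" "v \<in> U" "\<And>u. u \<in> U \<Longrightarrow> q u \<in> U \<union> B"
  shows "exit_point U q v \<in> B"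
  using assms(1,2)
proof (induction v rule: descending_induct)
  case (step v)
  show ?case
  proof (cases "q v \<in> U")
    case True
    then show ?thesis using step exit_point_step[OF assms(1)] by simp
  next
    case False
    then show ?thesis
      using step.hyps exit_point_step[OF assms(1)] exit_point_outside[OF False, of q] assms(3) by auto
  qed
qed

lemma exit_point_exit_point:
  assumes "descending U q" "U' \<subseteq> U" "\<And>u. u \<in> U' \<Longrightarrow> q' u = q u"
  shows "exit_point U q (exit_point U' q' v) = exit_point U q v"
proof (cases "v \<in> U'")
  case True
  have d: "descending U' q'" using assms by (rule descending_subset)
  show ?thesis using d True
  proof (induction v rule: descending_induct)
    case (step v)
    have v: "v \<in> U" using step.hyps assms(2) by blast
    have "exit_point U q (exit_point U' q' (q' v)) = exit_point U q (q' v)"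
      using step.IH exit_point_outside by (metis (full_types))
    then show ?case
      using exit_point_step[OF d step.hyps] exit_point_step[OF assms(1) v] assms(3)[OF step.hyps] by simp
  qed
qed (simp add: exit_point_outside)

lemma exit_point_cong:
  assumes "descending U q" "\<And>u. u \<in> U \<Longrightarrow> q' u = q u"
  shows "exit_point U q' v = exit_point U q v"
proof -
  have "descending U q'" using assms by (intro descending_subset[OF assms(1)]) auto
  then show ?thesis
    using exit_point_exit_point[OF assms(1) order_refl assms(2), of v]
      exit_point_outside[OF exit_point_notin, of U q' q v] by simp
qed

text \<open>
  This serves to show that the orbit of \<open>q w\<close> does not come back to \<open>w\<close>.
\<close>

lemma rank_exit_point_le:
  assumes "descending U' q" "U' \<subseteq> U" "\<forall>u \<in> U. q u \<in> U \<longrightarrow> r (q u) < (r u :: nat)" "v \<in> U"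
    "exit_point U' q v \<in> U"
  shows "r (exit_point U' q v) \<le> r v"
proof (cases "v \<in> U'")
  case True
  show ?thesis using assms(1) True assms(5)
  proof (induction v rule: descending_induct)
    case (step v)
    note e = exit_point_step[OF assms(1) step.hyps]
    have v: "v \<in> U" using step.hyps assms(2) by blast
    show ?case
    proof (cases "q v \<in> U'")
      case True
      then have "q v \<in> U" using assms(2) by blast
      then show ?thesis using step.IH[OF True] step.prems e assms(3) v by fastforce
    next
      case False
      then show ?thesis using exit_point_outside[OF False, of q] e assms(3) v step.prems by fastforce
    qed
  qed
qed (simp add: exit_point_outside)

text \<open>
  These are the forests on \<open>U\<close> whose trees hang from points of \<open>B\<close>: a map sends each vertex to its parent,
  and \<open>exit_point\<close> gives the point of \<open>B\<close> below a vertex.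
\<close>

definition parent_maps :: "'a set \<Rightarrow> 'a set \<Rightarrow> ('a \<Rightarrow> 'a) set" where
  "parent_maps U B = {q \<in> U \<rightarrow>\<^sub>E U \<union> B. descending U q}"

lemma finite_parent_maps: "finite U \<Longrightarrow> finite B \<Longrightarrow> finite (parent_maps U B)"
  unfolding parent_maps_def by (intro finite_Collect_conjI disjI1) (simp add: finite_PiE)

lemma parent_mapsD:
  assumes "q \<in> parent_maps U B"
  shows "descending U q" "\<And>u. u \<in> U \<Longrightarrow> q u \<in> U \<union> B" "q \<in> extensional U"
  using assms by (auto simp: parent_maps_def PiE_def)

lemma parent_maps_empty: "parent_maps {} B = {\<lambda>_. undefined}"
  by (auto simp: parent_maps_def descending_def)

lemma sum_parent_maps_by_exit:
  assumes "finite U" "finite B" "w \<in> U"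
  shows "(\<Sum>q \<in> parent_maps U B. f q) = (\<Sum>b \<in> B. \<Sum>q | q \<in> parent_maps U B \<and> exit_point U q w = b. f q)"
proof (rule sum.group[symmetric])
  show "(\<lambda>q. exit_point U q w) ` parent_maps U B \<subseteq> B"
  proof
    fix b assume "b \<in> (\<lambda>q. exit_point U q w) ` parent_maps U B"
    then obtain q where q: "q \<in> parent_maps U B" "b = exit_point U q w" by blast
    then show "b \<in> B" using exit_point_mem[OF parent_mapsD(1)[OF q(1)] assms(3) parent_mapsD(2)[OF q(1)]] by simp
  qed
qed (use assms finite_parent_maps in auto)

text \<open>
  Double counting of the pairs of an object and a mark, here mostly a forest and a marked vertex.
\<close>

lemma sum_weighted_card:
  fixes W :: "'a \<Rightarrow> real"
  assumes "finite Q" "finite U"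
  shows "(\<Sum>q \<in> Q. W q * card {w \<in> U. R q w}) = (\<Sum>w \<in> U. \<Sum>q | q \<in> Q \<and> R q w. W q)"
proof -
  have "(\<Sum>q \<in> Q. W q * card {w \<in> U. R q w}) = (\<Sum>q \<in> Q. \<Sum>w \<in> U. if R q w then W q else 0)"
    using assms(2) by (intro sum.cong refl) (simp add: sum.If_cases Int_def)
  also have "\<dots> = (\<Sum>w \<in> U. \<Sum>q \<in> Q. if R q w then W q else 0)" by (rule sum.swap)
  finally show ?thesis using assms(1) by (simp add: sum.If_cases Int_def)
qed

text \<open>
  The vertices that exit at \<open>w\<close> form the subtree at \<open>w\<close>, and \<open>x\<close> is not among them. Lifting their
  ranks above the rank of \<open>x\<close> leaves room for \<open>w\<close> in between.
\<close>

lemma descending_fun_upd: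
  assumes "w \<in> U" "q' \<in> parent_maps (U - {w}) (insert w B)" "U \<inter> B = {}"
    and x: "x \<in> B \<or> x \<in> U - {w} \<and> exit_point (U - {w}) q' x \<in> B"
  shows "descending U (q'(w := x))"
proof -
  let ?U = "U - {w}" and ?e = "exit_point (U - {w}) q'"
  have d: "descending ?U q'" using assms(2) by (rule parent_mapsD)
  then obtain r :: "'a \<Rightarrow> nat" where r: "\<forall>u \<in> ?U. q' u \<in> ?U \<longrightarrow> r (q' u) < r u"
    by (auto simp: descending_def)
  have wB: "w \<notin> B" using assms(1,3) by blast
  \<comment> \<open>The subtree at \<open>w\<close> is lifted by \<open>r x + 2\<close>, which puts \<open>w\<close> between \<open>x\<close> and this subtree.\<close>
  define r' where "r' u = (if u = w then r x + 1 else if ?e u = w then r u + r x + 2 else r u)" for u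
  have "r' ((q'(w := x)) u) < r' u" if u: "u \<in> U" "(q'(w := x)) u \<in> U" for u
  proof (cases "u = w")
    case True
    then have "x \<in> ?U" "?e x \<in> B" using u x assms(3) exit_point_outside[of x ?U q'] wB
      by auto
    then have "x \<noteq> w" "?e x \<noteq> w" using wB by auto
    then show ?thesis using True by (simp add: r'_def)
  next
    case False
    then have uU: "u \<in> ?U" using u by blast
    have e: "?e u = ?e (q' u)" by (rule exit_point_step[OF d uU])
    show ?thesis
    proof (cases "q' u = w")
      case True
      then have "?e u = w" using e exit_point_outside[of w ?U q'] by simp
      then show ?thesis using False True by (simp add: r'_def)
    next
      case ne: False
      then have "q' u \<in> ?U" using u False by auto
      then have "r (q' u) < r u" using r uU by blast
      then show ?thesis using False ne e by (simp add: r'_def)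
    qed
  qed
  then show ?thesis unfolding descending_def by blast
qed

text \<open>
  The marked vertex \<open>w\<close> is moved from \<open>U\<close> to \<open>B\<close>. What remains to be chosen is its parent: either \<open>b\<close>, or a
  vertex that already exits at \<open>b\<close>.
\<close>

lemma sum_parent_maps_exit_insert:
  fixes y :: "'a \<Rightarrow> real"
  assumes U: "finite U" "finite B" "U \<inter> B = {}" "w \<in> U" "b \<in> B"
  shows "(\<Sum>q | q \<in> parent_maps U B \<and> exit_point U q w = b. \<Prod>u\<in>U. y (q u)) =
    (\<Sum>q' \<in> parent_maps (U - {w}) (insert w B).
       (\<Prod>u\<in>U - {w}. y (q' u)) * (\<Sum>x \<in> insert b {x \<in> U - {w}. exit_point (U - {w}) q' x = b}. y x))"
proof -
  let ?U = "U - {w}" and ?B = "insert w B"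
  define N where "N q' = insert b {x \<in> ?U. exit_point ?U q' x = b}" for q'
  have bU: "b \<notin> U" "b \<noteq> w" using U by auto
  have "(\<Sum>q | q \<in> parent_maps U B \<and> exit_point U q w = b. \<Prod>u\<in>U. y (q u)) =
      (\<Sum>(q', x) \<in> Sigma (parent_maps ?U ?B) N. (\<Prod>u\<in>?U. y (q' u)) * y x)"
  proof (rule sum.reindex_bij_witness[where i = "\<lambda>(q', x). q'(w := x)"
        and j = "\<lambda>q. (restrict q ?U, q w)"])
    fix q assume "q \<in> {q. q \<in> parent_maps U B \<and> exit_point U q w = b}"
    then have q: "q \<in> parent_maps U B" "exit_point U q w = b" by auto
    note qD = parent_mapsD[OF q(1)]
    show "(case (restrict q ?U, q w) of (q', x) \<Rightarrow> q'(w := x)) = q"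
      using qD(3) U(4) by (auto simp: fun_eq_iff extensional_def)
    have d': "descending ?U (restrict q ?U)"
      using qD(1) by (rule descending_subset) auto
    have mem': "restrict q ?U \<in> parent_maps ?U ?B"
      unfolding parent_maps_def using d' qD(2) by (auto simp: PiE_iff)
    have ee: "exit_point U q (exit_point ?U (restrict q ?U) (q w)) = b"
      using exit_point_exit_point[OF qD(1), of ?U "restrict q ?U" "q w"] q(2)
        exit_point_step[OF qD(1) U(4)] by auto
    have "q w \<in> N (restrict q ?U)"
    proof (cases "q w \<in> U")
      case False
      then have "q w = b" using exit_point_step[OF qD(1) U(4)] exit_point_outside[OF False, of q] q(2) by simp
      then show ?thesis by (simp add: N_def)
    next
      case True
      obtain r :: "'a \<Rightarrow> nat" where r: "\<forall>u \<in> U. q u \<in> U \<longrightarrow> r (q u) < r u"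
        using qD(1) by (auto simp: descending_def)
      have lt: "r (q w) < r w" using r True U(4) by blast
      then have qU: "q w \<in> ?U" using True by auto
      have dU: "descending ?U q" using qD(1) by (rule descending_subset) auto
      have eq: "exit_point ?U (restrict q ?U) (q w) = exit_point ?U q (q w)"
        by (rule exit_point_cong[OF dU]) simp
      have "exit_point ?U (restrict q ?U) (q w) \<noteq> w"
      proof
        assume a: "exit_point ?U (restrict q ?U) (q w) = w"
        have "r (exit_point ?U q (q w)) \<le> r (q w)"
          by (rule rank_exit_point_le[OF dU _ r True]) (use a eq U in auto)
        then show False using a eq lt by simp
      qed
      moreover have "exit_point ?U (restrict q ?U) (q w) \<in> ?B"
        by (rule exit_point_mem[OF d' qU]) (use parent_mapsD(2)[OF mem'] in auto)
      ultimately have "exit_point ?U (restrict q ?U) (q w) \<notin> U" using U(3) by blast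
      then have "exit_point ?U (restrict q ?U) (q w) = b"
        using ee exit_point_outside by metis
      then show ?thesis using qU by (simp add: N_def)
    qed
    then show "(restrict q ?U, q w) \<in> Sigma (parent_maps ?U ?B) N" using mem' by auto
    have "(\<Prod>u\<in>U. y (q u)) = y (q w) * (\<Prod>u\<in>?U. y (q u))" using U by (intro prod.remove) auto
    moreover have "(\<Prod>u\<in>?U. y (q u)) = (\<Prod>u\<in>?U. y (restrict q ?U u))" by (intro prod.cong) auto
    ultimately show "(case (restrict q ?U, q w) of (q', x) \<Rightarrow> (\<Prod>u\<in>?U. y (q' u)) * y x) = (\<Prod>u\<in>U. y (q u))"
      by (simp only: prod.case mult.commute)
  next
    fix p assume "p \<in> Sigma (parent_maps ?U ?B) N"
    then obtain q' x where p: "p = (q', x)" "q' \<in> parent_maps ?U ?B" "x \<in> N q'" by auto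
    note qD = parent_mapsD[OF p(2)]
    have "restrict (q'(w := x)) ?U = q'"
      using qD(3) by (auto simp: fun_eq_iff extensional_def)
    then show "(restrict (case p of (q', x) \<Rightarrow> q'(w := x)) ?U, (case p of (q', x) \<Rightarrow> q'(w := x)) w) = p"
      using p(1) by simp
    have x: "x = b \<or> x \<in> ?U \<and> exit_point ?U q' x = b" using p(3) by (auto simp: N_def)
    have d: "descending U (q'(w := x))"
      by (rule descending_fun_upd[OF U(4) p(2) U(3)]) (use x U(5) in auto)
    have "exit_point U (q'(w := x)) w = exit_point U (q'(w := x)) x"
      using exit_point_step[OF d U(4)] by simp
    also have "\<dots> = exit_point U (q'(w := x)) (exit_point ?U q' x)"
      by (rule exit_point_exit_point[OF d, symmetric]) auto
    also have "exit_point ?U q' x = b"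
      using x exit_point_outside[of b ?U q'] bU by auto
    finally have "exit_point U (q'(w := x)) w = b" by (simp only: exit_point_outside[OF bU(1)])
    moreover have "q'(w := x) \<in> parent_maps U B"
      unfolding parent_maps_def using d qD(2,3) x U(4,5) by (auto simp: PiE_iff extensional_def)
    ultimately show "(case p of (q', x) \<Rightarrow> q'(w := x)) \<in> {q. q \<in> parent_maps U B \<and> exit_point U q w = b}"
      using p(1) by simp
  qed
  also have "\<dots> = (\<Sum>q' \<in> parent_maps ?U ?B. \<Sum>x \<in> N q'. (\<Prod>u\<in>?U. y (q' u)) * y x)"
    using U by (intro sum.Sigma[symmetric]) (auto simp: N_def finite_parent_maps)
  also have "\<dots> = (\<Sum>q' \<in> parent_maps ?U ?B. (\<Prod>u\<in>?U. y (q' u)) * (\<Sum>x \<in> N q'. y x))"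
    by (simp add: sum_distrib_left)
  finally show ?thesis by (simp add: N_def)
qed

text \<open>
  Cayley's formula, split according to the exit point of a marked vertex. The induction removes the
  marked vertex itself. With \<open>m\<close> other vertices and \<open>Y = sum y B\<close>, the forests hanging from \<open>insert w B\<close>
  have total weight \<open>(Y+1)(Y+1+m)^(m-1)\<close> if \<open>m > 0\<close>, and those in which a given vertex exits at \<open>b\<close> have
  weight \<open>y b (Y+1+m)^(m-1)\<close>. The parent of \<open>w\<close> is \<open>b\<close>, or one of the \<open>m\<close> vertices provided that it exits
  at \<open>b\<close>. This gives \<open>y b (Y+1)(Y+1+m)^(m-1) + m y b (Y+1+m)^(m-1) = y b (Y+1+m)^m\<close>.
\<close>

lemma sum_parent_maps_exit:
  fixes y :: "'a \<Rightarrow> real"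
  assumes "finite U" "finite B" "U \<inter> B = {}" "w \<in> U" "b \<in> B" "\<And>u. u \<in> U \<Longrightarrow> y u = 1"
  shows "(\<Sum>q | q \<in> parent_maps U B \<and> exit_point U q w = b. \<Prod>u\<in>U. y (q u)) =
    y b * (sum y B + card U) ^ (card U - 1)"
  using assms
proof (induction "card U" arbitrary: U B w b rule: less_induct)
  case less
  let ?U = "U - {w}" and ?B = "insert w B"
  define Y where "Y = sum y B"
  define W where "W q' = (\<Prod>u\<in>?U. y (q' u))" for q'
  define m where "m = card ?U"
  have cU: "card U = Suc m" unfolding m_def using card.remove[OF less.prems(1,4)] .
  have U': "finite ?U" "finite ?B" "?U \<inter> ?B = {}" using less.prems by auto
  have Y': "sum y ?B = Y + 1" using less.prems by (subst sum.insert) (auto simp: Y_def)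
  have IH: "(\<Sum>q | q \<in> parent_maps ?U ?B \<and> exit_point ?U q x = c. W q) = y c * (Y + 1 + m) ^ (m - 1)"
    if "x \<in> ?U" "c \<in> ?B" for x c
    using less.hyps[OF _ U' that] cU less.prems(6) by (simp add: W_def m_def Y')
  \<comment> \<open>Stated as a sum so that it holds for \<open>m = 0\<close> too, where the empty map has weight \<open>1\<close>.\<close>
  have total: "(\<Sum>q \<in> parent_maps ?U ?B. W q) + m * (Y + 1 + m) ^ (m - 1) = (Y + 1 + m) ^ m"
  proof (cases "?U = {}")
    case True
    then show ?thesis by (simp only: W_def m_def parent_maps_empty) simp
  next
    case False
    then obtain x where x: "x \<in> ?U" by blast
    have m: "m > 0" using False U' by (simp add: m_def card_gt_0_iff)
    have "(\<Sum>q \<in> parent_maps ?U ?B. W q) = (\<Sum>c \<in> ?B. y c * (Y + 1 + m) ^ (m - 1))"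
      unfolding sum_parent_maps_by_exit[OF U'(1,2) x] using IH[OF x] by simp
    also have "\<dots> = (Y + 1) * (Y + 1 + m) ^ (m - 1)"
      by (simp only: sum_distrib_right[symmetric] Y')
    finally show ?thesis using m by (cases m) (simp_all add: algebra_simps)
  qed
  have marked: "(\<Sum>q \<in> parent_maps ?U ?B. W q * card {x \<in> ?U. exit_point ?U q x = b}) =
      m * (y b * (Y + 1 + m) ^ (m - 1))"
    unfolding sum_weighted_card[OF finite_parent_maps[OF U'(1,2)] U'(1)]
    using IH[of _ b] less.prems(5) by (simp add: m_def)
  have "(\<Sum>q | q \<in> parent_maps U B \<and> exit_point U q w = b. \<Prod>u\<in>U. y (q u)) =
      (\<Sum>q \<in> parent_maps ?U ?B. W q * (y b + card {x \<in> ?U. exit_point ?U q x = b}))"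
  proof (subst sum_parent_maps_exit_insert[OF less.prems(1-5)], intro sum.cong refl)
    fix q'
    have "sum y (insert b {x \<in> ?U. exit_point ?U q' x = b}) =
        y b + sum y {x \<in> ?U. exit_point ?U q' x = b}"
      using less.prems by (subst sum.insert) auto
    also have "sum y {x \<in> ?U. exit_point ?U q' x = b} = (\<Sum>x | x \<in> ?U \<and> exit_point ?U q' x = b. 1)"
      using less.prems(6) by (intro sum.cong) auto
    finally show "(\<Prod>u\<in>?U. y (q' u)) * sum y (insert b {x \<in> ?U. exit_point ?U q' x = b}) =
        W q' * (y b + card {x \<in> ?U. exit_point ?U q' x = b})"
      by (simp add: W_def)
  qed
  also have "\<dots> = y b * ((\<Sum>q \<in> parent_maps ?U ?B. W q) + m * (Y + 1 + m) ^ (m - 1))"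
    using marked by (simp add: distrib_left sum.distrib sum_distrib_left mult.commute mult.left_commute)
  also have "\<dots> = y b * (Y + card U) ^ (card U - 1)"
    unfolding total cU by (simp add: algebra_simps)
  finally show ?case by (simp add: Y_def)
qed

lemma sum_parent_maps:
  fixes y :: "'a \<Rightarrow> real"
  assumes "finite U" "finite B" "U \<inter> B = {}" "U \<noteq> {}" "\<And>u. u \<in> U \<Longrightarrow> y u = 1"
  shows "(\<Sum>q \<in> parent_maps U B. \<Prod>u\<in>U. y (q u)) = sum y B * (sum y B + card U) ^ (card U - 1)"
proof -
  obtain w where w: "w \<in> U" using assms(4) by blast
  show ?thesis
    unfolding sum_parent_maps_by_exit[OF assms(1,2) w] sum_distrib_right
    by (intro sum.cong refl sum_parent_maps_exit assms w)
qed


section \<open>Rooted forests as parent maps\<close>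

lemma descending_no_two_cycle:
  assumes "descending V p" "v \<in> V" "p v \<in> V"
  shows "p (p v) \<noteq> v"
  using assms unfolding descending_def by (metis less_asym)

lemma descending_exit_time:
  assumes "descending U q"
  shows "\<exists>d :: 'a \<Rightarrow> nat. \<forall>v. d v = (if v \<in> U then Suc (d (q v)) else 0)"
  using descending_leaves[OF assms]
  by (intro exI[of _ "\<lambda>v. LEAST k. (q ^^ k) v \<notin> U"]) (simp add: Least_eq_0)

text \<open>
  The roots are the vertices that \<open>p\<close> sends out of \<open>V\<close>.
\<close>

definition forest_of :: "'a set \<Rightarrow> ('a \<Rightarrow> 'a) \<Rightarrow> 'a ugraph" where
  "forest_of V p = \<lparr>verts = V, edges = (\<lambda>v. {v, p v}) ` {v \<in> V. p v \<in> V}\<rparr>"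

lemma verts_forest_of [simp]: "verts (forest_of V p) = V"
  by (simp add: forest_of_def)

lemma adj_forest_of_iff:
  "adj (forest_of V p) x y \<longleftrightarrow> x \<in> V \<and> y \<in> V \<and> (y = p x \<or> x = p y)"
  by (auto simp: adj_def forest_of_def doubleton_eq_iff)

lemma is_cycle_adj_nth:
  assumes "is_cycle G c" "j < length c"
  shows "adj G (c ! j) (c ! (Suc j mod length c))"
proof (cases "Suc j < length c")
  case True
  then show ?thesis using assms by (simp add: is_cycle_def successively_conv_nth)
next
  case False
  then have "Suc j = length c" using assms(2) by simp
  moreover from this have "j = length c - 1" "c \<noteq> []" by auto
  ultimately show ?thesis
    using assms(1) by (simp add: is_cycle_def last_conv_nth hd_conv_nth)
qed

text \<open>
  At a vertex of largest rank on a cycle, both neighbours on the cycle would have to be its parent.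
\<close>

lemma acyclic_forest_of:
  assumes "descending V p"
  shows "\<not> is_cycle (forest_of V p) c"
proof
  assume c: "is_cycle (forest_of V p) c"
  let ?n = "length c"
  have n: "3 \<le> ?n" and dist: "distinct c" using c by (auto simp: is_cycle_def)
  obtain r :: "'a \<Rightarrow> nat" where r: "\<forall>u \<in> V. p u \<in> V \<longrightarrow> r (p u) < r u"
    using assms by (auto simp: descending_def)
  have fin: "finite ((\<lambda>j. r (c ! j)) ` {..<?n})" and ne: "(\<lambda>j. r (c ! j)) ` {..<?n} \<noteq> {}"
    using n by (auto simp: lessThan_empty_iff)
  obtain i where i: "i < ?n" "r (c ! i) = Max ((\<lambda>j. r (c ! j)) ` {..<?n})"
    using Max_in[OF fin ne] by auto
  have max: "r (c ! j) \<le> r (c ! i)" if "j < ?n" for j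
    unfolding i(2) using that by (intro Max_ge fin) auto
  have up: "c ! j = p (c ! i)"
    if "j < ?n" "adj (forest_of V p) (c ! i) (c ! j) \<or> adj (forest_of V p) (c ! j) (c ! i)" for j
    using that max[of j] r unfolding adj_forest_of_iff by (metis not_less)
  \<comment> \<open>The cyclic predecessor of \<open>i\<close>; it differs from the successor because the cycle has at least three vertices.\<close>
  define j where "j = (if i = 0 then ?n - 1 else i - 1)"
  have j: "j < ?n" "Suc j mod ?n = i" using i n by (auto simp: j_def)
  have m: "Suc i mod ?n < ?n" using i(1) by (intro mod_less_divisor) linarith
  have "c ! (Suc i mod ?n) = p (c ! i)"
    using is_cycle_adj_nth[OF c i(1)] by (intro up m disjI1)
  moreover have "c ! j = p (c ! i)"
    using up[OF j(1)] is_cycle_adj_nth[OF c j(1)] j(2) by simp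
  ultimately have "c ! (Suc i mod ?n) = c ! j" by simp
  then have eq: "Suc i mod ?n = j" using m nth_eq_iff_index_eq[OF dist] j(1) by blast
  show False
  proof (cases "Suc i < ?n")
    case True
    then show ?thesis using eq n by (auto simp: j_def split: if_splits)
  next
    case False
    then have "Suc i = ?n" using i by simp
    then show ?thesis using eq n by (auto simp: j_def split: if_splits)
  qed
qed

definition root_of :: "'a set \<Rightarrow> ('a \<Rightarrow> 'a) \<Rightarrow> 'a \<Rightarrow> 'a" where
  "root_of V p = exit_point {u \<in> V. p u \<in> V} p"

context
  fixes V :: "'a set" and s :: 'a and p :: "'a \<Rightarrow> 'a"
  assumes s: "s \<notin> V" and p: "p \<in> parent_maps V {s}"
begin

lemma parent_map_cases: "v \<in> V \<Longrightarrow> p v \<in> V \<or> p v = s"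
  using parent_mapsD(2)[OF p] by auto

lemma descending_nonroots: "descending {u \<in> V. p u \<in> V} p"
  by (rule descending_subset[OF parent_mapsD(1)[OF p]]) auto

lemma root_of_parent: "v \<in> V \<Longrightarrow> p v \<in> V \<Longrightarrow> root_of V p (p v) = root_of V p v"
  unfolding root_of_def using exit_point_step[OF descending_nonroots, of v] by simp

lemma root_of_root: "p v = s \<Longrightarrow> root_of V p v = v"
  unfolding root_of_def using s by (intro exit_point_outside) simp

lemma root_of_mem:
  assumes "v \<in> V"
  shows "root_of V p v \<in> V" "p (root_of V p v) = s"
proof -
  have "root_of V p v \<in> {u \<in> V. p u = s}"
  proof (cases "p v \<in> V")
    case True
    then have v: "v \<in> {u \<in> V. p u \<in> V}" using assms by simp
    show ?thesis unfolding root_of_def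
    proof (rule exit_point_mem[OF descending_nonroots v])
      fix u assume "u \<in> {u \<in> V. p u \<in> V}"
      then show "p u \<in> {u \<in> V. p u \<in> V} \<union> {u \<in> V. p u = s}"
        using parent_map_cases[of "p u"] by auto
    qed
  next
    case False
    then have "p v = s" using parent_map_cases assms by blast
    then show ?thesis using root_of_root assms by simp
  qed
  then show "root_of V p v \<in> V" "p (root_of V p v) = s" by auto
qed

lemma adj_root_of: "adj (forest_of V p) x y \<Longrightarrow> root_of V p x = root_of V p y"
  using root_of_parent by (auto simp: adj_forest_of_iff)

lemma connected_root_of:
  assumes "v \<in> V"
  shows "(adj (forest_of V p))\<^sup>*\<^sup>* v (root_of V p v)" "(adj (forest_of V p))\<^sup>*\<^sup>* (root_of V p v) v"
proof -
  show *: "(adj (forest_of V p))\<^sup>*\<^sup>* v (root_of V p v)"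
    using parent_mapsD(1)[OF p] assms
  proof (induction v rule: descending_induct)
    case (step v)
    show ?case
    proof (cases "p v \<in> V")
      case True
      then have "adj (forest_of V p) v (p v)" using step.hyps by (simp add: adj_forest_of_iff)
      then show ?thesis
        using step.IH[OF True] root_of_parent[OF step.hyps True] by (simp add: converse_rtranclp_into_rtranclp)
    next
      case False
      then have "p v = s" using parent_map_cases step.hyps by blast
      then show ?thesis by (simp add: root_of_root)
    qed
  qed
  have "symp (adj (forest_of V p))" by (auto simp: symp_def adj_def insert_commute)
  then show "(adj (forest_of V p))\<^sup>*\<^sup>* (root_of V p v) v"
    using * by (meson symp_rtranclp sympD)
qed

lemma connected_forest_of_iff:
  assumes "v \<in> V" "w \<in> V"
  shows "(adj (forest_of V p))\<^sup>*\<^sup>* v w \<longleftrightarrow> root_of V p v = root_of V p w"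
proof
  show "root_of V p v = root_of V p w" if "(adj (forest_of V p))\<^sup>*\<^sup>* v w"
    using that by induction (auto dest: adj_root_of)
  show "(adj (forest_of V p))\<^sup>*\<^sup>* v w" if "root_of V p v = root_of V p w"
    using connected_root_of(1)[OF assms(1)] connected_root_of(2)[OF assms(2)] that by simp
qed

lemma verts_graph_component_forest_of:
  assumes "v \<in> V"
  shows "verts (graph_component (forest_of V p) v) = {w \<in> V. root_of V p w = root_of V p v}"
  using connected_forest_of_iff[OF assms] by (auto simp: graph_component_def Let_def)

lemma parent_tree_rooted_component:
  assumes "v \<in> V" "p v = s"
  shows "\<exists>d. parent_tree (rooted_component (forest_of V p) v) p d"
proof -
  let ?C = "{w \<in> V. root_of V p w = v}" and ?T = "rooted_component (forest_of V p) v"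
  have verts: "verts ?T = ?C"
    using verts_graph_component_forest_of[OF assms(1)] root_of_root[OF assms(2)]
    by (simp add: rooted_component_def)
  have rt: "rt ?T = v" by (simp add: rooted_component_def)
  have par: "p w \<in> ?C" if "w \<in> ?C" "w \<noteq> v" for w
  proof -
    have "p w \<in> V" using that parent_map_cases[of w] root_of_root[of w] by auto
    then show ?thesis using that root_of_parent[of w] by simp
  qed
  have edges: "edges ?T = (\<lambda>w. {w, p w}) ` (?C - {v})"
  proof -
    have "edges ?T = {e \<in> edges (forest_of V p). e \<subseteq> ?C}"
      using verts by (simp add: rooted_component_def graph_component_def Let_def)
    also have "\<dots> = (\<lambda>w. {w, p w}) ` (?C - {v})"
      using par assms s by (auto simp: forest_of_def)
    finally show ?thesis .
  qed
  obtain d where d: "\<And>w. d w = (if w \<in> {u \<in> V. p u \<in> V} then Suc (d (p w)) else (0 :: nat))"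
    using descending_exit_time[OF descending_nonroots] by metis
  have "parent_tree ?T p d"
  proof
    show "rt ?T \<in> verts ?T" using assms root_of_root by (simp add: verts rt)
    show "d (rt ?T) = 0" using assms s by (subst d) (simp add: rt)
    show "edges ?T = (\<lambda>v. {v, p v}) ` (verts ?T - {rt ?T})" by (simp add: edges verts rt)
  next
    fix w assume w: "w \<in> verts ?T" "w \<noteq> rt ?T"
    show "p w \<in> verts ?T" using par w by (simp add: verts rt)
    show "d w = Suc (d (p w))" using par[of w] w d[of w] by (simp add: verts rt)
  qed
  then show ?thesis by blast
qed

lemma card_roots: "card {v \<in> V. p v = s} = card (graph_components (forest_of V p))"
proof (rule bij_betw_same_card[of "graph_component (forest_of V p)"], unfold bij_betw_def, intro conjI)
  let ?f = "forest_of V p"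
  show "inj_on (graph_component ?f) {v \<in> V. p v = s}"
  proof
    fix v w assume vw: "v \<in> {v \<in> V. p v = s}" "w \<in> {v \<in> V. p v = s}"
      "graph_component ?f v = graph_component ?f w"
    then have "v \<in> verts (graph_component ?f w)"
      using verts_graph_component_forest_of[of v] by simp
    then show "v = w" using verts_graph_component_forest_of[of w] vw root_of_root by simp
  qed
  have "graph_component ?f v = graph_component ?f (root_of V p v)" if "v \<in> V" for v
  proof -
    have "verts (graph_component ?f v) = verts (graph_component ?f (root_of V p v))"
      using verts_graph_component_forest_of that root_of_mem[OF that] root_of_root by simp
    then show ?thesis by (simp add: graph_component_def Let_def)
  qed
  then show "graph_component ?f ` {v \<in> V. p v = s} = graph_components ?f"
    unfolding graph_components_def verts_forest_of using root_of_mem by blast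
qed

end

text \<open>
  If \<open>p'\<close> does not use the edge \<open>{v, p v}\<close> from \<open>v\<close>, it uses it from \<open>p v\<close>. But the two maps agree at \<open>p v\<close>, by
  induction, so \<open>p\<close> would lead from \<open>p v\<close> back to \<open>v\<close>.
\<close>

lemma parent_maps_eqI:
  assumes "s \<notin> V" "p \<in> parent_maps V {s}" "p' \<in> parent_maps V {s}"
    and f: "forest_of V p = forest_of V p'"
    and roots: "\<And>v. v \<in> V \<Longrightarrow> p v = s \<longleftrightarrow> p' v = s"
  shows "p = p'"
proof
  fix v
  show "p v = p' v"
  proof (cases "v \<in> V")
    case True
    show ?thesis using parent_mapsD(1)[OF assms(2)] True
    proof (induction v rule: descending_induct)
      case (step v)
      show ?case
      proof (cases "p v = s")
        case True
        then show ?thesis using roots step.hyps by simp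
      next
        case False
        then have pv: "p v \<in> V" using parent_mapsD(2)[OF assms(2) step.hyps] by simp
        then have "adj (forest_of V p) v (p v)" using step.hyps by (simp add: adj_forest_of_iff)
        then have "p v = p' v \<or> v = p' (p v)" unfolding f by (simp add: adj_forest_of_iff)
        moreover have "v \<noteq> p' (p v)"
          using step.IH[OF pv] descending_no_two_cycle[OF parent_mapsD(1)[OF assms(2)] step.hyps pv] by simp
        ultimately show ?thesis by blast
      qed
    qed
  next
    case False
    then show ?thesis using parent_mapsD(3)[OF assms(2)] parent_mapsD(3)[OF assms(3)]
      by (simp add: extensional_def)
  qed
qed

lemma graph_component_eq:
  assumes "w \<in> verts (graph_component f v)"
  shows "graph_component f w = graph_component f v"
proof -
  have "symp (adj f)" by (auto simp: symp_def adj_def insert_commute)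
  then have "(adj f)\<^sup>*\<^sup>* w v" "(adj f)\<^sup>*\<^sup>* v w"
    using assms symp_rtranclp[of "adj f"] by (auto simp: graph_component_def Let_def dest: sympD)
  then have "(adj f)\<^sup>*\<^sup>* w u \<longleftrightarrow> (adj f)\<^sup>*\<^sup>* v u" for u
    by (meson rtranclp_trans)
  then show ?thesis by (simp add: graph_component_def)
qed

lemma mem_graph_component_self: "v \<in> verts f \<Longrightarrow> v \<in> verts (graph_component f v)"
  by (simp add: graph_component_def Let_def)

lemma rooted_tree_rooted_component:
  assumes "simple_graph f" "\<And>c. \<not> is_cycle f c" "v \<in> verts f"
  shows "rooted_tree (rooted_component f v)"
proof -
  let ?T = "rooted_component f v" and ?C = "verts (graph_component f v)"
  have C: "verts ?T = ?C" "edges ?T = {e \<in> edges f. e \<subseteq> ?C}"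
    by (simp_all add: rooted_component_def graph_component_def Let_def)
  have adjT: "adj ?T x y \<longleftrightarrow> adj f x y \<and> x \<in> ?C \<and> y \<in> ?C" for x y
    by (auto simp: adj_def C)
  have memC: "w \<in> ?C \<longleftrightarrow> w \<in> verts f \<and> (adj f)\<^sup>*\<^sup>* v w" for w
    by (simp add: graph_component_def Let_def)
  have reach: "(adj ?T)\<^sup>*\<^sup>* v w \<and> w \<in> ?C" if "(adj f)\<^sup>*\<^sup>* v w" for w
    using that
  proof induction
    case base
    then show ?case using assms(3) by (simp add: memC)
  next
    case (step x y)
    have "y \<in> verts f" using step.hyps(2) assms(1) by (auto simp: adj_def simple_graph_def)
    moreover have "(adj f)\<^sup>*\<^sup>* v y" using step.hyps by simp
    ultimately have "y \<in> ?C" by (simp add: memC)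
    then show ?case using step by (auto simp: adjT intro: rtranclp.rtrancl_into_rtrancl)
  qed
  have "symp (adj ?T)" by (auto simp: symp_def adj_def insert_commute)
  then have sym: "symp ((adj ?T)\<^sup>*\<^sup>*)" by (rule symp_rtranclp)
  have "(adj ?T)\<^sup>*\<^sup>* x y" if "x \<in> ?C" "y \<in> ?C" for x y
  proof (rule rtranclp_trans)
    have "(adj ?T)\<^sup>*\<^sup>* v x" using that(1) reach by (simp add: memC)
    then show "(adj ?T)\<^sup>*\<^sup>* x v" by (rule sympD[OF sym])
    show "(adj ?T)\<^sup>*\<^sup>* v y" using that(2) reach by (simp add: memC)
  qed
  then have "connected_graph ?T" by (simp add: connected_graph_def C)
  moreover have "\<not> is_cycle ?T c" for c
  proof
    assume "is_cycle ?T c"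
    then have "is_cycle f c"
      unfolding is_cycle_def using successively_mono[of "adj ?T" c "adj f"] by (auto simp: adjT)
    then show False using assms(2) by blast
  qed
  moreover have "simple_graph ?T" using assms(1) by (auto simp: simple_graph_def C)
  moreover have "rt ?T \<in> verts ?T" using assms(3) by (simp add: memC C(1) rooted_component_def)
  ultimately show ?thesis by (simp add: rooted_tree_def)
qed

text \<open>
  The parent maps of a given forest correspond to the choices of one root in each component. With the
  root \<open>r0\<close> imposed in its component, their number is the product of the sizes of all other components.
\<close>

lemma bij_betw_root_choices:
  assumes fin: "finite (verts f)" and simple: "simple_graph f" and acyclic: "\<And>c. \<not> is_cycle f c"
    and s: "s \<notin> verts f" and o: "r0 \<in> verts f"
  shows "\<exists>P. bij_betw P
    (\<Pi>\<^sub>E t \<in> graph_components f. if t = graph_component f r0 then {r0} else verts t)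
    {p \<in> parent_maps (verts f) {s}. p r0 = s \<and> forest_of (verts f) p = f}"
proof -
  define V where "V = verts f"
  define comp where "comp = graph_component f"
  define K where "K = (\<Pi>\<^sub>E t \<in> graph_components f. if t = comp r0 then {r0} else verts t)"
  have "\<exists>\<pi> d. \<forall>r \<in> V. parent_tree (rooted_component f r) (\<pi> r) (d r)"
    using rooted_tree_imp_parent_tree[OF rooted_tree_rooted_component[OF simple acyclic]]
    unfolding V_def by metis
  then obtain \<pi> d where "\<forall>r \<in> V. parent_tree (rooted_component f r) (\<pi> r) (d r)" by blast
  then have tree: "parent_tree (rooted_component f r) (\<pi> r) (d r)" if "r \<in> V" for r
    using that by blast
  have V_rc: "verts (rooted_component f r) = verts (comp r)" "rt (rooted_component f r) = r"
    "edges (rooted_component f r) = edges (comp r)" for r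
    by (simp_all add: rooted_component_def comp_def)
  have comp_sub: "verts (comp v) \<subseteq> V" for v by (auto simp: comp_def graph_component_def Let_def V_def)
  have self: "v \<in> verts (comp v)" if "v \<in> V" for v
    using mem_graph_component_self that by (simp add: comp_def V_def)
  have comp_eq: "comp w = comp v" if "w \<in> verts (comp v)" for v w
    using graph_component_eq that by (simp add: comp_def)
  have CC: "graph_components f = comp ` V" by (simp add: graph_components_def comp_def V_def)
  define P where "P R v = (if v \<in> V then let r = R (comp v) in if v = r then s else \<pi> r v else undefined)"
    for R v
  have choice: "R (comp v) \<in> verts (comp v)" "R (comp v) \<in> V" "comp (R (comp v)) = comp v"
    if "R \<in> K" "v \<in> V" for R v
  proof -
    have "R (comp v) \<in> (if comp v = comp r0 then {r0} else verts (comp v))"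
      using that unfolding K_def CC by (auto simp: PiE_iff)
    then show *: "R (comp v) \<in> verts (comp v)"
      using self[of r0] o by (auto simp: V_def split: if_splits)
    then show "R (comp v) \<in> V" "comp (R (comp v)) = comp v" using comp_sub comp_eq by blast+
  qed
  have step: "\<pi> (R (comp v)) v \<in> verts (comp v)" "\<pi> (R (comp v)) v \<in> V" "comp (\<pi> (R (comp v)) v) = comp v"
    "d (R (comp v)) v = Suc (d (R (comp v)) (\<pi> (R (comp v)) v))"
    if "R \<in> K" "v \<in> V" "v \<noteq> R (comp v)" for R v
  proof -
    note c = choice[OF that(1,2)]
    have v: "v \<in> verts (comp (R (comp v)))" unfolding c(3) using self that(2) .
    show *: "\<pi> (R (comp v)) v \<in> verts (comp v)"
      using parent_tree.parent[OF tree[OF c(2)], of v] v that(3) c(3) by (simp add: V_rc)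
    then show "\<pi> (R (comp v)) v \<in> V" "comp (\<pi> (R (comp v)) v) = comp v" using comp_sub comp_eq by blast+
    show "d (R (comp v)) v = Suc (d (R (comp v)) (\<pi> (R (comp v)) v))"
      using parent_tree.depth[OF tree[OF c(2)], of v] v that(3) by (simp add: V_rc)
  qed
  have P_s: "P R v = s \<longleftrightarrow> v = R (comp v)" if "R \<in> K" "v \<in> V" for R v
    using step(2)[OF that] that(2) s by (auto simp: P_def Let_def V_def)
  have P_V: "P R v = \<pi> (R (comp v)) v" if "v \<in> V" "v \<noteq> R (comp v)" for R v
    using that by (simp add: P_def Let_def)
  have P_pm: "P R \<in> parent_maps V {s}" if R: "R \<in> K" for R
  proof -
    have "d (R (comp (P R v))) (P R v) < d (R (comp v)) v" if v: "v \<in> V" "P R v \<in> V" for v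
    proof -
      have "v \<noteq> R (comp v)" using P_s[OF R v(1)] v(2) s by (auto simp: V_def)
      then show ?thesis using step[OF R v(1)] P_V[OF v(1), of R] by simp
    qed
    then have "descending V (P R)"
      unfolding descending_def by (intro exI[of _ "\<lambda>v. d (R (comp v)) v"]) blast
    moreover have "P R v \<in> V \<union> {s}" if "v \<in> V" for v
      using P_s[OF R that] P_V[OF that, of R] step(2)[OF R that] by (cases "v = R (comp v)") auto
    moreover have "P R \<in> extensional V" by (simp add: P_def extensional_def)
    ultimately show ?thesis by (auto simp: parent_maps_def PiE_def)
  qed
  have P_forest: "forest_of V (P R) = f" if R: "R \<in> K" for R
  proof -
    have "(\<lambda>v. {v, P R v}) ` {v \<in> V. P R v \<in> V} = edges f"
    proof (intro equalityI subsetI)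
      fix e assume "e \<in> (\<lambda>v. {v, P R v}) ` {v \<in> V. P R v \<in> V}"
      then obtain v where v: "v \<in> V" "P R v \<in> V" "e = {v, P R v}" by auto
      then have ne: "v \<noteq> R (comp v)" using P_s[OF R] s by (auto simp: V_def)
      note c = choice[OF R v(1)]
      have "v \<in> verts (comp (R (comp v)))" unfolding c(3) using self v(1) .
      then have "v \<in> verts (comp (R (comp v))) - {R (comp v)}" using ne by blast
      then have "e \<in> edges (rooted_component f (R (comp v)))"
        unfolding parent_tree.edges[OF tree[OF c(2)]] V_rc(1,2) v(3) P_V[where R = R, OF v(1) ne]
        by (rule imageI)
      then show "e \<in> edges f" by (simp add: V_rc comp_def graph_component_def Let_def)
    next
      fix e assume e: "e \<in> edges f"
      then have sub: "e \<subseteq> V" "card e = 2" using simple by (auto simp: simple_graph_def V_def)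
      then obtain x y where xy: "e = {x, y}" by (meson card_2_iff)
      have x: "x \<in> V" using sub xy by simp
      note c = choice[OF R x]
      have "adj f x y" using e xy by (simp add: adj_def)
      then have "(adj f)\<^sup>*\<^sup>* x y" by blast
      then have "e \<subseteq> verts (comp x)"
        using sub xy by (auto simp: comp_def graph_component_def Let_def V_def)
      then have "e \<in> edges (rooted_component f (R (comp x)))"
        using e unfolding V_rc(3) c(3) by (simp add: comp_def graph_component_def Let_def)
      then obtain v where v: "v \<in> verts (comp x)" "v \<noteq> R (comp x)" "e = {v, \<pi> (R (comp x)) v}"
        unfolding parent_tree.edges[OF tree[OF c(2)]] V_rc(1,2) c(3) by auto
      have vV: "v \<in> V" and cv: "comp v = comp x" using v(1) comp_sub comp_eq by blast+
      have ne: "v \<noteq> R (comp v)" using v(2) cv by simp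
      have "P R v = \<pi> (R (comp v)) v" by (rule P_V[where R = R, OF vV ne])
      then show "e \<in> (\<lambda>v. {v, P R v}) ` {v \<in> V. P R v \<in> V}"
        using v(3) cv vV step(2)[OF R vV ne] by (auto intro!: image_eqI[of _ _ v])
    qed
    then show ?thesis by (simp add: forest_of_def V_def)
  qed
  have oV: "r0 \<in> V" using o by (simp add: V_def)
  have R_o: "R (comp r0) = r0" if "R \<in> K" for R
    using that oV unfolding K_def CC by (auto simp: PiE_iff)
  have "bij_betw P K {p \<in> parent_maps V {s}. p r0 = s \<and> forest_of V p = f}"
    unfolding bij_betw_def
  proof
    show "inj_on P K"
    proof
      fix R R' assume R: "R \<in> K" "R' \<in> K" "P R = P R'"
      show "R = R'"
      proof (rule PiE_ext[OF R(1)[unfolded K_def] R(2)[unfolded K_def]])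
        fix t assume "t \<in> graph_components f"
        then obtain v where v: "t = comp v" "v \<in> V" by (auto simp: CC)
        note c = choice[OF R(1) v(2)]
        have "P R (R t) = s" using P_s[OF R(1) c(2)] c(3) v(1) by simp
        then show "R t = R' t" using P_s[OF R(2) c(2)] c(3) v(1) R(3) by simp
      qed
    qed
    show "P ` K = {p \<in> parent_maps V {s}. p r0 = s \<and> forest_of V p = f}"
    proof (intro equalityI subsetI)
      fix p assume "p \<in> P ` K"
      then show "p \<in> {p \<in> parent_maps V {s}. p r0 = s \<and> forest_of V p = f}"
        using P_pm P_forest P_s[OF _ oV] R_o[symmetric] by auto
    next
      fix p assume "p \<in> {p \<in> parent_maps V {s}. p r0 = s \<and> forest_of V p = f}"
      then have p: "p \<in> parent_maps V {s}" "p r0 = s" "forest_of V p = f" by auto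
      have sV: "s \<notin> V" using s by (simp add: V_def)
      note ro = root_of_mem[OF sV p(1)] root_of_root[OF sV p(1)]
      have vc: "verts (comp v) = {w \<in> V. root_of V p w = root_of V p v}" if "v \<in> V" for v
        using verts_graph_component_forest_of[OF sV p(1) that] by (simp add: comp_def p(3))
      define R where "R = restrict (\<lambda>t. root_of V p (SOME v. v \<in> verts t)) (graph_components f)"
      have R_comp: "R (comp v) = root_of V p v" if "v \<in> V" for v
      proof -
        have "(SOME w. w \<in> verts (comp v)) \<in> verts (comp v)" using self[OF that] by (rule someI)
        then show ?thesis using that by (simp add: R_def CC vc)
      qed
      have RK: "R \<in> K"
        unfolding K_def
      proof (rule PiE_I)
        fix t assume "t \<in> graph_components f"
        then obtain v where v: "t = comp v" "v \<in> V" by (auto simp: CC)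
        show "R t \<in> (if t = comp r0 then {r0} else verts t)"
        proof (cases "t = comp r0")
          case True
          then show ?thesis using R_comp[OF oV] ro(3)[OF p(2)] by simp
        next
          case False
          then show ?thesis using R_comp[OF v(2)] v ro by (simp add: vc)
        qed
      qed (simp add: R_def)
      have "P R = p"
      proof (rule parent_maps_eqI[OF sV P_pm[OF RK] p(1)])
        show "forest_of V (P R) = forest_of V p" using P_forest[OF RK] p(3) by simp
        show "P R v = s \<longleftrightarrow> p v = s" if "v \<in> V" for v
          using P_s[OF RK that] R_comp[OF that] ro(2)[OF that] ro(3)[of v] by metis
      qed
      then show "p \<in> P ` K" using RK by blast
    qed
  qed
  then show ?thesis unfolding V_def K_def comp_def by blast
qed

text \<open>
  The size of a component is the number of its possible roots. The component of \<open>r0\<close> is always rooted at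
  \<open>r0\<close>, and its size remains as a factor.
\<close>

lemma sum_forest_weight:
  fixes V :: "'a set" and g :: "'a ugraph \<Rightarrow> real"
  assumes V: "finite V" and s: "s \<notin> V" and o: "r0 \<in> V"
  shows "(\<Sum>f \<in> spanning_forests \<lparr>verts = V, edges = {e. e \<subseteq> V \<and> card e = 2}\<rparr>. forest_weight lam f * g f) =
    (\<Sum>p | p \<in> parent_maps V {s} \<and> p r0 = s.
       lam ^ card {v \<in> V. p v = s} * card {w \<in> V. root_of V p w = r0} * g (forest_of V p))"
    (is "(\<Sum>f \<in> ?F. _) = (\<Sum>p \<in> ?P. ?h p)")
proof -
  have finP: "finite ?P" using finite_parent_maps[OF V, of "{s}"] by simp
  have finF: "finite ?F"
    by (rule finite_spanning_forests) (use V in \<open>auto simp: simple_graph_def\<close>)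
  have sub: "forest_of V ` ?P \<subseteq> ?F"
  proof
    fix f assume "f \<in> forest_of V ` ?P"
    then obtain p where p: "p \<in> parent_maps V {s}" "f = forest_of V p" by auto
    have "p v \<noteq> v" if "v \<in> V" "p v \<in> V" for v
      using descending_no_two_cycle[OF parent_mapsD(1)[OF p(1)] that] by metis
    then have "edges f \<subseteq> {e. e \<subseteq> V \<and> card e = 2}"
      unfolding p(2) by (auto simp: forest_of_def card_2_iff)
    then show "f \<in> ?F"
      using acyclic_forest_of[OF parent_mapsD(1)[OF p(1)]] p(2) by (auto simp: spanning_forests_def)
  qed
  have fibre: "(\<Sum>p | p \<in> ?P \<and> forest_of V p = f. ?h p) = forest_weight lam f * g f" if f: "f \<in> ?F" for f
  proof -
    let ?C = "graph_components f" and ?t0 = "graph_component f r0"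
    have Vf: "verts f = V" and simple: "simple_graph f" and acyclic: "\<And>c. \<not> is_cycle f c"
      using f by (auto simp: spanning_forests_def simple_graph_def)
    have finC: "finite ?C" using V by (simp add: graph_components_def Vf)
    have t0: "?t0 \<in> ?C" using o by (simp add: graph_components_def Vf)
    obtain P where P: "bij_betw P (\<Pi>\<^sub>E t \<in> ?C. if t = ?t0 then {r0} else verts t)
        {p \<in> parent_maps V {s}. p r0 = s \<and> forest_of V p = f}"
      using bij_betw_root_choices[of f s r0] V s o simple acyclic unfolding Vf by blast
    have "card {p \<in> parent_maps V {s}. p r0 = s \<and> forest_of V p = f} =
        card (\<Pi>\<^sub>E t \<in> ?C. if t = ?t0 then {r0} else verts t)"
      using bij_betw_same_card[OF P] by simp
    also have "\<dots> = (\<Prod>t \<in> ?C. if t = ?t0 then 1 else card (verts t))"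
      by (subst card_PiE[OF finC]) (intro prod.cong refl, auto)
    also have "\<dots> = (\<Prod>t \<in> ?C - {?t0}. card (verts t))"
      by (subst prod.remove[OF finC t0]) (auto intro!: prod.cong)
    finally have card: "card {p \<in> ?P. forest_of V p = f} = (\<Prod>t \<in> ?C - {?t0}. card (verts t))"
      by (simp add: conj_assoc)
    have "?h p = lam ^ card ?C * card (verts ?t0) * g f" if "p \<in> ?P" "forest_of V p = f" for p
    proof -
      have p: "p \<in> parent_maps V {s}" "p r0 = s" using that by auto
      have "card {v \<in> V. p v = s} = card ?C" using card_roots[OF s p(1)] that(2) by simp
      moreover have "{w \<in> V. root_of V p w = r0} = verts ?t0"
        using verts_graph_component_forest_of[OF s p(1) o] root_of_root[OF s p(1,2)] that(2) by simp
      ultimately show ?thesis using that(2) by simp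
    qed
    then have "(\<Sum>p | p \<in> ?P \<and> forest_of V p = f. ?h p) =
        (\<Sum>p | p \<in> ?P \<and> forest_of V p = f. lam ^ card ?C * card (verts ?t0) * g f)"
      by (intro sum.cong refl) blast
    also have "\<dots> = card {p \<in> ?P. forest_of V p = f} * (lam ^ card ?C * card (verts ?t0) * g f)"
      by simp
    also have "\<dots> = forest_weight lam f * g f"
      unfolding card forest_weight_def prod.remove[OF finC t0] by simp
    finally show ?thesis .
  qed
  have "(\<Sum>p \<in> ?P. ?h p) = (\<Sum>f \<in> ?F. \<Sum>p | p \<in> ?P \<and> forest_of V p = f. ?h p)"
    using sum.group[OF finP finF sub, of ?h] by simp
  also have "\<dots> = (\<Sum>f \<in> ?F. forest_weight lam f * g f)"
    using fibre by (intro sum.cong) auto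
  finally show ?thesis ..
qed


section \<open>Forests with a prescribed ball\<close>

text \<open>
  The set \<open>R\<close>, on which the map is prescribed, will be the root of a tree when embeddings are counted, and
  empty when bijections are counted.
\<close>

lemma card_inj_extensions:
  assumes "finite A" "finite R" "A \<inter> R = {}" "finite V" "inj_on f0 R" "f0 ` R \<subseteq> V"
  shows "card {\<phi> \<in> R \<union> A \<rightarrow>\<^sub>E V. inj_on \<phi> (R \<union> A) \<and> (\<forall>r \<in> R. \<phi> r = f0 r)} =
    (\<Prod>i<card A. card V - card R - i)"
  using assms(1,3)
proof (induction A rule: finite_induct)
  case empty
  have "{\<phi> \<in> R \<union> {} \<rightarrow>\<^sub>E V. inj_on \<phi> (R \<union> {}) \<and> (\<forall>r \<in> R. \<phi> r = f0 r)} = {restrict f0 R}"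
  proof (intro equalityI subsetI)
    fix \<phi> assume "\<phi> \<in> {\<phi> \<in> R \<union> {} \<rightarrow>\<^sub>E V. inj_on \<phi> (R \<union> {}) \<and> (\<forall>r \<in> R. \<phi> r = f0 r)}"
    then show "\<phi> \<in> {restrict f0 R}" by (auto simp: PiE_iff extensional_def fun_eq_iff)
  qed (use assms(5,6) in auto)
  then show ?case by simp
next
  case (insert x A)
  define E where "E A = {\<phi> \<in> R \<union> A \<rightarrow>\<^sub>E V. inj_on \<phi> (R \<union> A) \<and> (\<forall>r \<in> R. \<phi> r = f0 r)}" for A
  have x: "x \<notin> R \<union> A" using insert by auto
  have RA: "finite (R \<union> A)" "card (R \<union> A) = card R + card A"
    using insert.hyps(1) insert.prems assms(2) card_Un_disjoint[of R A] by auto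
  have "bij_betw (\<lambda>(\<phi>, y). \<phi>(x := y)) (Sigma (E A) (\<lambda>\<phi>. V - \<phi> ` (R \<union> A))) (E (insert x A))"
  proof (rule bij_betw_byWitness[where f' = "\<lambda>\<phi>. (restrict \<phi> (R \<union> A), \<phi> x)"])
    show "\<forall>z \<in> Sigma (E A) (\<lambda>\<phi>. V - \<phi> ` (R \<union> A)).
        (\<lambda>\<phi>. (restrict \<phi> (R \<union> A), \<phi> x)) (case z of (\<phi>, y) \<Rightarrow> \<phi>(x := y)) = z"
      using x by (auto simp: E_def PiE_iff extensional_def fun_eq_iff)
    show "\<forall>\<phi> \<in> E (insert x A). (case (restrict \<phi> (R \<union> A), \<phi> x) of (\<phi>, y) \<Rightarrow> \<phi>(x := y)) = \<phi>"
      using x by (auto simp: E_def PiE_iff extensional_def fun_eq_iff)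
    show "(\<lambda>(\<phi>, y). \<phi>(x := y)) ` Sigma (E A) (\<lambda>\<phi>. V - \<phi> ` (R \<union> A)) \<subseteq> E (insert x A)"
    proof
      fix \<psi> assume "\<psi> \<in> (\<lambda>(\<phi>, y). \<phi>(x := y)) ` Sigma (E A) (\<lambda>\<phi>. V - \<phi> ` (R \<union> A))"
      then obtain \<phi> y where p: "\<psi> = \<phi>(x := y)" "\<phi> \<in> E A" "y \<in> V" "y \<notin> \<phi> ` (R \<union> A)" by auto
      have "inj_on \<psi> (insert x (R \<union> A))"
        unfolding p(1) using p(2,4) x by (intro inj_on_fun_updI inj_on_insert[THEN iffD2] conjI)
          (auto simp: E_def inj_on_def)
      moreover have "\<psi> \<in> insert x (R \<union> A) \<rightarrow>\<^sub>E V" "\<forall>r \<in> R. \<psi> r = f0 r"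
        using p x by (auto simp: E_def PiE_iff extensional_def)
      ultimately show "\<psi> \<in> E (insert x A)" by (simp add: E_def)
    qed
    show "(\<lambda>\<phi>. (restrict \<phi> (R \<union> A), \<phi> x)) ` E (insert x A) \<subseteq> Sigma (E A) (\<lambda>\<phi>. V - \<phi> ` (R \<union> A))"
    proof
      fix z assume "z \<in> (\<lambda>\<phi>. (restrict \<phi> (R \<union> A), \<phi> x)) ` E (insert x A)"
      then obtain \<phi> where p: "z = (restrict \<phi> (R \<union> A), \<phi> x)" "\<phi> \<in> E (insert x A)" by auto
      have inj: "inj_on \<phi> (insert x (R \<union> A))" using p(2) by (simp add: E_def)
      then have "inj_on (restrict \<phi> (R \<union> A)) (R \<union> A)" "\<phi> x \<notin> \<phi> ` (R \<union> A)"
        using x by (auto simp: inj_on_def)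
      then show "z \<in> Sigma (E A) (\<lambda>\<phi>. V - \<phi> ` (R \<union> A))"
        using p by (auto simp: E_def PiE_iff)
    qed
  qed
  then have "card (E (insert x A)) = card (Sigma (E A) (\<lambda>\<phi>. V - \<phi> ` (R \<union> A)))"
    using bij_betw_same_card by metis
  also have "\<dots> = (\<Sum>\<phi> \<in> E A. card (V - \<phi> ` (R \<union> A)))"
  proof (rule card_SigmaI)
    have "finite (R \<union> A \<rightarrow>\<^sub>E V)" using RA assms(4) by (simp add: finite_PiE)
    then show "finite (E A)" unfolding E_def by (rule rev_finite_subset) auto
  qed (use assms(4) in simp)
  also have "\<dots> = (\<Sum>\<phi> \<in> E A. card V - card R - card A)"
  proof (intro sum.cong refl)
    fix \<phi> assume "\<phi> \<in> E A"
    then have "\<phi> ` (R \<union> A) \<subseteq> V" "card (\<phi> ` (R \<union> A)) = card (R \<union> A)"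
      by (auto simp: E_def card_image)
    then show "card (V - \<phi> ` (R \<union> A)) = card V - card R - card A"
      using RA by (simp add: card_Diff_subset)
  qed
  also have "\<dots> = (\<Prod>i<card (insert x A). card V - card R - i)"
    using insert by (simp add: E_def)
  finally show ?case by (simp add: E_def)
qed

text \<open>
  For a fixed \<open>\<phi>\<close> the event only concerns parents: on the image of \<open>\<phi>\<close> they are dictated by \<open>\<pi>\<close>, and a vertex
  outside the image must not hang from a vertex of the ball that is off the boundary.
\<close>

lemma isos_trunc_component_iff:
  assumes T: "parent_tree T \<pi> d" and le: "\<And>v. v \<in> verts T \<Longrightarrow> d v \<le> h"
    and s: "s \<notin> V" and p: "p \<in> parent_maps V {s}" and o: "r0 \<in> V" "p r0 = s"
  shows "\<phi> \<in> isos T (trunc h (rooted_component (forest_of V p) r0)) \<longleftrightarrow>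
    \<phi> \<in> verts T \<rightarrow>\<^sub>E V \<and> inj_on \<phi> (verts T) \<and> \<phi> (rt T) = r0 \<and>
    (\<forall>v \<in> verts T. v \<noteq> rt T \<longrightarrow> p (\<phi> v) = \<phi> (\<pi> v)) \<and>
    (\<forall>u \<in> V - \<phi> ` verts T. p u \<notin> \<phi> ` {v \<in> verts T. d v < h})"
    (is "?L \<longleftrightarrow> ?R")
proof -
  let ?T' = "rooted_component (forest_of V p) r0"
  interpret T: parent_tree T \<pi> d by fact
  obtain d' where "parent_tree ?T' p d'"
    using parent_tree_rooted_component[OF s p o] by blast
  then interpret T': parent_tree ?T' p d' .
  have vT': "verts ?T' = {w \<in> V. root_of V p w = r0}"
    using verts_graph_component_forest_of[OF s p o(1)] root_of_root[OF s p o(2)]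
    by (simp add: rooted_component_def)
  have rT': "rt ?T' = r0" by (simp add: rooted_component_def)
  note iff = isos_trunc_iff[OF T T'.parent_tree_axioms le, where \<phi> = \<phi>]
  show ?thesis
  proof
    assume L: ?L
    then have phi: "inj_on \<phi> (verts T)" "\<phi> ` verts T = verts (trunc h ?T')"
      "\<phi> (rt T) = r0" "\<phi> \<in> extensional (verts T)"
      by (auto simp: isos_def bij_betw_def T'.rt_trunc rT')
    have sub: "\<phi> v \<in> V" if "v \<in> verts T" for v
    proof -
      have "\<phi> v \<in> verts (trunc h ?T')" using that phi(2) by blast
      then show ?thesis by (simp add: T'.verts_trunc vT')
    qed
    have "p u \<notin> \<phi> ` {v \<in> verts T. d v < h}" if u: "u \<in> V - \<phi> ` verts T" for u
    proof
      assume "p u \<in> \<phi> ` {v \<in> verts T. d v < h}"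
      then obtain v where v: "v \<in> verts T" "d v < h" "p u = \<phi> v" by auto
      have pu: "p u \<in> V" using sub v by simp
      have "\<phi> v \<in> verts ?T'" using v(1) phi(2) by (auto simp: T'.verts_trunc)
      then have "root_of V p (\<phi> v) = r0" by (simp add: vT')
      then have "root_of V p u = r0" using u v(3) root_of_parent[OF s p, of u] pu by simp
      then have "u \<in> verts ?T'" unfolding vT' using u by simp
      moreover have "u \<noteq> r0" using pu o s by auto
      ultimately have "u \<in> T'.kids (\<phi> v)" using v(3) by (simp add: T'.kids_def rT')
      moreover have "bij_betw \<phi> (T.kids v) (T'.kids (\<phi> v))" using L iff v by blast
      ultimately have "u \<in> \<phi> ` T.kids v" by (simp add: bij_betw_def)
      then show False using u T.kids_subset by blast
    qed
    moreover have "p (\<phi> v) = \<phi> (\<pi> v)" if "v \<in> verts T" "v \<noteq> rt T" for v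
      using isos_parent[OF T T'.parent_tree_trunc L that] by simp
    ultimately show ?R using phi sub by (auto simp: PiE_iff)
  next
    assume R: ?R
    then have phi: "inj_on \<phi> (verts T)" "\<phi> (rt T) = r0" "\<phi> \<in> extensional (verts T)"
      "\<And>v. v \<in> verts T \<Longrightarrow> \<phi> v \<in> V"
      "\<And>v. v \<in> verts T \<Longrightarrow> v \<noteq> rt T \<Longrightarrow> p (\<phi> v) = \<phi> (\<pi> v)"
      "\<And>u. u \<in> V - \<phi> ` verts T \<Longrightarrow> p u \<notin> \<phi> ` {v \<in> verts T. d v < h}"
      by (auto simp: PiE_iff)
    have root: "root_of V p (\<phi> v) = r0" if "v \<in> verts T" for v
      using that
    proof (induction v rule: T.vertex_induct)
      case root
      then show ?case using phi(2) root_of_root[OF s p o(2)] by simp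
    next
      case (step v)
      then show ?case
        using root_of_parent[OF s p, of "\<phi> v"] phi(4)[of v] phi(4)[of "\<pi> v"] phi(5)[of v] T.parent[of v] by simp
    qed
    have "bij_betw \<phi> (T.kids v) (T'.kids (\<phi> v))" if v: "v \<in> verts T" "d v < h" for v
      unfolding bij_betw_def
    proof
      show "inj_on \<phi> (T.kids v)" using phi(1) T.kids_subset by (rule inj_on_subset)
      show "\<phi> ` T.kids v = T'.kids (\<phi> v)"
      proof (intro equalityI subsetI)
        fix x assume "x \<in> \<phi> ` T.kids v"
        then obtain w where w: "x = \<phi> w" "w \<in> verts T" "w \<noteq> rt T" "\<pi> w = v"
          by (auto simp: T.kids_def)
        moreover have "\<phi> w \<noteq> r0" using w(2,3) phi(1,2) T.root by (metis inj_onD)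
        ultimately show "x \<in> T'.kids (\<phi> v)" using phi(4,5) root by (simp add: T'.kids_def vT' rT')
      next
        fix x assume "x \<in> T'.kids (\<phi> v)"
        then have x: "x \<in> V" "x \<noteq> r0" "p x = \<phi> v" by (auto simp: T'.kids_def vT' rT')
        then have "x \<in> \<phi> ` verts T" using phi(6)[of x] v by blast
        then obtain w where w: "w \<in> verts T" "x = \<phi> w" by blast
        then have ne: "w \<noteq> rt T" using x phi(2) by auto
        have "\<phi> (\<pi> w) = \<phi> v" using phi(5)[OF w(1) ne] w(2) x(3) by simp
        then have "\<pi> w = v" using phi(1) T.parent[OF w(1) ne] v(1) by (auto dest: inj_onD)
        then show "x \<in> \<phi> ` T.kids v" using w ne by (auto simp: T.kids_def)
      qed
    qed
    then show ?L using phi(2,3) rT' by (intro iff[THEN iffD2]) auto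
  qed
qed

text \<open>
  A vertex outside the image of \<open>\<phi>\<close> can only hang from another such vertex, from a boundary vertex of the
  ball, or from \<open>s\<close>. No cycle can arise, since the forced parents decrease the depth inside the ball.
\<close>

lemma bij_betw_parent_maps_pattern:
  assumes T: "parent_tree T \<pi> d" and le: "\<And>v. v \<in> verts T \<Longrightarrow> d v \<le> h"
    and s: "s \<notin> V"
    and phi: "\<phi> \<in> verts T \<rightarrow>\<^sub>E V" "inj_on \<phi> (verts T)" "\<phi> (rt T) = r0"
  defines "A \<equiv> \<phi> ` verts T" and "D \<equiv> \<phi> ` {v \<in> verts T. d v = h}"
  defines "P \<equiv> {p \<in> parent_maps V {s}. p r0 = s \<and>
      (\<forall>v \<in> verts T. v \<noteq> rt T \<longrightarrow> p (\<phi> v) = \<phi> (\<pi> v)) \<and>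
      (\<forall>u \<in> V - A. p u \<notin> \<phi> ` {v \<in> verts T. d v < h})}"
  shows "bij_betw (\<lambda>p. restrict p (V - A)) P (parent_maps (V - A) (insert s D))"
proof -
  interpret T: parent_tree T \<pi> d by fact
  define i where "i = inv_into (verts T) \<phi>"
  have i: "i (\<phi> v) = v" if "v \<in> verts T" for v using phi(2) that by (simp add: i_def)
  have phiV: "\<phi> v \<in> V" if "v \<in> verts T" for v using phi(1) that by auto
  have AV: "A \<subseteq> V" using phiV by (auto simp: A_def)
  have oA: "r0 \<in> A" using T.root phi(3) by (auto simp: A_def)
  have root_iff: "\<phi> v = r0 \<longleftrightarrow> v = rt T" if "v \<in> verts T" for v
    using phi(2,3) T.root that by (metis inj_onD)
  define ext where "ext q x = (if x \<in> A then if x = r0 then s else \<phi> (\<pi> (i x)) else q x)" for q x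
  have ext_phi: "ext q (\<phi> v) = (if v = rt T then s else \<phi> (\<pi> v))" if "v \<in> verts T" for q v
    using that by (auto simp: ext_def A_def root_iff i)
  have ext_out: "ext q x = q x" if "x \<notin> A" for q x using that by (simp add: ext_def)
  show ?thesis
  proof (rule bij_betw_byWitness[where f' = ext])
    show "\<forall>p \<in> P. ext (restrict p (V - A)) = p"
    proof (intro ballI ext)
      fix p x assume p: "p \<in> P"
      consider v where "v \<in> verts T" "x = \<phi> v" | "x \<in> V - A" | "x \<notin> V" using AV by (auto simp: A_def)
      then show "ext (restrict p (V - A)) x = p x"
      proof cases
        case 1
        then show ?thesis using p phi(3) by (auto simp: ext_phi P_def)
      next
        case 2
        then show ?thesis by (simp add: ext_out)
      next
        case 3
        then show ?thesis using p parent_mapsD(3)[of p V "{s}"] AV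
          by (auto simp: ext_def P_def extensional_def)
      qed
    qed
    show "\<forall>q \<in> parent_maps (V - A) (insert s D). restrict (ext q) (V - A) = q"
      using parent_mapsD(3) by (fastforce simp: fun_eq_iff ext_def extensional_def)
    show "(\<lambda>p. restrict p (V - A)) ` P \<subseteq> parent_maps (V - A) (insert s D)"
    proof
      fix q assume "q \<in> (\<lambda>p. restrict p (V - A)) ` P"
      then obtain p where p: "p \<in> P" "q = restrict p (V - A)" by blast
      have pm: "p \<in> parent_maps V {s}" using p(1) by (simp add: P_def)
      have "descending (V - A) q"
        using parent_mapsD(1)[OF pm] by (rule descending_subset) (auto simp: p(2))
      moreover have "q u \<in> (V - A) \<union> insert s D" if u: "u \<in> V - A" for u
      proof -
        have "p u \<in> V \<union> {s}" using parent_mapsD(2)[OF pm] u by blast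
        moreover have "p u \<notin> \<phi> ` {v \<in> verts T. d v < h}" using p(1) u by (simp add: P_def)
        moreover have "A \<subseteq> \<phi> ` {v \<in> verts T. d v < h} \<union> D"
          using le by (fastforce simp: A_def D_def le_less)
        ultimately show ?thesis using u p(2) by auto
      qed
      ultimately show "q \<in> parent_maps (V - A) (insert s D)"
        by (auto simp: parent_maps_def PiE_iff p(2))
    qed
    show "ext ` parent_maps (V - A) (insert s D) \<subseteq> P"
    proof
      fix p assume "p \<in> ext ` parent_maps (V - A) (insert s D)"
      then obtain q where q: "q \<in> parent_maps (V - A) (insert s D)" "p = ext q" by blast
      note qD = parent_mapsD[OF q(1)]
      obtain r :: "'b \<Rightarrow> nat" where r: "\<forall>u \<in> V - A. q u \<in> V - A \<longrightarrow> r (q u) < r u"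
        using qD(1) by (auto simp: descending_def)
      \<comment> \<open>The shift by \<open>h + 1\<close> ranks all other vertices above those of the ball.\<close>
      define r' where "r' x = (if x \<in> A then d (i x) else r x + h + 1)" for x
      have "r' (p x) < r' x" if x: "x \<in> V" "p x \<in> V" for x
      proof (cases "x \<in> A")
        case True
        then obtain v where v: "v \<in> verts T" "x = \<phi> v" by (auto simp: A_def)
        then have ne: "v \<noteq> rt T" using x(2) s by (auto simp: q(2) ext_phi)
        then have "p x = \<phi> (\<pi> v)" "\<pi> v \<in> verts T"
          using v T.parent by (auto simp: q(2) ext_phi)
        then show ?thesis using v T.depth[OF v(1) ne] by (simp add: r'_def A_def i)
      next
        case False
        then have px: "p x = q x" by (simp add: q(2) ext_out)
        show ?thesis
        proof (cases "p x \<in> A")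
          case True
          then obtain v where "v \<in> verts T" "p x = \<phi> v" by (auto simp: A_def)
          then show ?thesis using False le[of v] by (simp add: r'_def A_def i)
        next
          case out: False
          then show ?thesis using r x False px by (auto simp: r'_def)
        qed
      qed
      then have "descending V p" unfolding descending_def by blast
      moreover have "p x \<in> V \<union> {s}" if "x \<in> V" for x
      proof (cases "x \<in> A")
        case True
        then obtain v where "v \<in> verts T" "x = \<phi> v" by (auto simp: A_def)
        then show ?thesis using T.parent phiV by (simp add: q(2) ext_phi)
      next
        case False
        then show ?thesis using qD(2)[of x] that phiV by (auto simp: q(2) ext_out D_def)
      qed
      moreover have "p \<in> extensional V"
        using qD(3) AV by (auto simp: q(2) ext_def extensional_def)
      ultimately have "p \<in> parent_maps V {s}" by (auto simp: parent_maps_def PiE_iff)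
      moreover have "p u \<notin> \<phi> ` {v \<in> verts T. d v < h}" if "u \<in> V - A" for u
      proof
        have "p u = q u" using that by (simp add: q(2) ext_out)
        moreover assume "p u \<in> \<phi> ` {v \<in> verts T. d v < h}"
        ultimately obtain v where v: "v \<in> verts T" "d v < h" "q u = \<phi> v" by auto
        have "q u \<in> A" "q u \<noteq> s" using v phiV s by (auto simp: A_def)
        then have "q u \<in> D" using qD(2)[OF that] by blast
        then show False using v phi(2) by (auto simp: D_def dest: inj_onD)
      qed
      moreover have "p r0 = s" using oA by (simp add: q(2) ext_def)
      ultimately show "p \<in> P" by (auto simp: P_def q(2) ext_phi)
    qed
  qed
qed


text \<open>
  The point \<open>s\<close> has weight \<open>lam\<close> and each of the \<open>k\<close> boundary vertices has weight \<open>1\<close>, so the weights sum to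
  \<open>lam + k\<close>. The component of \<open>r0\<close> consists of the \<open>a\<close> vertices of the ball and of the vertices that exit at
  a boundary vertex; the term \<open>m * k\<close> comes from the latter.
\<close>

lemma sum_parent_maps_pattern:
  fixes lam :: real
  assumes T: "parent_tree T \<pi> d" and le: "\<And>v. v \<in> verts T \<Longrightarrow> d v \<le> h"
    and V: "finite V" and s: "s \<notin> V"
    and phi: "\<phi> \<in> verts T \<rightarrow>\<^sub>E V" "inj_on \<phi> (verts T)" "\<phi> (rt T) = r0"
    and less: "card (verts T) < card V"
  defines "k \<equiv> card {v \<in> verts T. d v = h}" and "a \<equiv> card (verts T)"
  defines "m \<equiv> card V - card (verts T)"
  shows "(\<Sum>p | p \<in> parent_maps V {s} \<and> p r0 = s \<and>
        (\<forall>v \<in> verts T. v \<noteq> rt T \<longrightarrow> p (\<phi> v) = \<phi> (\<pi> v)) \<and>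
        (\<forall>u \<in> V - \<phi> ` verts T. p u \<notin> \<phi> ` {v \<in> verts T. d v < h}).
      lam ^ card {v \<in> V. p v = s} * card {w \<in> V. root_of V p w = r0}) =
    lam * (lam + k + m) ^ (m - 1) * (a * (lam + k) + m * k)"
proof -
  interpret T: parent_tree T \<pi> d by fact
  let ?A = "\<phi> ` verts T"
  define U where "U = V - ?A"
  define D where "D = \<phi> ` {v \<in> verts T. d v = h}"
  define y where "y x = (if x = s then lam else 1)" for x
  define P where "P = {p \<in> parent_maps V {s}. p r0 = s \<and>
        (\<forall>v \<in> verts T. v \<noteq> rt T \<longrightarrow> p (\<phi> v) = \<phi> (\<pi> v)) \<and>
        (\<forall>u \<in> V - ?A. p u \<notin> \<phi> ` {v \<in> verts T. d v < h})}"
  have AV: "?A \<subseteq> V" using phi(1) by auto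
  have finA: "finite ?A" using AV V by (rule finite_subset)
  have cA: "card ?A = a" unfolding a_def using phi(2) by (rule card_image)
  have oA: "r0 \<in> ?A" using T.root phi(3) by blast
  have DA: "D \<subseteq> ?A" by (auto simp: D_def)
  have fin: "finite U" "finite (insert s D)" using V finA DA by (auto simp: U_def intro: finite_subset)
  have disj: "U \<inter> insert s D = {}" using s DA by (auto simp: U_def)
  have cU: "card U = m" unfolding U_def m_def using cA finA AV by (simp add: card_Diff_subset a_def)
  have Une: "U \<noteq> {}" using cU less fin by (auto simp: m_def)
  have yU: "y u = 1" if "u \<in> U" for u using that s by (auto simp: y_def U_def)
  have sD: "s \<notin> D" using DA AV s by blast
  have cD: "card D = k" unfolding D_def k_def
    by (intro card_image inj_on_subset[OF phi(2)]) auto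
  have yB: "sum y (insert s D) = lam + k"
  proof -
    have "sum y D = (\<Sum>x\<in>D. 1)" using sD by (intro sum.cong) (auto simp: y_def)
    then show ?thesis using fin sD cD by (simp add: y_def)
  qed
  have bij: "bij_betw (\<lambda>p. restrict p U) P (parent_maps U (insert s D))"
    unfolding P_def U_def D_def by (rule bij_betw_parent_maps_pattern[OF T le s phi])
  have weight: "lam ^ card {v \<in> V. p v = s} * card {w \<in> V. root_of V p w = r0} =
      lam * ((\<Prod>u\<in>U. y (restrict p U u)) *
        (a + card {w \<in> U. exit_point U (restrict p U) w \<in> D}))"
    if p: "p \<in> P" for p
  proof -
    have pm: "p \<in> parent_maps V {s}" and pr: "p r0 = s"
      and pphi: "\<And>v. v \<in> verts T \<Longrightarrow> v \<noteq> rt T \<Longrightarrow> p (\<phi> v) = \<phi> (\<pi> v)"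
      using p by (auto simp: P_def)
    have q: "restrict p U \<in> parent_maps U (insert s D)" using bij p by (auto simp: bij_betw_def)
    have dU: "descending U p" using parent_mapsD(1)[OF pm] by (rule descending_subset) (auto simp: U_def)
    have pA: "p x \<in> ?A" if "x \<in> ?A" "x \<noteq> r0" for x
      using that pphi phi(3) T.parent by auto
    have "x = r0" if "x \<in> ?A" "p x = s" for x
      by (rule ccontr) (use that pA[of x] AV s in blast)
    then have "{v \<in> V. p v = s} \<subseteq> insert r0 {u \<in> U. p u = s}" unfolding U_def by blast
    moreover have "insert r0 {u \<in> U. p u = s} \<subseteq> {v \<in> V. p v = s}"
      unfolding U_def using pr oA AV by blast
    ultimately have "{v \<in> V. p v = s} = insert r0 {u \<in> U. p u = s}" by (rule equalityI)
    moreover have "r0 \<notin> {u \<in> U. p u = s}" using oA by (auto simp: U_def)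
    ultimately have "card {v \<in> V. p v = s} = Suc (card {u \<in> U. p u = s})"
      using fin by simp
    moreover have "(\<Prod>u\<in>U. y (restrict p U u)) = lam ^ card {u \<in> U. p u = s}"
    proof -
      have "(\<Prod>u\<in>U. y (restrict p U u)) = (\<Prod>u\<in>U. if p u = s then lam else 1)"
        by (intro prod.cong) (auto simp: y_def)
      also have "\<dots> = lam ^ card {u \<in> U. p u = s}"
        using fin by (simp add: prod.If_cases Int_def)
      finally show ?thesis .
    qed
    moreover have "card {w \<in> V. root_of V p w = r0} =
        a + card {w \<in> U. exit_point U (restrict p U) w \<in> D}"
    proof -
      have rA: "root_of V p x = r0" if x: "x \<in> ?A" for x
      proof -
        obtain v where v: "v \<in> verts T" "x = \<phi> v" using x by blast
        have "root_of V p (\<phi> v) = r0" using v(1)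
        proof (induction v rule: T.vertex_induct)
          case root
          then show ?case using phi(3) root_of_root[OF s pm pr] by simp
        next
          case (step v)
          have "\<phi> v \<in> V" "\<phi> (\<pi> v) \<in> V" using AV step.hyps T.parent by blast+
          then show ?case
            using root_of_parent[OF s pm, of "\<phi> v"] pphi[OF step.hyps] step.IH by simp
        qed
        then show ?thesis using v(2) by simp
      qed
      have "root_of V p w = r0 \<longleftrightarrow> exit_point U p w \<in> D" if "w \<in> U" for w
        using dU that
      proof (induction w rule: descending_induct)
        case (step w)
        note e = exit_point_step[OF dU step.hyps]
        have w: "w \<in> V" using step.hyps by (simp add: U_def)
        have pw: "p w \<in> U \<or> p w \<in> D \<or> p w = s"
          using parent_mapsD(2)[OF q step.hyps] step.hyps by auto
        show ?case
        proof (cases "p w = s")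
          case True
          then have "exit_point U p w = s" using e exit_point_outside[of s U p] disj by auto
          moreover have "root_of V p w = w" using root_of_root[OF s pm True] .
          moreover have "w \<noteq> r0" using oA step.hyps by (auto simp: U_def)
          ultimately show ?thesis using sD by simp
        next
          case False
          then have pV: "p w \<in> V" using pw DA AV by (auto simp: U_def)
          note rw = root_of_parent[OF s pm w pV]
          show ?thesis
          proof (cases "p w \<in> U")
            case True
            then show ?thesis using step.IH e rw by simp
          next
            case out: False
            then have "p w \<in> D" using pw False by blast
            then show ?thesis using e rw rA DA exit_point_outside[OF out, of p] by auto
          qed
        qed
      qed
      moreover have "exit_point U (restrict p U) w = exit_point U p w" for w
        by (rule exit_point_cong[OF dU]) simp
      ultimately have "{w \<in> V. root_of V p w = r0} = ?A \<union> {w \<in> U. exit_point U (restrict p U) w \<in> D}"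
        using rA AV by (auto simp: U_def)
      moreover have "?A \<inter> {w \<in> U. exit_point U (restrict p U) w \<in> D} = {}" by (auto simp: U_def)
      ultimately show ?thesis using finA fin cA by (simp add: card_Un_disjoint)
    qed
    ultimately show ?thesis by simp
  qed
  let ?W = "\<lambda>q. \<Prod>u\<in>U. y (q u)" and ?Q = "parent_maps U (insert s D)"
  have "(\<Sum>p \<in> P. lam ^ card {v \<in> V. p v = s} * card {w \<in> V. root_of V p w = r0}) =
      (\<Sum>p \<in> P. lam * (?W (restrict p U) * (a + card {w \<in> U. exit_point U (restrict p U) w \<in> D})))"
    using weight by (intro sum.cong refl) blast
  also have "\<dots> = (\<Sum>q \<in> ?Q. lam * (?W q * (a + card {w \<in> U. exit_point U q w \<in> D})))"
    by (rule sum.reindex_bij_betw[OF bij])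
  also have "\<dots> = lam * (a * (\<Sum>q \<in> ?Q. ?W q) + (\<Sum>q \<in> ?Q. ?W q * card {w \<in> U. exit_point U q w \<in> D}))"
    by (simp add: sum_distrib_left distrib_left sum.distrib mult.commute mult.left_commute)
  also have "(\<Sum>q \<in> ?Q. ?W q) = (lam + k) * (lam + k + m) ^ (m - 1)"
    using sum_parent_maps[where y = y, OF fin disj Une] yU by (simp add: yB cU)
  also have "(\<Sum>q \<in> ?Q. ?W q * card {w \<in> U. exit_point U q w \<in> D}) =
      (\<Sum>w\<in>U. \<Sum>q | q \<in> ?Q \<and> exit_point U q w \<in> D. ?W q)"
    by (rule sum_weighted_card[OF finite_parent_maps[OF fin] fin(1)])
  also have "\<dots> = (\<Sum>w\<in>U. \<Sum>b\<in>D. \<Sum>q | q \<in> ?Q \<and> exit_point U q w = b. ?W q)"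
  proof (intro sum.cong refl)
    fix w
    let ?QD = "{q \<in> ?Q. exit_point U q w \<in> D}"
    have "(\<Sum>b\<in>D. \<Sum>q | q \<in> ?QD \<and> exit_point U q w = b. ?W q) = (\<Sum>q \<in> ?QD. ?W q)"
      using finite_parent_maps[OF fin] fin(2) by (intro sum.group) auto
    moreover have "{q \<in> ?QD. exit_point U q w = b} = {q \<in> ?Q. exit_point U q w = b}" if "b \<in> D" for b
      using that by auto
    ultimately show "(\<Sum>q \<in> ?QD. ?W q) = (\<Sum>b\<in>D. \<Sum>q | q \<in> ?Q \<and> exit_point U q w = b. ?W q)"
      by simp
  qed
  also have "\<dots> = (\<Sum>w\<in>U. \<Sum>b\<in>D. (lam + k + m) ^ (m - 1))"
  proof (intro sum.cong refl)
    fix w b assume w: "w \<in> U" and b: "b \<in> D"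
    then have "y b = 1" using sD by (auto simp: y_def)
    then show "(\<Sum>q | q \<in> ?Q \<and> exit_point U q w = b. ?W q) = (lam + k + m) ^ (m - 1)"
      using sum_parent_maps_exit[where y = y and b = b, OF fin disj w] b yU by (simp add: yB cU)
  qed
  also have "\<dots> = m * k * (lam + k + m) ^ (m - 1)"
    using cD by (simp add: cU)
  finally show ?thesis by (simp add: P_def algebra_simps)
qed


section \<open>The law of a ball in the massive spanning forest\<close>

lemma card_root_embeddings:
  assumes "finite (verts T)" "rt T \<in> verts T" "finite V" "r0 \<in> V"
  shows "card {\<phi> \<in> verts T \<rightarrow>\<^sub>E V. inj_on \<phi> (verts T) \<and> \<phi> (rt T) = r0} =
    (\<Prod>i<card (verts T) - 1. card V - 1 - i)"
  using card_inj_extensions[of "verts T - {rt T}" "{rt T}" V "\<lambda>_. r0"] assms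
  by (simp add: insert_absorb Diff_insert0)

lemma sum_forest_weight_isos:
  fixes V :: "'a set" and T :: "'b rgraph" and lam :: real
  assumes T: "parent_tree T \<pi> d" and le: "\<And>v. v \<in> verts T \<Longrightarrow> d v \<le> h"
    and V: "finite V" and s: "s \<notin> V" and o: "r0 \<in> V"
    and fin: "finite (verts T)" and less: "card (verts T) < card V"
  defines "k \<equiv> card {v \<in> verts T. d v = h}" and "a \<equiv> card (verts T)"
  defines "m \<equiv> card V - card (verts T)"
  shows "(\<Sum>f \<in> spanning_forests \<lparr>verts = V, edges = {e. e \<subseteq> V \<and> card e = 2}\<rparr>.
      forest_weight lam f * card (isos T (trunc h (rooted_component f r0)))) =
    (\<Prod>i<a - 1. card V - 1 - i) * (lam * (lam + k + m) ^ (m - 1) * (a * (lam + k) + m * k))"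
proof -
  define E where "E = {\<phi> \<in> verts T \<rightarrow>\<^sub>E V. inj_on \<phi> (verts T) \<and> \<phi> (rt T) = r0}"
  define C where "C \<phi> p \<longleftrightarrow> (\<forall>v \<in> verts T. v \<noteq> rt T \<longrightarrow> p (\<phi> v) = \<phi> (\<pi> v)) \<and>
    (\<forall>u \<in> V - \<phi> ` verts T. p u \<notin> \<phi> ` {v \<in> verts T. d v < h})" for \<phi> p
  define P where "P = {p. p \<in> parent_maps V {s} \<and> p r0 = s}"
  define w where "w p = lam ^ card {v \<in> V. p v = s} * card {w \<in> V. root_of V p w = r0}" for p
  have finE: "finite E"
    unfolding E_def using finite_PiE[OF fin, of "\<lambda>_. V"] V by auto
  have finP: "finite P" unfolding P_def using finite_parent_maps[OF V, of "{s}"] by simp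
  have "(\<Sum>f \<in> spanning_forests \<lparr>verts = V, edges = {e. e \<subseteq> V \<and> card e = 2}\<rparr>.
      forest_weight lam f * card (isos T (trunc h (rooted_component f r0)))) =
      (\<Sum>p \<in> P. w p * card (isos T (trunc h (rooted_component (forest_of V p) r0))))"
    unfolding P_def w_def by (rule sum_forest_weight[OF V s o])
  also have "\<dots> = (\<Sum>p \<in> P. w p * card {\<phi> \<in> E. C \<phi> p})"
  proof (intro sum.cong refl)
    fix p assume "p \<in> P"
    then have "isos T (trunc h (rooted_component (forest_of V p) r0)) = {\<phi> \<in> E. C \<phi> p}"
      using isos_trunc_component_iff[OF T le s _ o, of p] by (auto simp: P_def E_def C_def)
    then show "w p * card (isos T (trunc h (rooted_component (forest_of V p) r0))) =
        w p * card {\<phi> \<in> E. C \<phi> p}" by simp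
  qed
  also have "\<dots> = (\<Sum>\<phi> \<in> E. \<Sum>p | p \<in> P \<and> C \<phi> p. w p)"
    by (rule sum_weighted_card[OF finP finE])
  also have "\<dots> = (\<Sum>\<phi> \<in> E. lam * (lam + k + m) ^ (m - 1) * (a * (lam + k) + m * k))"
  proof (intro sum.cong refl)
    fix \<phi> assume "\<phi> \<in> E"
    then have phi: "\<phi> \<in> verts T \<rightarrow>\<^sub>E V" "inj_on \<phi> (verts T)" "\<phi> (rt T) = r0" by (auto simp: E_def)
    show "(\<Sum>p | p \<in> P \<and> C \<phi> p. w p) = lam * (lam + k + m) ^ (m - 1) * (a * (lam + k) + m * k)"
      unfolding k_def a_def m_def w_def P_def C_def
      using sum_parent_maps_pattern[OF T le V s phi less, of lam] by simp
  qed
  also have "\<dots> = card E * (lam * (lam + k + m) ^ (m - 1) * (a * (lam + k) + m * k))" by simp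
  also have "card E = (\<Prod>i<a - 1. card V - 1 - i)"
    unfolding E_def a_def by (rule card_root_embeddings[OF fin parent_tree.root[OF T] V o])
  finally show ?thesis by simp
qed

text \<open>
  A single vertex with \<open>h = 0\<close> is a pattern that imposes no condition.
\<close>

lemma sum_forest_weight_total:
  fixes V :: "'a set" and lam :: real
  assumes V: "finite V" and s: "s \<notin> V" and two: "2 \<le> card V"
  shows "(\<Sum>f \<in> spanning_forests \<lparr>verts = V, edges = {e. e \<subseteq> V \<and> card e = 2}\<rparr>. forest_weight lam f) =
    lam * (lam + card V) ^ (card V - 1)"
proof -
  obtain r0 where o: "r0 \<in> V" using two by fastforce
  define T :: "nat rgraph" where "T = \<lparr>verts = {0}, edges = {}, rt = 0\<rparr>"
  have T: "parent_tree T id (\<lambda>_. 0)" by unfold_locales (auto simp: T_def)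
  have phi: "restrict (\<lambda>_. r0) (verts T) \<in> verts T \<rightarrow>\<^sub>E V" "inj_on (restrict (\<lambda>_. r0) (verts T)) (verts T)"
    "restrict (\<lambda>_. r0) (verts T) (rt T) = r0" using o by (auto simp: T_def)
  have "(\<Sum>p | p \<in> parent_maps V {s} \<and> p r0 = s.
      lam ^ card {v \<in> V. p v = s} * card {w \<in> V. root_of V p w = r0}) =
      lam * (lam + 1 + (card V - 1)) ^ (card V - 1 - 1) * (1 * (lam + 1) + (card V - 1) * 1)"
    using sum_parent_maps_pattern[OF T _ V s phi, where h = 0 and lam = lam] two by (simp add: T_def)
  also have "\<dots> = lam * (lam + card V) ^ (card V - 1)"
  proof -
    obtain m where m: "card V = Suc (Suc m)" using two by (metis Suc_le_D numeral_2_eq_2 Suc_le_mono)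
    show ?thesis by (simp add: m algebra_simps)
  qed
  finally show ?thesis
    using sum_forest_weight[OF V s o, of lam "\<lambda>_. 1"] by simp
qed

text \<open>
  The events of local convergence, expressed by an isomorphism from the fixed tree.
\<close>

lemma utrunc_shape_eq_iff:
  fixes R :: "'a :: countable rgraph" and t :: "nat rgraph"
  assumes "simple_graph R" "rt R \<in> verts R" "simple_graph t" "rt t \<in> verts t"
  shows "utrunc h (shape R) = shape t \<longleftrightarrow> rooted_iso t (trunc h R)"
proof -
  have "utrunc h (shape R) = shape t \<longleftrightarrow> rooted_iso (trunc h R) t"
    unfolding utrunc_shape[OF assms(1,2)]
    by (rule shape_eq_iff[OF simple_graph_trunc[OF assms(1)] root_trunc[where h = h, OF assms(2)]])
  also have "\<dots> \<longleftrightarrow> rooted_iso t (trunc h R)"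
    using rooted_iso_sym[OF simple_graph_trunc[OF assms(1)] _ root_trunc[where h = h, OF assms(2)]]
      rooted_iso_sym[OF assms(3) _ assms(4)] by blast
  finally show ?thesis .
qed

lemma card_isos_trunc:
  fixes R :: "'a :: countable rgraph" and t :: "nat rgraph"
  assumes "simple_graph R" "rt R \<in> verts R" "simple_graph t" "rt t \<in> verts t" "finite (verts t)"
  shows "card (isos t (trunc h R)) = (if utrunc h (shape R) = shape t then card (isos t t) else 0)"
  unfolding utrunc_shape_eq_iff[OF assms(1-4)] by (rule card_isos[OF assms(3-5)])

text \<open>
  The exact probability of a ball: the number of embeddings of \<open>t\<close> rooted at \<open>0\<close>, times the weight of the
  forests that extend one embedding, divided by the total weight \<open>lam (lam + n)^(n-1)\<close>.
\<close>

lemma prob_massive_SF_ball: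
  fixes t :: "nat rgraph"
  assumes t: "parent_tree t \<pi> d" and le: "\<And>v. v \<in> verts t \<Longrightarrow> d v \<le> h"
    and fin: "finite (verts t)" and less: "card (verts t) < n" and lam: "lam > 0"
  defines "k \<equiv> card {v \<in> verts t. d v = h}" and "a \<equiv> card (verts t)"
  shows "card (isos t t) * \<P>(f in measure_pmf (massive_SF lam (complete_graph n)).
      utrunc h (shape (rooted_component f 0)) = shape t) =
    real (\<Prod>i<a - 1. n - 1 - i) * (lam + k + real (n - a)) ^ (n - a - 1) * (a * (lam + k) + real (n - a) * k) /
      (lam + n) ^ (n - 1)"
proof -
  interpret t: parent_tree t \<pi> d by fact
  let ?G = "complete_graph n" and ?F = "spanning_forests (complete_graph n)"
  have G: "?G = \<lparr>verts = {..<n}, edges = {e. e \<subseteq> {..<n} \<and> card e = 2}\<rparr>"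
    by (simp add: complete_graph_def)
  have finG: "finite (verts ?G)" and simG: "simple_graph ?G"
    by (auto simp: complete_graph_def simple_graph_def)
  have finF: "finite ?F" using finite_spanning_forests[OF finG simG] .
  have "a > 0" using fin t.root by (auto simp: a_def card_gt_0_iff)
  then have n: "2 \<le> n" using less by (simp add: a_def)
  have Z: "(\<Sum>f \<in> ?F. forest_weight lam f) = lam * (lam + n) ^ (n - 1)"
    unfolding G using sum_forest_weight_total[of "{..<n}" n lam] n by simp
  let ?A = "{f. utrunc h (shape (rooted_component f 0)) = shape t}"
  have "\<P>(f in measure_pmf (massive_SF lam ?G). utrunc h (shape (rooted_component f 0)) = shape t) =
      measure_pmf.prob (massive_SF lam ?G) (?A \<inter> ?F)"
  proof -
    have "set_pmf (massive_SF lam ?G) \<subseteq> ?F"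
      using pmf_massive_SF[OF finG simG lam] by (auto simp: set_pmf_eq split: if_splits)
    then have "measure_pmf.prob (massive_SF lam ?G) ?A = measure_pmf.prob (massive_SF lam ?G) (?A \<inter> ?F)"
      by (intro measure_pmf.finite_measure_eq_AE) (auto simp: AE_measure_pmf_iff)
    then show ?thesis by simp
  qed
  also have "\<dots> = (\<Sum>f \<in> ?A \<inter> ?F. pmf (massive_SF lam ?G) f)"
    using finF by (intro measure_measure_pmf_finite) auto
  also have "\<dots> = (\<Sum>f \<in> ?F. if f \<in> ?A then forest_weight lam f / (lam * (lam + n) ^ (n - 1)) else 0)"
    using finF pmf_massive_SF[OF finG simG lam] Z
    by (subst sum.inter_restrict[symmetric]) (auto intro!: sum.cong simp: Int_commute)
  finally have "card (isos t t) * \<P>(f in measure_pmf (massive_SF lam ?G).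
      utrunc h (shape (rooted_component f 0)) = shape t) =
      (\<Sum>f \<in> ?F. card (isos t t) * (if f \<in> ?A then forest_weight lam f / (lam * (lam + n) ^ (n - 1)) else 0))"
    by (simp add: sum_distrib_left)
  also have "\<dots> = (\<Sum>f \<in> ?F. forest_weight lam f * card (isos t (trunc h (rooted_component f 0)))) /
      (lam * (lam + n) ^ (n - 1))"
    unfolding sum_divide_distrib
  proof (intro sum.cong refl)
    fix f assume f: "f \<in> ?F"
    have "simple_graph f" "0 \<in> verts f"
      using f simG n by (auto simp: spanning_forests_def simple_graph_def complete_graph_def)
    then have "simple_graph (rooted_component f 0)" "rt (rooted_component f 0) \<in> verts (rooted_component f 0)"
      by (auto simp: rooted_component_def simple_graph_def graph_component_def Let_def)
    then have "card (isos t (trunc h (rooted_component f 0))) = (if f \<in> ?A then card (isos t t) else 0)"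
      using card_isos_trunc[of "rooted_component f 0" t h, OF _ _ t.simple_graph t.root fin] by simp
    then show "card (isos t t) * (if f \<in> ?A then forest_weight lam f / (lam * (lam + n) ^ (n - 1)) else 0) =
        forest_weight lam f * card (isos t (trunc h (rooted_component f 0))) / (lam * (lam + n) ^ (n - 1))"
      by simp
  qed
  also have "(\<Sum>f \<in> ?F. forest_weight lam f * card (isos t (trunc h (rooted_component f 0)))) =
      real (\<Prod>i<a - 1. n - 1 - i) * (lam * (lam + k + real (n - a)) ^ (n - a - 1) * (a * (lam + k) + real (n - a) * k))"
    unfolding G k_def a_def
    using sum_forest_weight_isos[OF t le, of "{..<n}" n 0 lam] fin less n by simp
  finally show ?thesis using lam by simp
qed


section \<open>Asymptotics of the ball probabilities\<close>

lemma tendsto_exp_power: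
  fixes z :: "nat \<Rightarrow> real" and m :: "nat \<Rightarrow> nat"
  assumes z: "z \<longlonglongrightarrow> 0" and mz: "(\<lambda>n. m n * z n) \<longlonglongrightarrow> c"
  shows "(\<lambda>n. (1 + z n) ^ m n) \<longlonglongrightarrow> exp c"
proof -
  \<comment> \<open>The continuous extension at \<open>0\<close>, because \<open>z n\<close> may vanish.\<close>
  define g where "g x = (if x = 0 then 1 else ln (1 + x) / x)" for x :: real
  have "((\<lambda>x :: real. ln (1 + x) / x) \<longlongrightarrow> 1) (at 0)" by real_asymp
  then have "(g \<longlongrightarrow> 1) (at 0)"
    by (rule Lim_transform_eventually) (auto simp: g_def eventually_at intro!: exI[of _ 1])
  then have "isCont g 0" by (simp add: isCont_def g_def)
  then have "(\<lambda>n. g (z n)) \<longlonglongrightarrow> g 0" using z by (rule isCont_tendsto_compose)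
  then have "(\<lambda>n. g (z n)) \<longlonglongrightarrow> 1" by (simp add: g_def)
  then have "(\<lambda>n. (m n * z n) * g (z n)) \<longlonglongrightarrow> c * 1" using mz by (intro tendsto_mult)
  then have lim: "(\<lambda>n. exp ((m n * z n) * g (z n))) \<longlonglongrightarrow> exp c" by (simp add: tendsto_exp)
  have "eventually (\<lambda>n. \<bar>z n\<bar> < 1) sequentially"
    using z[unfolded tendsto_iff, rule_format, of 1] by simp
  then have "eventually (\<lambda>n. exp ((m n * z n) * g (z n)) = (1 + z n) ^ m n) sequentially"
  proof eventually_elim
    case (elim n)
    then have "1 + z n > 0" by linarith
    moreover have "(m n * z n) * g (z n) = m n * ln (1 + z n)" by (simp add: g_def)
    ultimately show ?case by (simp only: exp_of_nat_mult exp_ln)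
  qed
  with lim show ?thesis by (rule Lim_transform_eventually)
qed

text \<open>
  With \<open>S = lam n + n\<close> and \<open>x = n / S\<close>, the expression is the product of \<open>\<Prod>i<a-1. (n-1-i)/n\<close>, of
  \<open>(1 - (a-k)/S)^(n-a-1)\<close>, of \<open>a (1-x) + k x\<close> and of \<open>x^(a-1)\<close>, and each factor converges.
\<close>

lemma limit_ball_formula:
  fixes lam :: "nat \<Rightarrow> real" and a k :: nat and \<beta> :: real
  assumes lam: "\<And>n. n \<ge> 1 \<Longrightarrow> lam n > 0" and a: "a > 0" and ka: "k \<le> a"
    and \<beta>: "(\<lambda>n. n / (lam n + n)) \<longlonglongrightarrow> \<beta>"
  shows "(\<lambda>n. real (\<Prod>i<a - 1. n - 1 - i) * (lam n + k + real (n - a)) ^ (n - a - 1) *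
      (a * (lam n + k) + real (n - a) * k) / (lam n + n) ^ (n - 1)) \<longlonglongrightarrow>
    exp (- (real a - k) * \<beta>) * (a * (1 - \<beta>) + k * \<beta>) * \<beta> ^ (a - 1)"
proof -
  define x where "x n = n / (lam n + n)" for n :: nat
  define c where "c = real a - k"
  have x: "x \<longlonglongrightarrow> \<beta>" using \<beta> by (simp add: x_def[abs_def])
  have S: "lam n + n > 0" if "n \<ge> 1" for n :: nat using lam[OF that] by simp
  have "(\<lambda>n. \<Prod>i<a - 1. real (n - 1 - i) / n) \<longlonglongrightarrow> (\<Prod>i<a - 1. 1)"
  proof (rule tendsto_prod)
    fix i
    have "(\<lambda>n. (real n - 1 - real i) / n) \<longlonglongrightarrow> 1" by real_asymp
    moreover have "eventually (\<lambda>n. (real n - 1 - real i) / n = real (n - 1 - i) / n) sequentially"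
      using eventually_ge_at_top[of "i + 1"] by eventually_elim (simp add: of_nat_diff)
    ultimately show "(\<lambda>n. real (n - 1 - i) / n) \<longlonglongrightarrow> 1" by (rule Lim_transform_eventually)
  qed
  then have lim1: "(\<lambda>n. \<Prod>i<a - 1. real (n - 1 - i) / n) \<longlonglongrightarrow> 1" by simp
  have lim2: "(\<lambda>n. (1 + (- c / (lam n + n))) ^ (n - a - 1)) \<longlonglongrightarrow> exp (- c * \<beta>)"
  proof (rule tendsto_exp_power)
    have inv: "(\<lambda>n. - c * (1 / real n * x n)) \<longlonglongrightarrow> - c * (0 * \<beta>)"
      by (intro tendsto_mult tendsto_const x lim_1_over_n)
    have "eventually (\<lambda>n. - c * (1 / real n * x n) = - c / (lam n + n)) sequentially"
      using eventually_ge_at_top[of 1] by eventually_elim (simp add: x_def)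
    with inv show "(\<lambda>n. - c / (lam n + n)) \<longlonglongrightarrow> 0"
      by (simp add: Lim_transform_eventually)
    have "(\<lambda>n. (real n - real a - 1) / n) \<longlonglongrightarrow> 1" by real_asymp
    then have "(\<lambda>n. - c * ((real n - real a - 1) / n * x n)) \<longlonglongrightarrow> - c * (1 * \<beta>)"
      by (intro tendsto_mult tendsto_const x)
    moreover have "eventually (\<lambda>n. - c * ((real n - real a - 1) / n * x n) =
        real (n - a - 1) * (- c / (lam n + n))) sequentially"
      using eventually_ge_at_top[of "a + 1"] by eventually_elim (simp add: x_def of_nat_diff)
    ultimately show "(\<lambda>n. real (n - a - 1) * (- c / (lam n + n))) \<longlonglongrightarrow> - c * \<beta>"
      by (simp add: Lim_transform_eventually)
  qed
  have lim3: "(\<lambda>n. a * (1 - x n) + k * x n) \<longlonglongrightarrow> a * (1 - \<beta>) + k * \<beta>"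
    by (intro tendsto_intros x)
  have "(\<lambda>n. (\<Prod>i<a - 1. real (n - 1 - i) / n) * (1 + (- c / (lam n + n))) ^ (n - a - 1) *
      (a * (1 - x n) + k * x n) * x n ^ (a - 1)) \<longlonglongrightarrow>
      1 * exp (- c * \<beta>) * (a * (1 - \<beta>) + k * \<beta>) * \<beta> ^ (a - 1)"
    by (intro tendsto_mult lim1 lim2 lim3 tendsto_power x)
  moreover have "eventually (\<lambda>n. (\<Prod>i<a - 1. real (n - 1 - i) / n) * (1 + (- c / (lam n + n))) ^ (n - a - 1) *
      (a * (1 - x n) + k * x n) * x n ^ (a - 1) =
      real (\<Prod>i<a - 1. n - 1 - i) * (lam n + k + real (n - a)) ^ (n - a - 1) *
      (a * (lam n + k) + real (n - a) * k) / (lam n + n) ^ (n - 1)) sequentially"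
    using eventually_gt_at_top[of a]
  proof eventually_elim
    case (elim n)
    define S where "S = lam n + n"
    have n: "n \<ge> 1" using elim by simp
    have S0: "S > 0" "lam n = S - n" using S[OF n] by (auto simp: S_def)
    have "(\<Prod>i<a - 1. real (n - 1 - i) / n) = real (\<Prod>i<a - 1. n - 1 - i) / n ^ (a - 1)"
      by (simp add: prod_dividef)
    moreover have "1 + (- c / (lam n + n)) = (lam n + k + real (n - a)) / S"
      using S0(1) elim by (simp add: c_def S_def field_simps of_nat_diff)
    moreover have "a * (1 - x n) + k * x n = (a * (lam n + k) + real (n - a) * k) / S"
    proof -
      have "a * (lam n + k) + real (n - a) * k = a * lam n + k * real n"
        using elim by (simp add: of_nat_diff algebra_simps)
      moreover have "1 - x n = lam n / S" using S0(1) by (simp add: x_def S_def field_simps)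
      ultimately show ?thesis by (simp add: x_def S_def add_divide_distrib)
    qed
    moreover have "x n = n / S" by (simp add: x_def S_def)
    moreover have "S ^ (n - 1) = S ^ (n - a - 1) * S * S ^ (a - 1)"
    proof -
      have "n - 1 = (n - a - 1) + 1 + (a - 1)" using elim a by simp
      then show ?thesis by (metis power_add power_one_right)
    qed
    ultimately show ?case using S0(1) n by (simp add: power_divide S_def[symmetric])
  qed
  ultimately show ?thesis unfolding c_def by (simp add: Lim_transform_eventually)
qed


section \<open>The spine tree described by parents\<close>

lemma card_bijections:
  assumes "finite A" "finite B" "card A = card B"
  shows "card {g \<in> A \<rightarrow>\<^sub>E B. bij_betw g A B} = fact (card A)"
proof -
  have "bij_betw g A B" if "g \<in> A \<rightarrow>\<^sub>E B" "inj_on g A" for g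
    using that assms card_subset_eq[of B "g ` A"] card_image[OF that(2)] by (auto simp: bij_betw_def)
  then have "{g \<in> A \<rightarrow>\<^sub>E B. bij_betw g A B} = {g \<in> A \<rightarrow>\<^sub>E B. inj_on g A}"
    by (auto simp: bij_betw_def)
  moreover have "card {g \<in> A \<rightarrow>\<^sub>E B. inj_on g A} = (\<Prod>i<card A. card B - i)"
    using card_inj_extensions[of A "{}" B "\<lambda>_. undefined"] assms(1,2) by simp
  moreover have "(fact (card A) :: nat) = (\<Prod>i<card A. card A - i)"
    by (simp add: fact_prod_rev atLeast0LessThan)
  ultimately show ?thesis using assms(3) by simp
qed

lemma snoc_mem_BGW_tree_iff:
  "u @ [j] \<in> verts (BGW_tree N) \<longleftrightarrow> u \<in> verts (BGW_tree N) \<and> j < N u"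
  unfolding BGW_tree_verts_iff by (auto simp: nth_append less_Suc_eq)

definition graft_parent :: "nat \<times> nat list \<Rightarrow> nat \<times> nat list" where
  "graft_parent = (\<lambda>(i, u). if u = [] then (i - 1, []) else (i, butlast u))"

definition graft_depth :: "nat \<times> nat list \<Rightarrow> nat" where
  "graft_depth = (\<lambda>(i, u). i + length u)"

abbreviation grafted_BGW :: "enat \<Rightarrow> (nat \<Rightarrow> nat list \<Rightarrow> nat) \<Rightarrow> (nat \<times> nat list) rgraph" where
  "grafted_BGW L \<omega> \<equiv> graft_on_spine L (\<lambda>i. BGW_tree (\<omega> i))"

lemma mem_grafted_BGW_iff: "(i, u) \<in> verts (grafted_BGW L \<omega>) \<longleftrightarrow> enat i < L \<and> u \<in> verts (BGW_tree (\<omega> i))"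
  by (simp add: graft_on_spine_def)

lemma Nil_mem_BGW_tree: "[] \<in> verts (BGW_tree N)"
  by (simp add: BGW_tree_verts_iff)

lemma parent_tree_grafted_BGW:
  assumes "L > 0"
  shows "parent_tree (grafted_BGW L \<omega>) graft_parent graft_depth"
proof
  let ?R = "grafted_BGW L \<omega>"
  show "rt ?R \<in> verts ?R" using assms root_graft_BGW by simp
  show "graft_depth (rt ?R) = 0" by (simp add: root_graft_BGW graft_depth_def)
  have less: "enat i < L" if "enat (Suc i) < L" for i
    using that by (meson Suc_n_not_le_n enat_ord_simps(1) less_trans linorder_not_le)
  have par: "graft_parent v \<in> verts ?R \<and> graft_depth v = Suc (graft_depth (graft_parent v)) \<and>
      {v, graft_parent v} \<in> edges ?R"
    if v: "v \<in> verts ?R" "v \<noteq> (0, [])" for v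
  proof -
    obtain i u where iu: "v = (i, u)" by (cases v)
    show ?thesis
    proof (cases u rule: rev_cases)
      case Nil
      then obtain m where m: "i = Suc m" using v(2) iu by (cases i) auto
      then have L: "enat (Suc m) < L" using v(1) iu by (simp add: mem_grafted_BGW_iff)
      then have "{(m, []), (Suc m, [])} \<in> edges ?R" unfolding graft_BGW_edges_iff by blast
      then show ?thesis
        using L less by (simp add: iu Nil m graft_parent_def graft_depth_def mem_grafted_BGW_iff
            Nil_mem_BGW_tree insert_commute)
    next
      case (snoc u' j)
      then have "enat i < L" "u' @ [j] \<in> verts (BGW_tree (\<omega> i))" using v(1) iu by (auto simp: mem_grafted_BGW_iff)
      moreover from this have "Pair i ` {u', u' @ [j]} \<in> edges ?R" unfolding graft_BGW_edges_iff by blast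
      ultimately show ?thesis
        by (simp add: iu snoc graft_parent_def graft_depth_def mem_grafted_BGW_iff
            snoc_mem_BGW_tree_iff insert_commute)
    qed
  qed
  then show "graft_parent v \<in> verts ?R" "graft_depth v = Suc (graft_depth (graft_parent v))"
    if "v \<in> verts ?R" "v \<noteq> rt ?R" for v
    using that by (auto simp: root_graft_BGW)
  show "edges ?R = (\<lambda>v. {v, graft_parent v}) ` (verts ?R - {rt ?R})"
  proof (intro equalityI subsetI)
    fix e assume "e \<in> edges ?R"
    then consider i u j where "e = Pair i ` {u, u @ [j]}" "enat i < L" "u @ [j] \<in> verts (BGW_tree (\<omega> i))"
      | i where "e = {(i, []), (Suc i, [])}" "enat (Suc i) < L"
      unfolding graft_BGW_edges_iff by blast
    then show "e \<in> (\<lambda>v. {v, graft_parent v}) ` (verts ?R - {rt ?R})"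
    proof cases
      case 1
      then show ?thesis
        by (intro image_eqI[of _ _ "(i, u @ [j])"])
          (auto simp: graft_parent_def mem_grafted_BGW_iff root_graft_BGW)
    next
      case 2
      then show ?thesis
        by (intro image_eqI[of _ _ "(Suc i, [])"])
          (auto simp: graft_parent_def mem_grafted_BGW_iff root_graft_BGW Nil_mem_BGW_tree)
    qed
  next
    fix e assume "e \<in> (\<lambda>v. {v, graft_parent v}) ` (verts ?R - {rt ?R})"
    then show "e \<in> edges ?R" using par by (auto simp: root_graft_BGW)
  qed
qed

definition sons :: "nat \<Rightarrow> nat \<times> nat list \<Rightarrow> (nat \<times> nat list) set" where
  "sons c x = (\<lambda>j. (fst x, snd x @ [j])) ` {..<c}"

lemma card_sons: "card (sons c x) = c" and finite_sons: "finite (sons c x)"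
  by (auto simp: sons_def card_image inj_on_def)

lemma sons_nonempty_word: "y \<in> sons c x \<Longrightarrow> snd y \<noteq> []"
  by (auto simp: sons_def)

lemma parent_sons: "y \<in> sons c x \<Longrightarrow> graft_parent y = x"
  by (auto simp: sons_def graft_parent_def)

lemma depth_sons: "y \<in> sons c x \<Longrightarrow> graft_depth y = Suc (graft_depth x)"
  by (auto simp: sons_def graft_depth_def split: prod.splits)

text \<open>
  A vertex \<open>(i, u)\<close> has its sons in the branching tree grafted at \<open>i\<close>; a spine vertex \<open>(i, [])\<close> has in addition the
  next spine vertex, if there is one.
\<close>

lemma kids_grafted_BGW:
  assumes "L > 0" "x \<in> verts (grafted_BGW L \<omega>)"
  shows "parent_tree.kids (grafted_BGW L \<omega>) graft_parent x =
    sons (\<omega> (fst x) (snd x)) x \<union>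
    (if snd x = [] \<and> enat (Suc (fst x)) < L then {(Suc (fst x), [])} else {})"
proof -
  interpret R: parent_tree "grafted_BGW L \<omega>" graft_parent graft_depth
    by (rule parent_tree_grafted_BGW[OF assms(1)])
  obtain i u where x: "x = (i, u)" by (cases x)
  have L: "enat i < L" "u \<in> verts (BGW_tree (\<omega> i))" using assms(2) x by (auto simp: mem_grafted_BGW_iff)
  have kid: "y \<in> R.kids x \<longleftrightarrow> y \<in> verts (grafted_BGW L \<omega>) \<and> y \<noteq> (0, []) \<and> graft_parent y = x" for y
    by (simp add: R.mem_kids_iff root_graft_BGW)
  have "(i', u') \<in> R.kids x \<longleftrightarrow> (i', u') \<in> sons (\<omega> i u) x \<union>
      (if u = [] \<and> enat (Suc i) < L then {(Suc i, [])} else {})" for i' u'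
  proof (cases u' rule: rev_cases)
    case Nil
    then show ?thesis unfolding kid
      by (cases i') (auto simp: x sons_def mem_grafted_BGW_iff graft_parent_def Nil_mem_BGW_tree)
  next
    case (snoc v j)
    then show ?thesis using L unfolding kid
      by (auto simp: x sons_def mem_grafted_BGW_iff graft_parent_def snoc_mem_BGW_tree_iff)
  qed
  then show ?thesis by (auto simp: x)
qed


section \<open>Codings of a finite tree by spine positions and words\<close>

context parent_tree
begin

text \<open>
  The path from the root to \<open>e\<close>, which will be sent to the spine when \<open>e\<close> is sent to the last spine vertex in
  the ball.
\<close>

definition spine :: "'a \<Rightarrow> 'a set" where
  "spine e = (\<lambda>i. (\<pi> ^^ i) e) ` {..d e}"

definition side :: "'a \<Rightarrow> 'a \<Rightarrow> 'a set" where
  "side e v = kids v - spine e"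

lemma iterate_parent:
  assumes "e \<in> verts T" "i \<le> d e"
  shows "(\<pi> ^^ i) e \<in> verts T" "d ((\<pi> ^^ i) e) = d e - i"
proof -
  have "(\<pi> ^^ i) e \<in> verts T \<and> d ((\<pi> ^^ i) e) = d e - i"
    using assms(2)
  proof (induction i)
    case (Suc i)
    then have "(\<pi> ^^ i) e \<in> verts T" "d ((\<pi> ^^ i) e) = d e - i" by auto
    moreover from this have "(\<pi> ^^ i) e \<noteq> rt T" using Suc.prems depth_root by auto
    ultimately show ?case using parent depth[of "(\<pi> ^^ i) e"] by simp
  qed (use assms(1) in simp)
  then show "(\<pi> ^^ i) e \<in> verts T" "d ((\<pi> ^^ i) e) = d e - i" by auto
qed

context
  fixes e assumes e: "e \<in> verts T"
begin

lemma spine_subset: "spine e \<subseteq> verts T"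
  using iterate_parent(1)[OF e] by (auto simp: spine_def)

lemma spine_depth_le: "v \<in> spine e \<Longrightarrow> d v \<le> d e"
  using iterate_parent(2)[OF e] by (auto simp: spine_def)

lemma mem_spine_self: "e \<in> spine e"
  unfolding spine_def by (rule image_eqI[of _ _ 0]) auto

lemma mem_spine_iff:
  assumes "v \<in> verts T"
  shows "v \<in> spine e \<longleftrightarrow> d v \<le> d e \<and> v = (\<pi> ^^ (d e - d v)) e"
proof
  assume "v \<in> spine e"
  then obtain i where "i \<le> d e" "v = (\<pi> ^^ i) e" by (auto simp: spine_def)
  then show "d v \<le> d e \<and> v = (\<pi> ^^ (d e - d v)) e" using iterate_parent(2)[OF e] by simp
next
  assume "d v \<le> d e \<and> v = (\<pi> ^^ (d e - d v)) e"
  then show "v \<in> spine e" unfolding spine_def by (metis atMost_iff diff_le_self imageI)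
qed

lemma spine_eqI:
  assumes "v \<in> spine e" "w \<in> spine e" "d v = d w"
  shows "v = w"
proof -
  have "v = (\<pi> ^^ (d e - d v)) e" "w = (\<pi> ^^ (d e - d w)) e"
    using assms mem_spine_iff spine_subset by blast+
  then show ?thesis using assms(3) by simp
qed

lemma ex_spine_depth: "m \<le> d e \<Longrightarrow> \<exists>v \<in> spine e. d v = m"
  using iterate_parent(2)[OF e, of "d e - m"] unfolding spine_def by auto

lemma root_mem_spine: "rt T \<in> spine e"
  using ex_spine_depth[of 0] depth_eq_0_iff spine_subset by auto

lemma spine_parent:
  assumes "v \<in> spine e" "v \<noteq> rt T"
  shows "\<pi> v \<in> spine e"
proof -
  have v: "v \<in> verts T" using assms(1) spine_subset by blast
  obtain i where i: "i \<le> d e" "v = (\<pi> ^^ i) e" using assms(1) by (auto simp: spine_def)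
  have "d v = d e - i" using iterate_parent(2)[OF e i(1)] i(2) by simp
  then have "Suc i \<le> d e" using depth[OF v assms(2)] i(1) by simp
  then show ?thesis unfolding spine_def using i(2) by (intro image_eqI[of _ _ "Suc i"]) auto
qed

lemma card_spine: "card (spine e) = Suc (d e)"
proof -
  have "inj_on (\<lambda>i. (\<pi> ^^ i) e) {..d e}"
  proof
    fix i j assume "i \<in> {..d e}" "j \<in> {..d e}" "(\<pi> ^^ i) e = (\<pi> ^^ j) e"
    then show "i = j" using iterate_parent(2)[OF e, of i] iterate_parent(2)[OF e, of j] by auto
  qed
  then show ?thesis by (simp add: spine_def card_image)
qed

lemma finite_spine: "finite (spine e)"
  by (simp add: spine_def)

lemma kids_inter_spine:
  assumes "v \<in> spine e" "w \<in> spine e" "d w = Suc (d v)"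
  shows "kids v \<inter> spine e = {w}" "w \<in> kids v"
proof -
  have w: "w \<in> verts T" "w \<noteq> rt T" using assms spine_subset depth_root by auto
  then have "d (\<pi> w) = d v" using depth assms(3) by simp
  then have "\<pi> w = v" using spine_eqI spine_parent assms(1,2) w(2) by blast
  then show k: "w \<in> kids v" using w by (simp add: kids_def)
  show "kids v \<inter> spine e = {w}"
    using k assms spine_eqI depth_kids by auto
qed

lemma kids_inter_spine_empty:
  assumes "v \<notin> spine e \<or> v = e"
  shows "kids v \<inter> spine e = {}"
proof -
  have False if w: "w \<in> kids v" "w \<in> spine e" for w
  proof -
    have "v \<in> spine e" using w spine_parent[of w] by (auto simp: kids_def)
    then have "v = e" using assms by blast
    then show False using depth_kids[OF w(1)] spine_depth_le[OF w(2)] by simp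
  qed
  then show ?thesis by blast
qed

lemma mem_side_parent: "v \<in> verts T \<Longrightarrow> v \<notin> spine e \<Longrightarrow> v \<in> side e (\<pi> v)"
  using root_mem_spine by (auto simp: side_def kids_def)

lemma mem_sideD: "w \<in> side e v \<Longrightarrow> w \<in> verts T \<and> w \<notin> spine e \<and> w \<noteq> rt T \<and> \<pi> w = v"
  by (auto simp: side_def kids_def)

text \<open>
  The maps that put the path to \<open>e\<close> on the spine and number the other children of each vertex. Whether such a
  map is an isomorphism depends only on the offspring numbers along its image.
\<close>

definition spine_codings :: "('a \<Rightarrow> nat \<times> nat list) set" where
  "spine_codings = {\<phi> \<in> extensional (verts T). (\<forall>v \<in> spine e. \<phi> v = (d v, [])) \<and>
     (\<forall>v \<in> verts T. bij_betw \<phi> (side e v) (sons (card (side e v)) (\<phi> v)))}"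

lemma codings_sons:
  assumes "\<phi> \<in> spine_codings" "v \<in> verts T" "v \<notin> spine e"
  shows "\<phi> v \<in> sons (card (side e (\<pi> v))) (\<phi> (\<pi> v))"
proof -
  have "\<pi> v \<in> verts T" using parent assms root_mem_spine by metis
  then have "bij_betw \<phi> (side e (\<pi> v)) (sons (card (side e (\<pi> v))) (\<phi> (\<pi> v)))"
    using assms(1) by (simp add: spine_codings_def)
  then show ?thesis using mem_side_parent[OF assms(2,3)] by (auto simp: bij_betw_def)
qed

lemma codings_snd_Nil_iff:
  assumes "\<phi> \<in> spine_codings" "v \<in> verts T"
  shows "snd (\<phi> v) = [] \<longleftrightarrow> v \<in> spine e"
proof (cases "v \<in> spine e")
  case True
  then show ?thesis using assms(1) by (simp add: spine_codings_def)
next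
  case False
  then show ?thesis using codings_sons[OF assms] sons_nonempty_word by metis
qed

lemma codings_depth:
  assumes "\<phi> \<in> spine_codings" "v \<in> verts T"
  shows "graft_depth (\<phi> v) = d v"
  using assms(2)
proof (induction v rule: vertex_induct)
  case root
  then show ?case using assms(1) root_mem_spine depth_root by (simp add: spine_codings_def graft_depth_def)
next
  case (step v)
  show ?case
  proof (cases "v \<in> spine e")
    case True
    then show ?thesis using assms(1) by (simp add: spine_codings_def graft_depth_def)
  next
    case False
    then show ?thesis
      using depth_sons[OF codings_sons[OF assms(1) step.hyps(1)]] step.IH depth[OF step.hyps] by simp
  qed
qed

lemma inj_on_codings:
  assumes "\<phi> \<in> spine_codings"
  shows "inj_on \<phi> (verts T)"
proof -
  have rT: "rt T \<in> verts T" by (rule root)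
  have "v = w" if "v \<in> verts T" "w \<in> verts T" "\<phi> v = \<phi> w" for v w
    using that
  proof (induction v arbitrary: w rule: vertex_induct)
    case root
    then have "d w = 0" using codings_depth[OF assms, of w] codings_depth[OF assms rT] depth_root
      by simp
    then show ?case using root depth_eq_0_iff by simp
  next
    case (step v)
    have iff: "v \<in> spine e \<longleftrightarrow> w \<in> spine e"
      using codings_snd_Nil_iff[OF assms] step.hyps(1) step.prems by metis
    show ?case
    proof (cases "v \<in> spine e")
      case True
      moreover have "d v = d w" using codings_depth[OF assms] step by metis
      ultimately show ?thesis using iff spine_eqI by blast
    next
      case False
      then have out: "v \<notin> spine e" "w \<notin> spine e" using iff by auto
      have w: "w \<noteq> rt T" using out root_mem_spine by blast
      have "\<phi> (\<pi> v) = \<phi> (\<pi> w)"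
        using parent_sons[OF codings_sons[OF assms step.hyps(1) out(1)]]
          parent_sons[OF codings_sons[OF assms step.prems(1) out(2)]] step.prems(2) by simp
      then have eq: "\<pi> v = \<pi> w" using step.IH[OF parent[OF step.prems(1) w]] by simp
      have "inj_on \<phi> (side e (\<pi> v))"
        using assms parent[OF step.hyps] by (auto simp: spine_codings_def bij_betw_def)
      then show ?thesis
        using mem_side_parent[OF step.hyps(1) out(1)] mem_side_parent[OF step.prems(1) out(2)] eq step.prems(2)
        by (auto dest: inj_onD)
    qed
  qed
  then show ?thesis by (auto simp: inj_on_def)
qed

lemma disjoint_side: "v \<noteq> w \<Longrightarrow> side e v \<inter> side e w = {}"
  by (auto dest!: mem_sideD)

lemma UN_side: "(\<Union>v \<in> verts T. side e v) = verts T - spine e"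
  using mem_side_parent mem_sideD parent root_mem_spine by (fastforce dest: mem_sideD)

text \<open>
  Vertices are treated in order of increasing depth. When the turn of \<open>x\<close> comes, its own position is known,
  and its children off the spine can be placed in \<open>c!\<close> ways, where \<open>c\<close> is their number.
\<close>

lemma card_partial_codings:
  assumes fin: "finite (verts T)"
    and S: "finite S" "S \<subseteq> verts T" "\<And>v. v \<in> S \<Longrightarrow> v \<noteq> rt T \<Longrightarrow> \<pi> v \<in> S"
  shows "card {\<phi> \<in> extensional (spine e \<union> (\<Union>v \<in> S. side e v)). (\<forall>v \<in> spine e. \<phi> v = (d v, [])) \<and>
     (\<forall>v \<in> S. bij_betw \<phi> (side e v) (sons (card (side e v)) (\<phi> v)))} = (\<Prod>v \<in> S. fact (card (side e v)))"
  using S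
proof (induction S rule: finite_ranking_induct[where f = d])
  case empty
  have "{\<phi> \<in> extensional (spine e \<union> (\<Union>v \<in> {}. side e v)). (\<forall>v \<in> spine e. \<phi> v = (d v, [])) \<and>
     (\<forall>v \<in> {}. bij_betw \<phi> (side e v) (sons (card (side e v)) (\<phi> v)))} = {restrict (\<lambda>v. (d v, [])) (spine e)}"
    by (auto simp: extensional_def fun_eq_iff)
  then show ?case by simp
next
  case (insert x S)
  show ?case
  proof (cases "x \<in> S")
    case True
    then show ?thesis using insert by (simp add: insert_absorb)
  next
    case xS: False
    define dom where "dom S = spine e \<union> (\<Union>v \<in> S. side e v)" for S
    define K where "K S = {\<phi> \<in> extensional (dom S). (\<forall>v \<in> spine e. \<phi> v = (d v, [])) \<and>
      (\<forall>v \<in> S. bij_betw \<phi> (side e v) (sons (card (side e v)) (\<phi> v)))}" for S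
    define A where "A = side e x"
    define c where "c = card A"
    define G where "G \<phi> = {g \<in> A \<rightarrow>\<^sub>E sons c (\<phi> x). bij_betw g A (sons c (\<phi> x))}" for \<phi> :: "'a \<Rightarrow> nat \<times> nat list"
    have closed: "\<pi> v \<in> S" if v: "v \<in> S" "v \<noteq> rt T" for v
    proof -
      have "v \<in> verts T" using insert.prems(1) v by blast
      then have "d v = Suc (d (\<pi> v))" using depth v(2) by blast
      moreover have "d v \<le> d x" using insert.hyps(2) v(1) .
      ultimately have "\<pi> v \<noteq> x" by auto
      then show ?thesis using insert.prems(2)[of v] v by blast
    qed
    have dom: "v \<in> dom S" if v: "v \<in> insert x S" for v
    proof (cases "v \<in> spine e")
      case False
      have vT: "v \<in> verts T" using insert.prems(1) v by blast
      have vr: "v \<noteq> rt T" using False root_mem_spine by blast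
      have "\<pi> v \<in> insert x S" using insert.prems(2)[OF v vr] .
      moreover have "\<pi> v \<noteq> x"
        using depth[OF vT vr] insert.hyps(2)[of v] v by auto
      ultimately have "\<pi> v \<in> S" by blast
      then show ?thesis using mem_side_parent[OF vT False] by (auto simp: dom_def)
    qed (simp add: dom_def)
    have domA: "dom S \<inter> A = {}" "dom (insert x S) = dom S \<union> A"
    proof -
      have "side e v \<inter> A = {}" if "v \<in> S" for v
        unfolding A_def using xS that by (intro disjoint_side) auto
      then show "dom S \<inter> A = {}" unfolding dom_def using mem_sideD by (auto simp: A_def)
      show "dom (insert x S) = dom S \<union> A" by (auto simp: dom_def A_def)
    qed
    have finA: "finite A" using fin by (rule rev_finite_subset) (use mem_sideD in \<open>auto simp: A_def\<close>)
    have side_dom: "side e v \<subseteq> dom S" if "v \<in> S" for v using that by (auto simp: dom_def)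
    have IH: "card (K S) = (\<Prod>v \<in> S. fact (card (side e v)))"
      unfolding K_def dom_def using insert.IH insert.prems(1) closed by simp
    have bij: "bij_betw (\<lambda>(\<phi>, g). \<lambda>v. if v \<in> A then g v else \<phi> v) (Sigma (K S) G) (K (insert x S))"
    proof (rule bij_betw_byWitness[where f' = "\<lambda>\<phi>. (restrict \<phi> (dom S), restrict \<phi> A)"])
      show "\<forall>z \<in> Sigma (K S) G. (\<lambda>\<phi>. (restrict \<phi> (dom S), restrict \<phi> A))
          (case z of (\<phi>, g) \<Rightarrow> \<lambda>v. if v \<in> A then g v else \<phi> v) = z"
        using domA(1) by (auto simp: K_def G_def fun_eq_iff extensional_def PiE_iff)
      show "\<forall>\<phi> \<in> K (insert x S). (case (restrict \<phi> (dom S), restrict \<phi> A) of (\<phi>, g) \<Rightarrow>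
          \<lambda>v. if v \<in> A then g v else \<phi> v) = \<phi>"
        unfolding K_def domA(2) by (auto simp: fun_eq_iff extensional_def)
      show "(\<lambda>(\<phi>, g). \<lambda>v. if v \<in> A then g v else \<phi> v) ` Sigma (K S) G \<subseteq> K (insert x S)"
      proof
        fix \<psi> assume "\<psi> \<in> (\<lambda>(\<phi>, g). \<lambda>v. if v \<in> A then g v else \<phi> v) ` Sigma (K S) G"
        then obtain \<phi> g where \<psi>: "\<psi> = (\<lambda>v. if v \<in> A then g v else \<phi> v)" and \<phi>: "\<phi> \<in> K S" and g: "g \<in> G \<phi>"
          by auto
        have on_dom: "\<psi> v = \<phi> v" if "v \<in> dom S" for v using that domA(1) by (auto simp: \<psi>)
        have "bij_betw \<psi> A (sons c (\<psi> x))"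
        proof -
          have "bij_betw g A (sons c (\<phi> x))" using g by (simp add: G_def)
          moreover have "\<psi> x = \<phi> x" using on_dom dom by simp
          ultimately show ?thesis using bij_betw_cong[of A \<psi> g] by (simp add: \<psi>)
        qed
        moreover have "bij_betw \<psi> (side e v) (sons (card (side e v)) (\<psi> v))" if v: "v \<in> S" for v
        proof -
          have "bij_betw \<phi> (side e v) (sons (card (side e v)) (\<phi> v))" using \<phi> v by (simp add: K_def)
          moreover have "\<psi> v = \<phi> v" using on_dom dom v by simp
          moreover have "bij_betw \<psi> (side e v) Y \<longleftrightarrow> bij_betw \<phi> (side e v) Y" for Y
            using side_dom[OF v] on_dom by (intro bij_betw_cong) auto
          ultimately show ?thesis by simp
        qed
        moreover have "\<psi> v = (d v, [])" if "v \<in> spine e" for v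
          using on_dom[of v] that \<phi> by (simp add: dom_def K_def)
        moreover have "\<psi> \<in> extensional (dom S \<union> A)"
          using \<phi> by (auto simp: \<psi> K_def extensional_def)
        ultimately show "\<psi> \<in> K (insert x S)" unfolding K_def domA(2) by (simp add: A_def c_def)
      qed
      show "(\<lambda>\<phi>. (restrict \<phi> (dom S), restrict \<phi> A)) ` K (insert x S) \<subseteq> Sigma (K S) G"
      proof
        fix z assume "z \<in> (\<lambda>\<phi>. (restrict \<phi> (dom S), restrict \<phi> A)) ` K (insert x S)"
        then obtain \<phi> where z: "z = (restrict \<phi> (dom S), restrict \<phi> A)" and \<phi>: "\<phi> \<in> K (insert x S)"
          by auto
        let ?\<phi> = "restrict \<phi> (dom S)"
        have val: "?\<phi> v = \<phi> v" if "v \<in> insert x S" for v using dom[OF that] by simp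
        have "bij_betw ?\<phi> (side e v) (sons (card (side e v)) (?\<phi> v))" if v: "v \<in> S" for v
        proof -
          have "bij_betw \<phi> (side e v) (sons (card (side e v)) (\<phi> v))" using \<phi> v by (simp add: K_def)
          moreover have "?\<phi> v = \<phi> v" using val v by blast
          moreover have "bij_betw ?\<phi> (side e v) Y \<longleftrightarrow> bij_betw \<phi> (side e v) Y" for Y
            using side_dom[OF v] by (intro bij_betw_cong) auto
          ultimately show ?thesis by simp
        qed
        moreover have "?\<phi> v = (d v, [])" if "v \<in> spine e" for v
          using that \<phi> by (simp add: K_def dom_def)
        ultimately have "?\<phi> \<in> K S" by (simp add: K_def)
        moreover have "restrict \<phi> A \<in> G ?\<phi>"
        proof -
          have "bij_betw \<phi> A (sons c (\<phi> x))" using \<phi> by (simp add: K_def A_def c_def)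
          then show ?thesis using val[of x] by (auto simp: G_def bij_betw_def)
        qed
        ultimately show "z \<in> Sigma (K S) G" using z by simp
      qed
    qed
    have "card (K (insert x S)) = card (Sigma (K S) G)" using bij_betw_same_card[OF bij] by (rule sym)
    also have "\<dots> = (\<Sum>\<phi> \<in> K S. card (G \<phi>))"
    proof (rule card_SigmaI)
      have "card (K S) > 0" unfolding IH by (simp add: prod_pos)
      then show "finite (K S)" by (rule card_ge_0_finite)
      have "finite (A \<rightarrow>\<^sub>E sons c (\<phi> x))" for \<phi>
        using finA finite_sons by (simp add: finite_PiE)
      then show "\<forall>\<phi> \<in> K S. finite (G \<phi>)" by (auto simp: G_def)
    qed
    also have "\<dots> = card (K S) * fact c"
      using card_bijections[OF finA finite_sons] by (simp add: G_def card_sons c_def)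
    also have "\<dots> = (\<Prod>v \<in> insert x S. fact (card (side e v)))"
      using insert.hyps(1) xS by (simp add: IH c_def A_def)
    finally show ?thesis by (simp add: K_def dom_def)
  qed
qed

lemma card_spine_codings:
  assumes "finite (verts T)"
  shows "card spine_codings = (\<Prod>v \<in> verts T. fact (card (side e v)))"
proof -
  have "spine e \<union> (\<Union>v \<in> verts T. side e v) = verts T" using UN_side spine_subset by blast
  then show ?thesis
    using card_partial_codings[OF assms assms] parent by (simp add: spine_codings_def)
qed

lemma finite_spine_codings:
  assumes "finite (verts T)"
  shows "finite spine_codings"
proof (rule card_ge_0_finite)
  show "card spine_codings > 0" unfolding card_spine_codings[OF assms] by (simp add: prod_pos)
qed

text \<open>
  Every vertex off the path to \<open>e\<close> is counted once, at its parent.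
\<close>

lemma sum_card_side:
  assumes "finite (verts T)"
  shows "(\<Sum>v \<in> verts T. card (side e v)) + Suc (d e) = card (verts T)"
proof -
  have "(\<Sum>v \<in> verts T. card (side e v)) = card (\<Union>v \<in> verts T. side e v)"
  proof (rule card_UN_disjoint[symmetric])
    show "\<forall>v \<in> verts T. finite (side e v)"
      using assms mem_sideD by (meson finite_subset subsetI)
  qed (use assms disjoint_side in auto)
  also have "\<dots> = card (verts T) - Suc (d e)"
    unfolding UN_side using card_Diff_subset[OF finite_spine spine_subset] card_spine by simp
  finally show ?thesis
    using card_mono[OF assms spine_subset] card_spine by simp
qed

end
end


section \<open>Isomorphisms onto a ball of the spine tree\<close>

text \<open>
  The last vertex of a spine with \<open>L\<close> vertices that lies in the ball of radius \<open>h\<close> has depth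
  \<open>l = min (L - 1) h\<close>.
\<close>

definition spine_ends :: "nat \<Rightarrow> enat \<Rightarrow> nat \<Rightarrow> bool" where
  "spine_ends h L l \<longleftrightarrow> l \<le> h \<and> enat l < L \<and> (l = h \<or> L = enat (Suc l))"

lemma ex_spine_ends: "L > 0 \<Longrightarrow> \<exists>l. spine_ends h L l"
proof (cases L)
  case (enat n)
  assume "L > 0"
  then have "n > 0" using enat by (simp add: zero_enat_def)
  then show ?thesis using enat by (intro exI[of _ "min (n - 1) h"]) (auto simp: spine_ends_def)
next
  case infinity
  then show ?thesis by (intro exI[of _ h]) (simp add: spine_ends_def)
qed

lemma spine_ends_le: "spine_ends h L l \<Longrightarrow> m \<le> h \<Longrightarrow> enat m < L \<Longrightarrow> m \<le> l"
  by (auto simp: spine_ends_def)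

lemma spine_ends_unique: "spine_ends h L l \<Longrightarrow> spine_ends h L l' \<Longrightarrow> l = l'"
  by (auto simp: spine_ends_def)

context parent_tree
begin

definition matches :: "nat \<Rightarrow> (nat \<Rightarrow> nat list \<Rightarrow> nat) \<Rightarrow> 'a \<Rightarrow> ('a \<Rightarrow> nat \<times> nat list) \<Rightarrow> bool" where
  "matches h \<omega> e \<phi> \<longleftrightarrow> (\<forall>v \<in> verts T. d v < h \<longrightarrow> \<omega> (fst (\<phi> v)) (snd (\<phi> v)) = card (side e v))"

lemma kids_eq: "kids v = side e v \<union> (kids v \<inter> spine e)"
  by (auto simp: side_def)

lemma coding_mem_isos:
  assumes le: "\<And>v. v \<in> verts T \<Longrightarrow> d v \<le> h"
    and e: "e \<in> verts T" "spine_ends h L (d e)"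
    and phi: "\<phi> \<in> spine_codings e" "matches h \<omega> e \<phi>"
  shows "\<phi> \<in> isos T (trunc h (grafted_BGW L \<omega>))"
proof -
  let ?R = "grafted_BGW L \<omega>"
  have L: "enat (d e) < L" using e(2) by (simp add: spine_ends_def)
  then have L0: "L > 0" by (metis not_less_zero zero_less_iff_neq_zero)
  interpret R: parent_tree ?R graft_parent graft_depth by (rule parent_tree_grafted_BGW[OF L0])
  have on_spine: "\<phi> v = (d v, [])" if "v \<in> spine e" for v
    using phi(1) that e(1) by (simp add: spine_codings_def)
  have below_L: "enat m < L" if "m \<le> d e" for m
    using L that by (metis enat_ord_simps(1) le_less_trans)
  have mem: "\<phi> v \<in> verts ?R" if "v \<in> verts T" for v
    using that
  proof (induction v rule: vertex_induct)
    case root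
    then show ?case
      using on_spine[OF root_mem_spine[OF e(1)]] L0
      by (simp add: mem_grafted_BGW_iff Nil_mem_BGW_tree depth_root zero_enat_def)
  next
    case (step v)
    show ?case
    proof (cases "v \<in> spine e")
      case True
      then show ?thesis
        using on_spine below_L spine_depth_le[OF e(1) True] by (simp add: mem_grafted_BGW_iff Nil_mem_BGW_tree)
    next
      case False
      have "d (\<pi> v) < h" using le[OF step.hyps(1)] depth[OF step.hyps] by simp
      then have "\<omega> (fst (\<phi> (\<pi> v))) (snd (\<phi> (\<pi> v))) = card (side e (\<pi> v))"
        using phi(2) parent[OF step.hyps] by (simp add: matches_def)
      moreover have "\<phi> v \<in> sons (card (side e (\<pi> v))) (\<phi> (\<pi> v))"
        using codings_sons[OF e(1) phi(1) step.hyps(1) False] .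
      ultimately show ?thesis using step.IH
        by (cases "\<phi> (\<pi> v)") (auto simp: sons_def mem_grafted_BGW_iff snoc_mem_BGW_tree_iff)
    qed
  qed
  have "bij_betw \<phi> (kids v) (R.kids (\<phi> v))" if v: "v \<in> verts T" "d v < h" for v
  proof -
    define X where "X = (if snd (\<phi> v) = [] \<and> enat (Suc (fst (\<phi> v))) < L
      then {(Suc (fst (\<phi> v)), [] :: nat list)} else {})"
    have R: "R.kids (\<phi> v) = sons (card (side e v)) (\<phi> v) \<union> X"
      using kids_grafted_BGW[OF L0 mem[OF v(1)]] phi(2) v by (simp add: X_def matches_def)
    have "bij_betw \<phi> (side e v) (sons (card (side e v)) (\<phi> v))"
      using phi(1) v(1) e(1) by (simp add: spine_codings_def)
    moreover have "bij_betw \<phi> (kids v \<inter> spine e) X"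
    proof -
      consider "v \<notin> spine e" | "v = e" | "v \<in> spine e" "d v < d e"
        using spine_depth_le[OF e(1), of v] spine_eqI[OF e(1), of v e] mem_spine_self[OF e(1)]
        by (metis le_neq_implies_less)
      then show ?thesis
      proof cases
        case 1
        then have "snd (\<phi> v) \<noteq> []" using codings_snd_Nil_iff[OF e(1) phi(1) v(1)] by simp
        then show ?thesis using kids_inter_spine_empty[OF e(1), of v] 1 by (simp add: X_def bij_betw_def)
      next
        case 2
        then have "L = enat (Suc (d e))" using v(2) e(2) by (simp add: spine_ends_def)
        then have "X = {}" using on_spine[OF mem_spine_self[OF e(1)]] 2 by (simp add: X_def)
        then show ?thesis using kids_inter_spine_empty[OF e(1), of v] 2 by (simp add: bij_betw_def)
      next
        case 3
        then obtain w where w: "w \<in> spine e" "d w = Suc (d v)"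
          using ex_spine_depth[OF e(1), of "Suc (d v)"] by auto
        have "X = {(Suc (d v), [])}"
          using on_spine[OF 3(1)] below_L[of "Suc (d v)"] 3(2) by (simp add: X_def)
        then show ?thesis
          using kids_inter_spine(1)[OF e(1) 3(1) w] on_spine[OF w(1)] w(2) by (simp add: bij_betw_def)
      qed
    qed
    moreover have "sons (card (side e v)) (\<phi> v) \<inter> X = {}"
      by (auto simp: X_def dest: sons_nonempty_word)
    ultimately have "bij_betw \<phi> (side e v \<union> (kids v \<inter> spine e)) (R.kids (\<phi> v))"
      unfolding R by (rule bij_betw_combine)
    then show ?thesis using kids_eq[of v e] by simp
  qed
  moreover have "\<phi> (rt T) = rt ?R"
    using on_spine[OF root_mem_spine[OF e(1)]] depth_root by (simp add: root_graft_BGW)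
  moreover have "\<phi> \<in> extensional (verts T)" using phi(1) e(1) by (simp add: spine_codings_def)
  ultimately show ?thesis
    by (intro isos_trunc_iff[OF parent_tree_axioms R.parent_tree_axioms, of h \<phi>, THEN iffD2]) (use le in auto)
qed

text \<open>
  The vertex \<open>e\<close> is the one that goes to the last spine vertex in the ball. Its ancestors then go to the
  spine, because parents are preserved.
\<close>

lemma isos_obtain_coding:
  assumes le: "\<And>v. v \<in> verts T \<Longrightarrow> d v \<le> h"
    and L0: "L > 0" and phi: "\<phi> \<in> isos T (trunc h (grafted_BGW L \<omega>))"
  obtains e where "e \<in> verts T" "spine_ends h L (d e)" "\<phi> \<in> spine_codings e" "matches h \<omega> e \<phi>"
proof -
  let ?R = "grafted_BGW L \<omega>"
  interpret R: parent_tree ?R graft_parent graft_depth by (rule parent_tree_grafted_BGW[OF L0])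
  have bij: "bij_betw \<phi> (verts T) (verts (trunc h ?R))" "\<phi> \<in> extensional (verts T)"
    using phi by (auto simp: isos_def)
  have inj: "inj_on \<phi> (verts T)" using bij(1) by (simp add: bij_betw_def)
  have mem: "\<phi> v \<in> verts ?R" if "v \<in> verts T" for v
    using bij(1) that by (auto simp: bij_betw_def R.verts_trunc)
  have dep: "graft_depth (\<phi> v) = d v" if "v \<in> verts T" for v
    using isos_depth[OF parent_tree_axioms R.parent_tree_trunc phi that] .
  have par: "\<phi> (\<pi> v) = graft_parent (\<phi> v)" if "v \<in> verts T" "v \<noteq> rt T" for v
    using isos_parent[OF parent_tree_axioms R.parent_tree_trunc phi that] .
  have kid: "bij_betw \<phi> (kids v) (R.kids (\<phi> v))" if "v \<in> verts T" "d v < h" for v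
    using isos_trunc_iff[OF parent_tree_axioms R.parent_tree_axioms, of h \<phi>] le phi that by blast
  obtain l where l: "spine_ends h L l" using ex_spine_ends[OF L0] by blast
  then have "(l, []) \<in> verts (trunc h ?R)"
    by (simp add: R.verts_trunc mem_grafted_BGW_iff Nil_mem_BGW_tree graft_depth_def spine_ends_def)
  then have "(l, []) \<in> \<phi> ` verts T" using bij(1) by (simp add: bij_betw_def)
  then obtain e where e: "e \<in> verts T" "\<phi> e = (l, [])" by (metis imageE)
  have de: "d e = l" using dep[OF e(1)] e(2) by (simp add: graft_depth_def)
  have iter: "\<phi> ((\<pi> ^^ i) e) = (l - i, [])" if "i \<le> l" for i
    using that
  proof (induction i)
    case (Suc i)
    have v: "(\<pi> ^^ i) e \<in> verts T" "d ((\<pi> ^^ i) e) = l - i"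
      using iterate_parent[OF e(1), of i] Suc.prems de by auto
    then have "(\<pi> ^^ i) e \<noteq> rt T" using Suc.prems depth_root by auto
    then show ?case using par[OF v(1)] Suc by (simp add: graft_parent_def)
  qed (simp add: e(2))
  have on_spine: "\<phi> v = (d v, [])" if "v \<in> spine e" for v
  proof -
    obtain i where "i \<le> l" "v = (\<pi> ^^ i) e" using \<open>v \<in> spine e\<close> de by (auto simp: spine_def)
    then show ?thesis using iter[of i] iterate_parent(2)[OF e(1), of i] de by simp
  qed
  have side_img: "bij_betw \<phi> (side e v) (sons (\<omega> (fst (\<phi> v)) (snd (\<phi> v))) (\<phi> v))"
    if v: "v \<in> verts T" "d v < h" for v
    unfolding bij_betw_def
  proof
    have K: "R.kids (\<phi> v) = sons (\<omega> (fst (\<phi> v)) (snd (\<phi> v))) (\<phi> v) \<union>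
      (if snd (\<phi> v) = [] \<and> enat (Suc (fst (\<phi> v))) < L then {(Suc (fst (\<phi> v)), [])} else {})"
      by (rule kids_grafted_BGW[OF L0 mem[OF v(1)]])
    show "inj_on \<phi> (side e v)"
      using inj by (rule inj_on_subset) (use mem_sideD[OF e(1)] in blast)
    show "\<phi> ` side e v = sons (\<omega> (fst (\<phi> v)) (snd (\<phi> v))) (\<phi> v)"
    proof (intro equalityI subsetI)
      fix y assume "y \<in> \<phi> ` side e v"
      then obtain w where w: "y = \<phi> w" "w \<in> side e v" by blast
      note wD = mem_sideD[OF e(1) w(2)]
      have "w \<in> kids v" using w(2) by (simp add: side_def)
      then have "\<phi> w \<in> R.kids (\<phi> v)" using kid[OF v] by (auto simp: bij_betw_def)
      \<comment> \<open>A child sent to the next spine vertex would coincide with the vertex of the path to \<open>e\<close> at its depth.\<close>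
      moreover have False if s: "enat (Suc (fst (\<phi> v))) < L" "\<phi> w = (Suc (fst (\<phi> v)), [])"
      proof -
        have dw: "d w = Suc (fst (\<phi> v))" using dep[of w] wD s(2) by (simp add: graft_depth_def)
        then have "d w \<le> l" using spine_ends_le[OF l le[of w]] wD s(1) by simp
        then obtain w' where w': "w' \<in> spine e" "d w' = d w"
          using ex_spine_depth[OF e(1), of "d w"] de by blast
        then have "\<phi> w' = \<phi> w" using on_spine s(2) dw by simp
        then have "w' = w" using inj spine_subset[OF e(1)] w'(1) wD by (meson inj_onD subsetD)
        then show False using w'(1) wD by blast
      qed
      ultimately show "y \<in> sons (\<omega> (fst (\<phi> v)) (snd (\<phi> v))) (\<phi> v)"
        unfolding K w(1) by (auto split: if_splits)
    next
      fix y assume y: "y \<in> sons (\<omega> (fst (\<phi> v)) (snd (\<phi> v))) (\<phi> v)"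
      then have "y \<in> R.kids (\<phi> v)" by (simp add: K)
      then obtain w where w: "w \<in> kids v" "y = \<phi> w" using kid[OF v] by (auto simp: bij_betw_def)
      have "w \<notin> spine e" using on_spine[of w] sons_nonempty_word[OF y] w(2) by auto
      then show "y \<in> \<phi> ` side e v" using w by (simp add: side_def)
    qed
  qed
  have m: "matches h \<omega> e \<phi>"
    unfolding matches_def using bij_betw_same_card[OF side_img] by (simp add: card_sons)
  moreover have "\<phi> \<in> spine_codings e"
  proof -
    have "bij_betw \<phi> (side e v) (sons (card (side e v)) (\<phi> v))" if v: "v \<in> verts T" for v
    proof (cases "d v < h")
      case True
      then show ?thesis using side_img[OF v] m v by (simp add: matches_def)
    next
      case False
      have "kids v = {}" using depth_kids le False kids_subset[of v] by fastforce
      then show ?thesis by (simp add: side_def sons_def bij_betw_def)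
    qed
    then show ?thesis using bij(2) on_spine e(1) by (simp add: spine_codings_def)
  qed
  moreover have "spine_ends h L (d e)" using l de by simp
  ultimately show thesis using that e(1) by blast
qed

lemma isos_grafted_BGW:
  assumes le: "\<And>v. v \<in> verts T \<Longrightarrow> d v \<le> h" and L0: "L > 0"
  shows "isos T (trunc h (grafted_BGW L \<omega>)) =
    (\<Union>e \<in> {e \<in> verts T. spine_ends h L (d e)}. {\<phi> \<in> spine_codings e. matches h \<omega> e \<phi>})"
  using coding_mem_isos[OF le] isos_obtain_coding[OF le L0] by (auto; metis)

text \<open>
  The vertex \<open>e\<close> can be recovered from an isomorphism, as the preimage of the last spine vertex in the ball, so
  the codings belonging to different \<open>e\<close> do not overlap.
\<close>

lemma card_isos_grafted_BGW:
  assumes le: "\<And>v. v \<in> verts T \<Longrightarrow> d v \<le> h" and L0: "L > 0" and fin: "finite (verts T)"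
  shows "card (isos T (trunc h (grafted_BGW L \<omega>))) =
    (\<Sum>e \<in> verts T. \<Sum>\<phi> \<in> spine_codings e. if spine_ends h L (d e) \<and> matches h \<omega> e \<phi> then 1 else 0)"
proof -
  let ?K = "\<lambda>e. {\<phi> \<in> spine_codings e. matches h \<omega> e \<phi>}"
  have eq: "isos T (trunc h (grafted_BGW L \<omega>)) = (\<Union>e \<in> {e \<in> verts T. spine_ends h L (d e)}. ?K e)"
    by (rule isos_grafted_BGW) (use le L0 in auto)
  have "card (isos T (trunc h (grafted_BGW L \<omega>))) = (\<Sum>e \<in> {e \<in> verts T. spine_ends h L (d e)}. card (?K e))"
    unfolding eq
  proof (rule card_UN_disjoint)
    show "\<forall>e \<in> {e \<in> verts T. spine_ends h L (d e)}. finite (?K e)"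
      using finite_spine_codings[OF _ fin] by auto
    show "\<forall>e \<in> {e \<in> verts T. spine_ends h L (d e)}. \<forall>e' \<in> {e \<in> verts T. spine_ends h L (d e)}.
        e \<noteq> e' \<longrightarrow> ?K e \<inter> ?K e' = {}"
    proof (intro ballI impI)
      fix e e' assume e: "e \<in> {e \<in> verts T. spine_ends h L (d e)}" "e' \<in> {e \<in> verts T. spine_ends h L (d e)}"
        "e \<noteq> e'"
      have "False" if "\<phi> \<in> spine_codings e" "\<phi> \<in> spine_codings e'" for \<phi>
      proof -
        have "d e = d e'" using spine_ends_unique e by auto
        then have "\<phi> e = \<phi> e'"
          using that e mem_spine_self by (simp add: spine_codings_def)
        then show False using inj_on_codings[of e \<phi>] that e by (auto dest: inj_onD)
      qed
      then show "?K e \<inter> ?K e' = {}" by blast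
    qed
  qed (use fin in simp)
  also have "\<dots> = (\<Sum>e \<in> verts T. if spine_ends h L (d e) then card (?K e) else 0)"
    using fin by (simp add: sum.If_cases Int_def)
  also have "\<dots> = (\<Sum>e \<in> verts T. \<Sum>\<phi> \<in> spine_codings e.
      if spine_ends h L (d e) \<and> matches h \<omega> e \<phi> then 1 else 0)"
    using finite_spine_codings[OF _ fin] by (intro sum.cong refl) (simp add: sum.If_cases Int_def)
  finally show ?thesis .
qed

end


section \<open>The law of a ball in the spine tree\<close>

lemma prob_space_BGWP: "prob_space (BGWP \<beta>)"
  unfolding BGWP_def by (intro prob_space_PiM prob_space_measure_pmf)

lemma prob_space_BGWP_family: "prob_space (\<Pi>\<^sub>M i \<in> (UNIV :: nat set). BGWP \<beta>)"
  by (intro prob_space_PiM prob_space_BGWP)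

text \<open>
  The offspring numbers are independent, within one tree and across the trees on the spine; the finitely many
  positions are grouped according to the tree that they belong to.
\<close>

lemma BGWP_family_cylinder:
  fixes F :: "(nat \<times> nat list) set" and n :: "nat \<times> nat list \<Rightarrow> nat" and \<beta> :: real
  assumes F: "finite F"
  defines "P \<equiv> \<Pi>\<^sub>M i \<in> (UNIV :: nat set). BGWP \<beta>"
  shows "{\<omega> \<in> space P. \<forall>x \<in> F. \<omega> (fst x) (snd x) = n x} \<in> sets P"
    and "measure P {\<omega> \<in> space P. \<forall>x \<in> F. \<omega> (fst x) (snd x) = n x} = (\<Prod>x \<in> F. pmf (poisson_pmf \<beta>) (n x))"
proof -
  interpret B: product_prob_space "\<lambda>_. measure_pmf (poisson_pmf \<beta>)" "UNIV :: nat list set" ..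
  interpret G: prob_space "BGWP \<beta>" by (rule prob_space_BGWP)
  interpret P: product_prob_space "\<lambda>_. BGWP \<beta>" "UNIV :: nat set" ..
  define J where "J i = {u. (i, u) \<in> F}" for i
  define X where "X i = {N \<in> space (BGWP \<beta>). \<forall>u \<in> J i. N u \<in> {n (i, u)}}" for i
  have finJ: "finite (J i)" for i
    using finite_vimageI[OF F, of "Pair i"] by (simp add: J_def vimage_def inj_on_def)
  have Xs: "X i \<in> sets (BGWP \<beta>)" for i
  proof -
    have "X i = {N \<in> space (BGWP \<beta>). \<forall>u \<in> J i. N u = n (i, u)}" by (simp add: X_def)
    also have "\<dots> \<in> sets (BGWP \<beta>)"
    proof (rule sets.sets_Collect_finite_All[OF _ finJ])
      fix u
      have "(\<lambda>N. N u) \<in> BGWP \<beta> \<rightarrow>\<^sub>M measure_pmf (poisson_pmf \<beta>)"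
        unfolding BGWP_def by (rule measurable_component_singleton) simp
      then have "(\<lambda>N. N u) -` {n (i, u)} \<inter> space (BGWP \<beta>) \<in> sets (BGWP \<beta>)"
        by (rule measurable_sets) simp
      also have "(\<lambda>N. N u) -` {n (i, u)} \<inter> space (BGWP \<beta>) = {N \<in> space (BGWP \<beta>). N u = n (i, u)}"
        by auto
      finally show "{N \<in> space (BGWP \<beta>). N u = n (i, u)} \<in> sets (BGWP \<beta>)" .
    qed
    finally show ?thesis .
  qed
  have eX: "emeasure (BGWP \<beta>) (X i) = (\<Prod>u \<in> J i. ennreal (pmf (poisson_pmf \<beta>) (n (i, u))))" for i
    unfolding X_def BGWP_def using finJ
    by (subst B.emeasure_PiM_Collect) (auto simp: emeasure_pmf_single)
  have F_eq: "F = Sigma (fst ` F) J" by (force simp: J_def)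
  have set_eq: "{\<omega> \<in> space P. \<forall>x \<in> F. \<omega> (fst x) (snd x) = n x} = {\<omega> \<in> space P. \<forall>i \<in> fst ` F. \<omega> i \<in> X i}"
    (is "?L = ?R")
  proof -
    have "\<omega> i \<in> space (BGWP \<beta>)" if "\<omega> \<in> space P" for \<omega> i
      using that by (simp add: P_def space_PiM PiE_iff)
    then show ?thesis by (force simp: X_def J_def)
  qed
  have sub: "\<And>i. i \<in> fst ` F \<Longrightarrow> X i \<in> sets (BGWP \<beta>)" by (rule Xs)
  show "?L \<in> sets P"
    unfolding set_eq unfolding P_def
  proof (rule sets.sets_Collect_finite_All[OF _ finite_imageI[OF F]])
    fix i
    have "(\<lambda>\<omega>. \<omega> i) \<in> P \<rightarrow>\<^sub>M BGWP \<beta>"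
      unfolding P_def by (rule measurable_component_singleton) simp
    then have "(\<lambda>\<omega>. \<omega> i) -` X i \<inter> space P \<in> sets P" using Xs by (rule measurable_sets)
    also have "(\<lambda>\<omega>. \<omega> i) -` X i \<inter> space P = {\<omega> \<in> space P. \<omega> i \<in> X i}" by auto
    finally show "{\<omega> \<in> space (Pi\<^sub>M UNIV (\<lambda>i. BGWP \<beta>)). \<omega> i \<in> X i} \<in> sets (Pi\<^sub>M UNIV (\<lambda>i. BGWP \<beta>))"
      by (simp add: P_def)
  qed
  have "emeasure P ?L = (\<Prod>i \<in> fst ` F. emeasure (BGWP \<beta>) (X i))"
    unfolding set_eq unfolding P_def by (rule P.emeasure_PiM_Collect) (use F Xs in auto)
  also have "\<dots> = (\<Prod>x \<in> F. ennreal (pmf (poisson_pmf \<beta>) (n x)))"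
    unfolding eX using F finJ by (subst (2) F_eq, subst prod.Sigma) auto
  also have "\<dots> = ennreal (\<Prod>x \<in> F. pmf (poisson_pmf \<beta>) (n x))"
    by (rule prod_ennreal) simp
  finally show "measure P ?L = (\<Prod>x \<in> F. pmf (poisson_pmf \<beta>) (n x))"
    by (simp add: measure_def prod_nonneg)
qed

text \<open>
  The factorials that count the codings cancel against those of the Poisson weights. A factor \<open>exp (- \<beta>)\<close>
  remains for each vertex of depth less than \<open>h\<close>, and a factor \<open>\<beta>\<close> for each edge off the spine.
\<close>

lemma (in parent_tree) sum_codings_Poisson:
  assumes le: "\<And>v. v \<in> verts T \<Longrightarrow> d v \<le> h" and fin: "finite (verts T)"
    and \<beta>: "\<beta> > 0" and e: "e \<in> verts T"
  shows "card (spine_codings e) * (\<Prod>v \<in> {v \<in> verts T. d v < h}. pmf (poisson_pmf \<beta>) (card (side e v))) =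
    exp (- (real (card (verts T)) - card {v \<in> verts T. d v = h}) * \<beta>) * \<beta> ^ (card (verts T) - 1 - d e)"
proof -
  let ?I = "{v \<in> verts T. d v < h}" and ?D = "{v \<in> verts T. d v = h}"
  let ?c = "\<lambda>v. card (side e v)"
  have V: "verts T = ?I \<union> ?D" using le by (auto simp: le_less)
  have fins: "finite ?I" "finite ?D" using fin by auto
  have leaf: "?c v = 0" if "v \<in> verts T - ?I" for v
  proof -
    have "kids v = {}" using depth_kids[of _ v] le that kids_subset[of v] by fastforce
    then show ?thesis by (simp add: side_def)
  qed
  have "card (spine_codings e) = (\<Prod>v \<in> ?I. fact (?c v))"
    unfolding card_spine_codings[OF e fin] using fin leaf by (intro prod.mono_neutral_right) auto
  moreover have "(\<Sum>v \<in> ?I. ?c v) = card (verts T) - 1 - d e"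
  proof -
    have "(\<Sum>v \<in> ?I. ?c v) = (\<Sum>v \<in> verts T. ?c v)"
      using fin leaf by (intro sum.mono_neutral_left) auto
    then show ?thesis using sum_card_side[OF e fin] by simp
  qed
  moreover have "card (verts T) = card ?I + card ?D"
    using card_Un_disjoint[OF fins] V by auto
  moreover have "(\<Prod>v \<in> ?I. fact (?c v)) * (\<Prod>v \<in> ?I. pmf (poisson_pmf \<beta>) (?c v)) =
      \<beta> ^ (\<Sum>v \<in> ?I. ?c v) * exp (- \<beta>) ^ card ?I"
  proof -
    have "(\<Prod>v \<in> ?I. fact (?c v)) * (\<Prod>v \<in> ?I. pmf (poisson_pmf \<beta>) (?c v)) =
        (\<Prod>v \<in> ?I. \<beta> ^ ?c v * exp (- \<beta>))"
      unfolding prod.distrib[symmetric] using \<beta> by (intro prod.cong) auto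
    then show ?thesis by (simp add: prod.distrib power_sum)
  qed
  ultimately show ?thesis
    by (simp add: exp_of_nat_mult[symmetric] mult.commute)
qed

text \<open>
  This covers both limit trees: \<open>\<rho>\<close> is the law of the depth of the last spine vertex in the ball, which is
  independent of the offspring numbers.
\<close>

lemma prob_limit_ball:
  fixes M :: "'w measure" and t :: "nat rgraph"
  assumes "prob_space M" and t: "parent_tree t \<pi> d"
    and le: "\<And>v. v \<in> verts t \<Longrightarrow> d v \<le> h" and fin: "finite (verts t)"
    and \<beta>: "\<beta> > 0"
    and event: "{w \<in> space M. utrunc h (shape (grafted_BGW (Lm w) (W w))) = shape t} \<in> sets M"
    and pos: "AE w in M. Lm w > 0"
    and meas: "\<And>l F n. finite F \<Longrightarrow>
      {w \<in> space M. spine_ends h (Lm w) l \<and> (\<forall>x \<in> F. W w (fst x) (snd x) = n x)} \<in> sets M"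
    and prob: "\<And>l F n. finite F \<Longrightarrow>
      measure M {w \<in> space M. spine_ends h (Lm w) l \<and> (\<forall>x \<in> F. W w (fst x) (snd x) = n x)} =
      \<rho> l * (\<Prod>x \<in> F. pmf (poisson_pmf \<beta>) (n x))"
  shows "card (isos t t) * measure M {w \<in> space M. utrunc h (shape (grafted_BGW (Lm w) (W w))) = shape t} =
    exp (- (real (card (verts t)) - card {v \<in> verts t. d v = h}) * \<beta>) *
    (\<Sum>e \<in> verts t. \<rho> (d e) * \<beta> ^ (card (verts t) - 1 - d e))"
proof -
  interpret prob_space M by fact
  interpret t: parent_tree t \<pi> d by fact
  let ?I = "{v \<in> verts t. d v < h}"
  define E where "E = {w \<in> space M. utrunc h (shape (grafted_BGW (Lm w) (W w))) = shape t}"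
  define S where "S e \<phi> = {w \<in> space M. spine_ends h (Lm w) (d e) \<and> t.matches h (W w) e \<phi>}" for e \<phi>
  have S: "S e \<phi> \<in> sets M"
    "measure M (S e \<phi>) = \<rho> (d e) * (\<Prod>v \<in> ?I. pmf (poisson_pmf \<beta>) (card (t.side e v)))"
    if e: "e \<in> verts t" and \<phi>: "\<phi> \<in> t.spine_codings e" for e \<phi>
  proof -
    define n where "n x = card (t.side e (inv_into (verts t) \<phi> x))" for x
    have inj: "inj_on \<phi> (verts t)" using t.inj_on_codings[OF e \<phi>] .
    have n: "n (\<phi> v) = card (t.side e v)" if "v \<in> verts t" for v
      using inj that by (simp add: n_def)
    have eq: "S e \<phi> = {w \<in> space M. spine_ends h (Lm w) (d e) \<and> (\<forall>x \<in> \<phi> ` ?I. W w (fst x) (snd x) = n x)}"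
      by (auto simp: S_def t.matches_def n)
    have F: "finite (\<phi> ` ?I)" using fin by simp
    show "S e \<phi> \<in> sets M" unfolding eq by (rule meas[OF F])
    have "inj_on \<phi> ?I" using inj by (rule inj_on_subset) auto
    then show "measure M (S e \<phi>) = \<rho> (d e) * (\<Prod>v \<in> ?I. pmf (poisson_pmf \<beta>) (card (t.side e v)))"
      unfolding eq prob[OF F] by (simp add: prod.reindex n)
  qed
  have AE: "AE w in M. real (card (isos t t)) * indicator E w =
      (\<Sum>e \<in> verts t. \<Sum>\<phi> \<in> t.spine_codings e. indicator (S e \<phi>) w :: real)"
    using pos AE_space
  proof eventually_elim
    case (elim w)
    interpret R: parent_tree "grafted_BGW (Lm w) (W w)" graft_parent graft_depth
      by (rule parent_tree_grafted_BGW[OF elim(1)])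
    have "real (card (isos t t)) * indicator E w = real (card (isos t (trunc h (grafted_BGW (Lm w) (W w)))))"
      unfolding card_isos_trunc[OF R.simple_graph R.root t.simple_graph t.root fin]
      using elim(2) by (simp add: E_def indicator_def)
    also have "\<dots> = (\<Sum>e \<in> verts t. \<Sum>\<phi> \<in> t.spine_codings e.
        real (if spine_ends h (Lm w) (d e) \<and> t.matches h (W w) e \<phi> then 1 else 0))"
      using t.card_isos_grafted_BGW[of h "Lm w" "W w"] le elim(1) fin by (simp only: of_nat_sum)
    also have "\<dots> = (\<Sum>e \<in> verts t. \<Sum>\<phi> \<in> t.spine_codings e. indicator (S e \<phi>) w)"
      using elim(2) by (intro sum.cong refl) (simp add: S_def)
    finally show ?case .
  qed
  have "card (isos t t) * measure M E = (\<integral>w. real (card (isos t t)) * indicator E w \<partial>M)"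
    using event by (simp add: E_def)
  also have "\<dots> = (\<integral>w. (\<Sum>e \<in> verts t. \<Sum>\<phi> \<in> t.spine_codings e. indicator (S e \<phi>) w) \<partial>M)"
  proof (rule integral_cong_AE[OF _ _ AE])
    show "(\<lambda>w. real (card (isos t t)) * indicator E w :: real) \<in> borel_measurable M"
      using event by (simp add: E_def)
    show "(\<lambda>w. \<Sum>e \<in> verts t. \<Sum>\<phi> \<in> t.spine_codings e. indicator (S e \<phi>) w :: real) \<in> borel_measurable M"
      using S(1) by (intro borel_measurable_sum borel_measurable_indicator)
  qed
  also have "\<dots> = (\<Sum>e \<in> verts t. \<Sum>\<phi> \<in> t.spine_codings e. measure M (S e \<phi>))"
  proof -
    have int: "integrable M (\<lambda>w. indicator (S e \<phi>) w :: real)"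
      if "e \<in> verts t" "\<phi> \<in> t.spine_codings e" for e \<phi>
      using S(1)[OF that] by (simp add: integrable_indicator_iff less_top[symmetric])
    have "(\<integral>w. (\<Sum>\<phi> \<in> t.spine_codings e. indicator (S e \<phi>) w) \<partial>M) =
        (\<Sum>\<phi> \<in> t.spine_codings e. measure M (S e \<phi>))" if "e \<in> verts t" for e
      using int[OF that] S(1)[OF that] by (subst Bochner_Integration.integral_sum) (auto intro!: sum.cong)
    then show ?thesis
      using int by (subst Bochner_Integration.integral_sum) (auto intro!: Bochner_Integration.integrable_sum)
  qed
  also have "\<dots> = (\<Sum>e \<in> verts t. \<rho> (d e) * (card (t.spine_codings e) *
      (\<Prod>v \<in> ?I. pmf (poisson_pmf \<beta>) (card (t.side e v)))))"
    using S(2) by (intro sum.cong refl) (simp add: mult.left_commute)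
  also have "\<dots> = (\<Sum>e \<in> verts t. \<rho> (d e) * (exp (- (real (card (verts t)) - card {v \<in> verts t. d v = h}) * \<beta>) *
      \<beta> ^ (card (verts t) - 1 - d e)))"
    using t.sum_codings_Poisson[of h \<beta>] le fin \<beta> by (intro sum.cong refl) simp
  also have "\<dots> = exp (- (real (card (verts t)) - card {v \<in> verts t. d v = h}) * \<beta>) *
      (\<Sum>e \<in> verts t. \<rho> (d e) * \<beta> ^ (card (verts t) - 1 - d e))"
    unfolding sum_distrib_left by (intro sum.cong refl) simp
  finally show ?thesis by (simp add: E_def)
qed


section \<open>The three regimes\<close>

lemma prob_space_tree0_space: "prob_space tree0_space"
  unfolding tree0_space_def by (rule prob_space_BGWP_family)

text \<open>
  On the infinite spine, the last spine vertex in the ball always lies on the boundary.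
\<close>

lemma prob_tree0_ball:
  fixes t :: "nat rgraph"
  assumes t: "parent_tree t \<pi> d" and le: "\<And>v. v \<in> verts t \<Longrightarrow> d v \<le> h" and fin: "finite (verts t)"
    and \<tau>: "shape t \<in> finite_utrees h"
  shows "card (isos t t) * \<P>(\<omega> in tree0_space. utrunc h (shape (tree0 \<omega>)) = shape t) =
    exp (- (real (card (verts t)) - card {v \<in> verts t. d v = h})) * card {v \<in> verts t. d v = h}"
proof -
  define \<rho> where "\<rho> l = (if l = h then 1 else 0 :: real)" for l
  have ends: "spine_ends h \<infinity> l \<longleftrightarrow> l = h" for l by (auto simp: spine_ends_def)
  note cyl = BGWP_family_cylinder[where \<beta> = 1, folded tree0_space_def]
  have "card (isos t t) * \<P>(\<omega> in tree0_space. utrunc h (shape (grafted_BGW \<infinity> \<omega>)) = shape t) =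
    exp (- (real (card (verts t)) - card {v \<in> verts t. d v = h}) * 1) *
    (\<Sum>e \<in> verts t. \<rho> (d e) * 1 ^ (card (verts t) - 1 - d e))"
  proof (rule prob_limit_ball[OF prob_space_tree0_space t le fin])
    show "{\<omega> \<in> space tree0_space. utrunc h (shape (grafted_BGW \<infinity> \<omega>)) = shape t} \<in> sets tree0_space"
      using measurable_tree0_event[OF \<tau>] by (simp add: tree0_def)
  next
    fix l n and F :: "(nat \<times> nat list) set" assume F: "finite F"
    show "{\<omega> \<in> space tree0_space. spine_ends h \<infinity> l \<and> (\<forall>x\<in>F. \<omega> (fst x) (snd x) = n x)} \<in> sets tree0_space"
      using cyl(1)[OF F, of n] by (cases "l = h") (simp_all add: ends)
    show "measure tree0_space {\<omega> \<in> space tree0_space. spine_ends h \<infinity> l \<and> (\<forall>x\<in>F. \<omega> (fst x) (snd x) = n x)} =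
        \<rho> l * (\<Prod>x\<in>F. pmf (poisson_pmf 1) (n x))"
      using cyl(2)[OF F, of n] by (cases "l = h") (simp_all add: ends \<rho>_def)
  qed simp_all
  also have "(\<Sum>e \<in> verts t. \<rho> (d e) * 1 ^ (card (verts t) - 1 - d e)) = card {v \<in> verts t. d v = h}"
    using fin by (simp add: \<rho>_def sum.If_cases Int_def)
  finally show ?thesis by (simp add: tree0_def)
qed

lemma prob_spine_length_greater:
  assumes "\<alpha> > 0"
  shows "measure_pmf.prob (spine_length \<alpha>) {h<..} = (1 / (1 + \<alpha>)) ^ h"
proof -
  define \<beta> where "\<beta> = 1 / (1 + \<alpha>)"
  have \<beta>: "\<alpha> * \<beta> = 1 - \<beta>" using assms by (simp add: \<beta>_def field_simps)
  have pmf: "pmf (spine_length \<alpha>) (Suc i) = (1 - \<beta>) * \<beta> ^ i" for i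
    using pmf_spine_length[OF assms, of "Suc i"] by (simp add: \<beta>[symmetric]) (simp add: \<beta>_def power_one_over)
  have zero: "pmf (spine_length \<alpha>) 0 = 0"
    by (simp add: spine_length_def pmf_eq_0_set_pmf)
  have "measure_pmf.prob (spine_length \<alpha>) {..h} = 1 - \<beta> ^ h"
  proof (induction h)
    case 0
    then show ?case by (simp add: zero measure_measure_pmf_finite)
  next
    case (Suc h)
    then show ?case by (simp add: measure_measure_pmf_finite pmf algebra_simps)
  qed
  moreover have "{h<..} = - {..h}" by auto
  ultimately show ?thesis
    using measure_pmf.prob_compl[of "{..h}" "spine_length \<alpha>"] by (simp add: \<beta>_def Compl_eq_Diff_UNIV)
qed

lemma prob_tree_alpha_ball:
  fixes t :: "nat rgraph"
  assumes t: "parent_tree t \<pi> d" and le: "\<And>v. v \<in> verts t \<Longrightarrow> d v \<le> h" and fin: "finite (verts t)"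
    and \<tau>: "shape t \<in> finite_utrees h" and \<alpha>: "\<alpha> > 0"
  defines "\<beta> \<equiv> 1 / (1 + \<alpha>)" and "a \<equiv> card (verts t)" and "k \<equiv> card {v \<in> verts t. d v = h}"
  shows "card (isos t t) * \<P>(\<omega> in tree_alpha_space \<alpha>. utrunc h (shape (tree_alpha \<omega>)) = shape t) =
    exp (- (real a - k) * \<beta>) * (a * (1 - \<beta>) + k * \<beta>) * \<beta> ^ (a - 1)"
proof -
  interpret t: parent_tree t \<pi> d by fact
  let ?P = "\<Pi>\<^sub>M i \<in> (UNIV :: nat set). BGWP \<beta>"
  interpret P: prob_space ?P by (rule prob_space_BGWP_family)
  interpret PP: pair_prob_space "measure_pmf (spine_length \<alpha>)" ?P ..
  have space: "tree_alpha_space \<alpha> = measure_pmf (spine_length \<alpha>) \<Otimes>\<^sub>M ?P"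
    by (simp add: tree_alpha_space_def \<beta>_def)
  have \<beta>0: "\<beta> > 0" using \<alpha> by (simp add: \<beta>_def)
  have \<alpha>\<beta>: "\<alpha> * \<beta> = 1 - \<beta>" using \<alpha> by (simp add: \<beta>_def field_simps)
  define \<rho> where "\<rho> l = (if l < h then \<alpha> * \<beta> ^ Suc l else if l = h then \<beta> ^ h else 0)" for l
  define Ls where "Ls l = {L. spine_ends h (enat L) l}" for l
  have Ls: "measure_pmf.prob (spine_length \<alpha>) (Ls l) = \<rho> l" for l
  proof -
    consider "l < h" | "l = h" | "h < l" by linarith
    then show ?thesis
    proof cases
      case 1
      then have "Ls l = {Suc l}" by (auto simp: Ls_def spine_ends_def)
      then show ?thesis using 1 pmf_spine_length[OF \<alpha>, of "Suc l"]
        by (simp add: \<rho>_def measure_pmf_single \<beta>_def power_one_over)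
    next
      case 2
      then have "Ls l = {h<..}" by (auto simp: Ls_def spine_ends_def)
      then show ?thesis using 2 prob_spine_length_greater[OF \<alpha>] by (simp add: \<rho>_def \<beta>_def)
    next
      case 3
      then have "Ls l = {}" by (auto simp: Ls_def spine_ends_def)
      then show ?thesis using 3 by (simp add: \<rho>_def)
    qed
  qed
  have rect: "{w \<in> space (tree_alpha_space \<alpha>). spine_ends h (enat (fst w)) l \<and> (\<forall>x\<in>F. snd w (fst x) (snd x) = n x)} =
      Ls l \<times> {\<omega> \<in> space ?P. \<forall>x\<in>F. \<omega> (fst x) (snd x) = n x}" for l F n
    by (auto simp: space space_pair_measure Ls_def)
  have tree: "tree_alpha w = grafted_BGW (enat (fst w)) (snd w)" for w
    by (cases w) (simp add: tree_alpha_def)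
  have prob: "prob_space (tree_alpha_space \<alpha>)" unfolding space by (rule PP.prob_space_axioms)
  have "card (isos t t) * \<P>(w in tree_alpha_space \<alpha>. utrunc h (shape (grafted_BGW (enat (fst w)) (snd w))) = shape t) =
    exp (- (real (card (verts t)) - card {v \<in> verts t. d v = h}) * \<beta>) *
    (\<Sum>e \<in> verts t. \<rho> (d e) * \<beta> ^ (card (verts t) - 1 - d e))"
  proof (rule prob_limit_ball[OF prob t le fin \<beta>0])
    show "{w \<in> space (tree_alpha_space \<alpha>). utrunc h (shape (grafted_BGW (enat (fst w)) (snd w))) = shape t}
        \<in> sets (tree_alpha_space \<alpha>)"
      using measurable_tree_alpha_event[OF \<tau>, of \<alpha>] by (simp add: tree)
    have "AE L in measure_pmf (spine_length \<alpha>). L > 0"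
      by (auto simp: AE_measure_pmf_iff spine_length_def)
    moreover have "{w \<in> space (measure_pmf (spine_length \<alpha>) \<Otimes>\<^sub>M ?P). fst w > 0} = {0<..} \<times> space ?P"
      by (auto simp: space_pair_measure)
    then have "{w \<in> space (measure_pmf (spine_length \<alpha>) \<Otimes>\<^sub>M ?P). fst w > 0}
        \<in> sets (measure_pmf (spine_length \<alpha>) \<Otimes>\<^sub>M ?P)"
      by (simp add: pair_measureI)
    ultimately have "AE w in measure_pmf (spine_length \<alpha>) \<Otimes>\<^sub>M ?P. fst w > 0"
      by (intro PP.AE_pair_measure) auto
    then show "AE w in tree_alpha_space \<alpha>. enat (fst w) > 0" unfolding space zero_enat_def by simp
  next
    fix l n and F :: "(nat \<times> nat list) set" assume F: "finite F"
    note cyl = BGWP_family_cylinder[OF F, of \<beta> n]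
    show "{w \<in> space (tree_alpha_space \<alpha>). spine_ends h (enat (fst w)) l \<and> (\<forall>x\<in>F. snd w (fst x) (snd x) = n x)}
        \<in> sets (tree_alpha_space \<alpha>)"
      unfolding rect unfolding space using cyl(1) by (intro pair_measureI) auto
    have "emeasure (tree_alpha_space \<alpha>) (Ls l \<times> {\<omega> \<in> space ?P. \<forall>x\<in>F. \<omega> (fst x) (snd x) = n x}) =
        emeasure (measure_pmf (spine_length \<alpha>)) (Ls l) * emeasure ?P {\<omega> \<in> space ?P. \<forall>x\<in>F. \<omega> (fst x) (snd x) = n x}"
      unfolding space using cyl(1) by (intro P.emeasure_pair_measure_Times) auto
    then show "measure (tree_alpha_space \<alpha>) {w \<in> space (tree_alpha_space \<alpha>).
        spine_ends h (enat (fst w)) l \<and> (\<forall>x\<in>F. snd w (fst x) (snd x) = n x)} =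
        \<rho> l * (\<Prod>x\<in>F. pmf (poisson_pmf \<beta>) (n x))"
      unfolding rect using Ls[of l] cyl(2) by (simp add: measure_def enn2real_mult)
  qed
  also have "(\<Sum>e \<in> verts t. \<rho> (d e) * \<beta> ^ (card (verts t) - 1 - d e)) = (a * (1 - \<beta>) + k * \<beta>) * \<beta> ^ (a - 1)"
  proof -
    \<comment> \<open>With \<open>\<alpha> * \<beta> = 1 - \<beta>\<close>, the contribution of \<open>e\<close> depends only on whether \<open>e\<close> is on the boundary.\<close>
    have summand: "\<rho> (d e) * \<beta> ^ (a - 1 - d e) = (if d e = h then 1 else 1 - \<beta>) * \<beta> ^ (a - 1)"
      if e: "e \<in> verts t" for e
    proof -
      have "d e + (a - 1 - d e) = a - 1" using t.sum_card_side[OF e fin] by (simp add: a_def)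
      then have "\<beta> ^ d e * \<beta> ^ (a - 1 - d e) = \<beta> ^ (a - 1)" by (metis power_add)
      then show ?thesis using le[OF e] by (auto simp: \<rho>_def \<alpha>\<beta>[symmetric])
    qed
    have "(\<Sum>e \<in> verts t. \<rho> (d e) * \<beta> ^ (a - 1 - d e)) = (\<Sum>e \<in> verts t. if d e = h then 1 else 1 - \<beta>) * \<beta> ^ (a - 1)"
      unfolding sum_distrib_right using summand by (intro sum.cong refl) blast
    also have "(\<Sum>e \<in> verts t. if d e = h then 1 else 1 - \<beta>) = (\<Sum>e \<in> verts t. (1 - \<beta>) + (if d e = h then \<beta> else 0))"
      by (intro sum.cong) auto
    also have "\<dots> = a * (1 - \<beta>) + k * \<beta>"
      using fin by (simp add: sum.distrib sum.If_cases Int_def a_def k_def)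
    finally show ?thesis by (simp add: a_def)
  qed
  finally show ?thesis by (simp add: tree a_def k_def)
qed

lemma prob_single_vertex_ball:
  fixes t :: "nat rgraph"
  assumes t: "parent_tree t \<pi> d" and fin: "finite (verts t)"
  shows "card (isos t t) * \<P>(s in measure_pmf (return_pmf single_vertex). utrunc h (shape s) = shape t) =
    (if card (verts t) = 1 then 1 else 0)"
proof -
  interpret t: parent_tree t \<pi> d by fact
  have s: "parent_tree single_vertex id (\<lambda>_. 0)" by unfold_locales (auto simp: single_vertex_def)
  interpret s: parent_tree single_vertex id "\<lambda>_. 0" by (rule s)
  have "card (isos t t) * \<P>(s in measure_pmf (return_pmf single_vertex). utrunc h (shape s) = shape t) =
      card (isos t (trunc h single_vertex))"
    unfolding card_isos_trunc[OF s.simple_graph s.root t.simple_graph t.root fin]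
    by (simp add: measure_return_pmf)
  also have "card (isos t (trunc h single_vertex)) = (if card (verts t) = 1 then 1 else 0)"
  proof (cases "card (verts t) = 1")
    case True
    then have V: "verts t = {rt t}" using t.root by (metis card_1_singletonE singletonD)
    then have "isos t (trunc h single_vertex) = {restrict (\<lambda>_. 0) {rt t}}"
      using s.verts_trunc[of h] parent_tree.edges[OF s.parent_tree_trunc, of h] s.rt_trunc[of h] t.edges
      by (auto simp: isos_def single_vertex_def extensional_def fun_eq_iff bij_betw_def)
    then show ?thesis using True by simp
  next
    case False
    have "isos t (trunc h single_vertex) = {}"
    proof (rule ccontr)
      assume "isos t (trunc h single_vertex) \<noteq> {}"
      then obtain \<phi> where "bij_betw \<phi> (verts t) (verts (trunc h single_vertex))" by (auto simp: isos_def)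
      then have "card (verts t) = card (verts (trunc h single_vertex))" by (rule bij_betw_same_card)
      then show False using False by (simp add: s.verts_trunc) (simp add: single_vertex_def)
    qed
    then show ?thesis using False by simp
  qed
  finally show ?thesis by simp
qed

text \<open>
  A limit is identified by its ball probabilities, and these depend on \<open>lam\<close> only through the limit \<open>\<beta>\<close> of
  \<open>n / (lam n + n)\<close>.
\<close>

lemma converges_locally_massive_SF:
  fixes lam :: "nat \<Rightarrow> real" and \<beta> :: real and M' :: "'b measure"
  assumes lam: "\<And>n. n \<ge> 1 \<Longrightarrow> lam n > 0" and \<beta>: "(\<lambda>n. n / (lam n + n)) \<longlonglongrightarrow> \<beta>"
    and limit: "\<And>h (t :: nat rgraph) \<pi> d. parent_tree t \<pi> d \<Longrightarrow> (\<And>v. v \<in> verts t \<Longrightarrow> d v \<le> h) \<Longrightarrow>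
      finite (verts t) \<Longrightarrow> shape t \<in> finite_utrees h \<Longrightarrow>
      card (isos t t) * \<P>(\<omega> in M'. utrunc h (X' \<omega>) = shape t) =
      exp (- (real (card (verts t)) - card {v \<in> verts t. d v = h}) * \<beta>) *
      (card (verts t) * (1 - \<beta>) + card {v \<in> verts t. d v = h} * \<beta>) * \<beta> ^ (card (verts t) - 1)"
  shows "converges_locally (\<lambda>n. measure_pmf (massive_SF (lam n) (complete_graph n)))
    (\<lambda>n f. shape (rooted_component f 0)) M' X'"
  unfolding converges_locally_def
proof (intro allI ballI)
  fix h \<tau> assume \<tau>: "\<tau> \<in> finite_utrees h"
  then obtain t :: "nat rgraph" where t: "\<tau> = shape t" "rooted_tree t" "finite (verts t)" "height_le t h"
    by (auto simp: finite_utrees_def)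
  obtain \<pi> d where pt: "parent_tree t \<pi> d" using rooted_tree_imp_parent_tree[OF t(2)] by blast
  interpret t: parent_tree t \<pi> d by (rule pt)
  have le: "d v \<le> h" if "v \<in> verts t" for v using t(4) that by (simp add: t.height_le_iff)
  define \<sigma> where "\<sigma> = real (card (isos t t))"
  define a where "a = card (verts t)"
  define k where "k = card {v \<in> verts t. d v = h}"
  have \<sigma>: "\<sigma> > 0" using card_isos_pos[OF t.simple_graph t.root t(3)] by (simp add: \<sigma>_def)
  have a: "a > 0" using t.root t(3) by (auto simp: a_def card_gt_0_iff)
  have ka: "k \<le> a" unfolding k_def a_def using t(3) by (intro card_mono) auto
  let ?p = "\<lambda>n. \<P>(f in measure_pmf (massive_SF (lam n) (complete_graph n)).
      utrunc h (shape (rooted_component f 0)) = \<tau>)"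
  have "eventually (\<lambda>n. real (\<Prod>i<a - 1. n - 1 - i) * (lam n + k + real (n - a)) ^ (n - a - 1) *
      (a * (lam n + k) + real (n - a) * k) / (lam n + n) ^ (n - 1) = \<sigma> * ?p n) sequentially"
    using eventually_gt_at_top[of a]
  proof eventually_elim
    case (elim n)
    then show ?case
      using prob_massive_SF_ball[OF pt le t(3), of n "lam n"] lam[of n]
      by (simp add: \<sigma>_def a_def k_def t(1))
  qed
  with limit_ball_formula[of lam a k \<beta>, OF _ a ka \<beta>] lam
  have "(\<lambda>n. \<sigma> * ?p n) \<longlonglongrightarrow> exp (- (real a - k) * \<beta>) * (a * (1 - \<beta>) + k * \<beta>) * \<beta> ^ (a - 1)"
    by (blast intro: Lim_transform_eventually)
  also have "exp (- (real a - k) * \<beta>) * (a * (1 - \<beta>) + k * \<beta>) * \<beta> ^ (a - 1) =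
      \<sigma> * \<P>(\<omega> in M'. utrunc h (X' \<omega>) = \<tau>)"
    using limit[OF pt le t(3)] \<tau> by (simp add: \<sigma>_def a_def k_def t(1))
  finally have "(\<lambda>n. \<sigma> * ?p n / \<sigma>) \<longlonglongrightarrow> \<sigma> * \<P>(\<omega> in M'. utrunc h (X' \<omega>) = \<tau>) / \<sigma>"
    by (intro tendsto_divide tendsto_const) (use \<sigma> in auto)
  then show "?p \<longlonglongrightarrow> \<P>(\<omega> in M'. utrunc h (X' \<omega>) = \<tau>)" using \<sigma> by simp
qed

lemma tendsto_ratio:
  fixes lam :: "nat \<Rightarrow> real" and l :: real
  assumes "(\<lambda>n. lam n / n) \<longlonglongrightarrow> l" "l \<ge> 0"
  shows "(\<lambda>n. n / (lam n + n)) \<longlonglongrightarrow> 1 / (1 + l)"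
proof -
  have "(\<lambda>n. 1 / (1 + lam n / n)) \<longlonglongrightarrow> 1 / (1 + l)"
    using assms by (intro tendsto_intros) auto
  moreover have "eventually (\<lambda>n. 1 / (1 + lam n / n) = n / (lam n + n)) sequentially"
    using eventually_gt_at_top[of 0] by eventually_elim (simp add: field_simps)
  ultimately show ?thesis by (rule Lim_transform_eventually)
qed

theorem theorem1p1:
  fixes \<alpha> :: real and lam :: "nat \<Rightarrow> real"
  assumes "\<alpha> > 0"
    and "\<And>n. n \<ge> 1 \<Longrightarrow> lam n > 0"
  shows
    "(lam \<in> o(\<lambda>n. real n) \<longrightarrow>
       converges_locally (\<lambda>n. measure_pmf (massive_SF (lam n) (complete_graph n)))
         (\<lambda>n f. shape (rooted_component f 0))
         tree0_space (\<lambda>\<omega>. shape (tree0 \<omega>))) \<and>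
     (lam \<sim>[at_top] (\<lambda>n. \<alpha> * real n) \<longrightarrow>
       converges_locally (\<lambda>n. measure_pmf (massive_SF (lam n) (complete_graph n)))
         (\<lambda>n f. shape (rooted_component f 0))
         (tree_alpha_space \<alpha>) (\<lambda>\<omega>. shape (tree_alpha \<omega>))) \<and>
     (filterlim (\<lambda>n. lam n / real n) at_top at_top \<longrightarrow>
       converges_locally (\<lambda>n. measure_pmf (massive_SF (lam n) (complete_graph n)))
         (\<lambda>n f. shape (rooted_component f 0))
         (measure_pmf (return_pmf single_vertex)) shape)"
proof (intro conjI impI)
  assume "lam \<in> o(\<lambda>n. real n)"
  then have "(\<lambda>n. lam n / n) \<longlonglongrightarrow> 0" by (rule smalloD_tendsto)
  then have "(\<lambda>n. n / (lam n + n)) \<longlonglongrightarrow> 1" using tendsto_ratio[of lam 0] by simp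
  then show "converges_locally (\<lambda>n. measure_pmf (massive_SF (lam n) (complete_graph n)))
      (\<lambda>n f. shape (rooted_component f 0)) tree0_space (\<lambda>\<omega>. shape (tree0 \<omega>))"
    by (intro converges_locally_massive_SF[where \<beta> = 1] assms(2)) (simp_all add: prob_tree0_ball)
next
  assume "lam \<sim>[at_top] (\<lambda>n. \<alpha> * real n)"
  then have "(\<lambda>n. lam n / (\<alpha> * real n)) \<longlonglongrightarrow> 1"
    by (rule asymp_equivD_strong) (use assms(1) in \<open>auto intro: eventually_mono[OF eventually_gt_at_top[of 0]]\<close>)
  then have "(\<lambda>n. \<alpha> * (lam n / (\<alpha> * real n))) \<longlonglongrightarrow> \<alpha> * 1" by (intro tendsto_intros)
  then have "(\<lambda>n. lam n / n) \<longlonglongrightarrow> \<alpha>" using assms(1) by simp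
  then have "(\<lambda>n. n / (lam n + n)) \<longlonglongrightarrow> 1 / (1 + \<alpha>)" using assms(1) by (intro tendsto_ratio) auto
  then show "converges_locally (\<lambda>n. measure_pmf (massive_SF (lam n) (complete_graph n)))
      (\<lambda>n f. shape (rooted_component f 0)) (tree_alpha_space \<alpha>) (\<lambda>\<omega>. shape (tree_alpha \<omega>))"
    by (intro converges_locally_massive_SF[where \<beta> = "1 / (1 + \<alpha>)"] assms(2))
      (simp_all add: prob_tree_alpha_ball assms(1))
next
  assume "filterlim (\<lambda>n. lam n / real n) at_top at_top"
  then have "filterlim (\<lambda>n. 1 + lam n / real n) at_top at_top"
    by (rule filterlim_tendsto_add_at_top[OF tendsto_const])
  then have "(\<lambda>n. inverse (1 + lam n / real n)) \<longlonglongrightarrow> 0"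
    by (rule tendsto_inverse_0_at_top)
  moreover have "eventually (\<lambda>n. inverse (1 + lam n / n) = n / (lam n + n)) sequentially"
    using eventually_gt_at_top[of 0] by eventually_elim (simp add: field_simps)
  ultimately have lim: "(\<lambda>n. n / (lam n + n)) \<longlonglongrightarrow> 0" by (rule Lim_transform_eventually)
  show "converges_locally (\<lambda>n. measure_pmf (massive_SF (lam n) (complete_graph n)))
      (\<lambda>n f. shape (rooted_component f 0)) (measure_pmf (return_pmf single_vertex)) shape"
  proof (rule converges_locally_massive_SF[where lam = lam and \<beta> = 0])
    show "lam n > 0" if "n \<ge> 1" for n using assms(2) that .
    show "(\<lambda>n. n / (lam n + n)) \<longlonglongrightarrow> 0" by (rule lim)
    fix h and t :: "nat rgraph" and \<pi> d
    assume t: "parent_tree t \<pi> d" "finite (verts t)"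
    then have "card (verts t) > 0" using parent_tree.root by (auto simp: card_gt_0_iff)
    then show "card (isos t t) * \<P>(\<omega> in measure_pmf (return_pmf single_vertex). utrunc h (shape \<omega>) = shape t) =
      exp (- (real (card (verts t)) - card {v \<in> verts t. d v = h}) * 0) *
      (card (verts t) * (1 - 0 :: real) + card {v \<in> verts t. d v = h} * (0 :: real)) *
      (0 :: real) ^ (card (verts t) - 1)"
      unfolding prob_single_vertex_ball[OF t] by (cases "card (verts t) - 1") auto
  qed
qed

end
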